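(* Let $|\psi\rangle$ be a pure $L$-qubit state of the form $$\rho=|\psi\rangle\langle\psi|=\frac{1}{2^{L}}\Big(\mathbb 1+\frac{\bar Z-\bar Y}{\sqrt 2}\Big)\prod_{j=2}^{L}(\mathbb 1+g_j),$$ where $\mathcal G=\langle g_2,\dots,g_L\rangle$ is the stabilizer group of a stabilizer code encoding one logical qubit, with logical operators $\bar X,\bar Y,\bar Z$. Let $A\subset\{1,\dots,L\}$ be a subsystem, $B$ its complement, and $\rho_A=\mathrm{Tr}_B\,\rho$. Then the following three statements are equivalent: (a) magic resource is unitarily-extractable from $A$; (b) $\mathcal R(\rho_A)>1$; (c) all three logical operators $\bar X,\bar Y,\bar Z$ are reducible to $A$.
   Context: Hermitian Pauli operators on $L$ qubits are $\pm$ tensor products of single-qubit operators from $\{\mathbb 1,X,Y,Z\}$; such an operator is supported on a set $S$ of qubits if it acts as the identity on all qubits outside $S$. Stabilizer code encoding one logical qubit: an abelian group $\mathcal G$ of Hermitian Pauli operators on $L$ qubits with $-\mathbb 1\notin\mathcal G$, generated by $L-1$ independent elements $g_2,\dots,g_L$. Logical operators are Hermitian Pauli operators that commute with every element of $\mathcal G$ and do not lie in $\pm\mathcal G$. $\bar X,\bar Y,\bar Z$ are logical operators that pairwise anticommute, with $\bar Y=i\bar X\bar Z$. A logical operator $\bar\sigma$ is reducible to a set of qubits $S$ if there is $g\in\mathcal G$ such that $g\bar\sigma$ is supported on $S$. Robustness of magic of a state $\rho$ on $n$ qubits: $\mathcal R(\rho)=\min\{\sum_i|x_i| : \rho=\sum_i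 x_i\sigma_i,\ x_i\in\mathbb R,\ \sum_i x_i=1\}$, where $\sigma_i$ ranges over (the density matrices of) all pure $n$-qubit stabilizer states. Unitarily-extractable magic resource: let $C$ be an ancilla qubit initialized in $|0\rangle_C$. Magic resource is unitarily-extractable from $A$ if there exists a Clifford unitary $U=\mathbb 1_B\otimes U_{AC}$, acting non-trivially only on $A$ and $C$, such that $U(|\psi\rangle\otimes|0\rangle_C)=|\psi'\rangle_{AB}\otimes|\psi'\rangle_C$ for some pure states $|\psi'\rangle_{AB}$ of the $L$ qubits and $|\psi'\rangle_C$ of the ancilla with $\mathcal R(|\psi'\rangle_C)>1$. *)

theory Defs
  imports
    Complex_Main
    "HOL-Algebra.Generated_Groups"
    "Jordan_Normal_Form.Schur_Decomposition"
begin

text \<open>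
  The qubits of an \<open>n\<close>-qubit register are labelled \<open>0, \<dots>, n - 1\<close>.  Vectors and operators
  have dimension \<open>2 ^ n\<close>, and bit \<open>k\<close> of a basis index is the value of qubit \<open>k\<close>.
\<close>

section \<open>Pauli operators\<close>

datatype pauli = PI | PX | PY | PZ

fun pauli_matrix :: "pauli \<Rightarrow> complex mat" where
  "pauli_matrix PI = mat_of_rows_list 2 [[1, 0], [0, 1]]"
| "pauli_matrix PX = mat_of_rows_list 2 [[0, 1], [1, 0]]"
| "pauli_matrix PY = mat_of_rows_list 2 [[0, - \<i>], [\<i>, 0]]"
| "pauli_matrix PZ = mat_of_rows_list 2 [[1, 0], [0, - 1]]"

text \<open>Entrywise form of the tensor product of the single-qubit operators \<open>P k\<close>, \<open>k < n\<close>.\<close>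

definition pauli_string :: "nat \<Rightarrow> (nat \<Rightarrow> pauli) \<Rightarrow> complex mat" where
  "pauli_string n P = mat (2 ^ n) (2 ^ n)
     (\<lambda>(i, j). \<Prod>k<n. pauli_matrix (P k) $$ (of_bool (bit i k), of_bool (bit j k)))"

definition hermitian_paulis :: "nat \<Rightarrow> complex mat set" where
  "hermitian_paulis n = {s \<cdot>\<^sub>m pauli_string n P | s P. s \<in> {1, - 1}}"

definition pauli_group :: "nat \<Rightarrow> complex mat monoid" where
  "pauli_group n =
     \<lparr>carrier = {s \<cdot>\<^sub>m pauli_string n P | s P. s \<in> {1, - 1, \<i>, - \<i>}},
      monoid.mult = (*), one = 1\<^sub>m (2 ^ n)\<rparr>"

definition supported_on :: "nat \<Rightarrow> nat set \<Rightarrow> complex mat \<Rightarrow> bool" where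
  "supported_on n S M \<longleftrightarrow>
     (\<exists>s P. s \<in> {1, - 1} \<and> M = s \<cdot>\<^sub>m pauli_string n P \<and> (\<forall>k<n. k \<notin> S \<longrightarrow> P k = PI))"

section \<open>Stabilizer groups and logical operators\<close>

text \<open>The family \<open>(g j)\<close>, \<open>j \<in> J\<close>, independently generates the stabilizer group \<open>G\<close>.
  Independence makes \<open>g\<close> injective on \<open>J\<close>.\<close>

definition stabilizer_group :: "nat \<Rightarrow> 'i set \<Rightarrow> ('i \<Rightarrow> complex mat) \<Rightarrow> complex mat set \<Rightarrow> bool" where
  "stabilizer_group n J g G \<longleftrightarrow>
     g ` J \<subseteq> hermitian_paulis n \<and>
     G = generate (pauli_group n) (g ` J) \<and>
     (\<forall>j\<in>J. g j \<notin> generate (pauli_group n) (g ` (J - {j}))) \<and>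
     G \<subseteq> hermitian_paulis n \<and>
     (\<forall>a\<in>G. \<forall>b\<in>G. a * b = b * a) \<and>
     - 1\<^sub>m (2 ^ n) \<notin> G"

definition logical_operators :: "nat \<Rightarrow> complex mat set \<Rightarrow> complex mat set" where
  "logical_operators n G =
     {s \<in> hermitian_paulis n. (\<forall>h\<in>G. s * h = h * s) \<and> s \<notin> G \<and> - s \<notin> G}"

definition reducible_to :: "nat \<Rightarrow> complex mat set \<Rightarrow> complex mat \<Rightarrow> nat set \<Rightarrow> bool" where
  "reducible_to n G s S \<longleftrightarrow> (\<exists>h\<in>G. supported_on n S (h * s))"

section \<open>States, subsystems and Clifford unitaries\<close>

definition pure_state :: "nat \<Rightarrow> complex vec \<Rightarrow> bool" where
  "pure_state n v \<longleftrightarrow> v \<in> carrier_vec (2 ^ n) \<and> v \<bullet>c v = 1"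

definition density :: "complex vec \<Rightarrow> complex mat" where
  "density v = mat (dim_vec v) (dim_vec v) (\<lambda>(i, j). v $ i * cnj (v $ j))"

text \<open>The restriction of a basis index to the qubits in a finite set \<open>S\<close>, as a basis index of
  \<open>card S\<close> qubits: the qubits of \<open>S\<close> are relabelled \<open>0, \<dots>, card S - 1\<close> in increasing order.\<close>

definition restrict_bits :: "nat set \<Rightarrow> nat \<Rightarrow> nat" where
  "restrict_bits S i = horner_sum of_bool 2 (map (bit i) (sorted_list_of_set S))"

text \<open>In the next three definitions \<open>S \<subseteq> {..<n}\<close>, with complement \<open>{..<n} - S\<close>:
  the vector \<open>u\<close> on \<open>S\<close> tensored with \<open>v\<close> on the complement, the operator \<open>V\<close> on \<open>S\<close> tensored
  with the identity on the complement, and the trace over the complement.\<close>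

definition tensor_vec :: "nat \<Rightarrow> nat set \<Rightarrow> complex vec \<Rightarrow> complex vec \<Rightarrow> complex vec" where
  "tensor_vec n S u v =
     vec (2 ^ n) (\<lambda>i. u $ restrict_bits S i * v $ restrict_bits ({..<n} - S) i)"

definition embed_operator :: "nat \<Rightarrow> nat set \<Rightarrow> complex mat \<Rightarrow> complex mat" where
  "embed_operator n S V = mat (2 ^ n) (2 ^ n)
     (\<lambda>(i, j). if restrict_bits ({..<n} - S) i = restrict_bits ({..<n} - S) j
               then V $$ (restrict_bits S i, restrict_bits S j) else 0)"

definition reduced_state :: "nat \<Rightarrow> nat set \<Rightarrow> complex mat \<Rightarrow> complex mat" where
  "reduced_state n S M = mat (2 ^ card S) (2 ^ card S)
     (\<lambda>(a, b). \<Sum>(i, j) \<in> {(i, j). i < 2 ^ n \<and> j < 2 ^ n \<and>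
                 restrict_bits S i = a \<and> restrict_bits S j = b \<and>
                 restrict_bits ({..<n} - S) i = restrict_bits ({..<n} - S) j}. M $$ (i, j))"

definition clifford :: "nat \<Rightarrow> complex mat \<Rightarrow> bool" where
  "clifford n U \<longleftrightarrow>
     U \<in> carrier_mat (2 ^ n) (2 ^ n) \<and>
     U * mat_adjoint U = 1\<^sub>m (2 ^ n) \<and> mat_adjoint U * U = 1\<^sub>m (2 ^ n) \<and>
     (\<forall>P\<in>hermitian_paulis n. U * P * mat_adjoint U \<in> hermitian_paulis n)"

section \<open>Robustness of magic\<close>

definition stabilizer_states :: "nat \<Rightarrow> complex mat set" where
  "stabilizer_states n =
     {density v | v. pure_state n v \<and>
        (\<exists>g G. stabilizer_group n {1..n} g G \<and> (\<forall>h\<in>G. h *\<^sub>v v = v))}"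

text \<open>Stabilizer states outside \<open>F\<close> have coefficient \<open>0\<close>.  There are finitely many stabilizer
  states, so the minimum over all decompositions is attained and equals the infimum.\<close>

definition robustness :: "nat \<Rightarrow> complex mat \<Rightarrow> real" where
  "robustness n M = Inf {(\<Sum>s\<in>F. \<bar>x s\<bar>) | F x.
     finite F \<and> F \<subseteq> stabilizer_states n \<and>
     M = mat (2 ^ n) (2 ^ n) (\<lambda>(i, j). \<Sum>s\<in>F. complex_of_real (x s) * s $$ (i, j)) \<and>
     (\<Sum>s\<in>F. x s) = 1}"

text \<open>The ancilla \<open>C\<close> is qubit \<open>L\<close> of an \<open>(L + 1)\<close>-qubit register.\<close>

definition unitarily_extractable :: "nat \<Rightarrow> nat set \<Rightarrow> complex vec \<Rightarrow> bool" where
  "unitarily_extractable L A \<psi> \<longleftrightarrow>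
     (\<exists>U V \<phi> \<chi>.
        clifford (L + 1) U \<and>
        V \<in> carrier_mat (2 ^ (card A + 1)) (2 ^ (card A + 1)) \<and>
        U = embed_operator (L + 1) (insert L A) V \<and>
        pure_state L \<phi> \<and> pure_state 1 \<chi> \<and>
        U *\<^sub>v tensor_vec (L + 1) {..<L} \<psi> (unit_vec 2 0) = tensor_vec (L + 1) {..<L} \<phi> \<chi> \<and>
        robustness 1 (density \<chi>) > 1)"

end

theory Submission
  imports Defs
begin

text \<open>
  \<^bold>\<open>Idea.\<close> Write \<open>\<rho> = (1 + (Z - Y) / \<surd>2) T\<close>, where \<open>T\<close> is the normalised sum of the stabilizer
  group.  The partial trace keeps exactly the Pauli terms supported on \<open>A\<close>, so it replaces \<open>T\<close> by
  the normalised sum \<open>T\<^sub>A\<close> of the subgroup supported on \<open>A\<close>, and keeps the \<open>Z\<close>-term or the \<open>Y\<close>-term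
  iff that logical operator is reducible to \<open>A\<close>.

  If both survive, \<open>tr (Z\<^sub>A \<sigma>) - tr (Y\<^sub>A \<sigma>)\<close> is a magic witness: a stabilizer state has nonzero
  expectation for at most one of two anticommuting Pauli operators, so the witness is bounded by \<open>1\<close> on
  stabilizer states, while it equals \<open>\<surd>2\<close> on \<open>\<rho>\<^sub>A\<close>.  If at most one survives, \<open>\<rho>\<^sub>A\<close> is a convex
  combination of normalised sums of isotropic groups, and such sums are mixtures of stabilizer states.

  If the logical operators are reducible, swapping the logical qubit, represented on \<open>A\<close>, with the
  ancilla is a Clifford unitary and moves the magic state to the ancilla.  Conversely, in the Heisenberg
  picture the Bloch components of the extracted ancilla state are expectations of pairwise
  anticommuting Pauli operators on \<open>A\<close> and the ancilla.  Two of them can be nonzero only if both \<open>Z\<close>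
  and \<open>Y\<close> are reducible to \<open>A\<close>; otherwise the Bloch vector of the pure ancilla state lies on a
  coordinate axis and the state is a stabilizer state.
\<close>

section \<open>Basis indices and subsystems\<close>

lemma one_smult_mat [simp]: "(1::complex) \<cdot>\<^sub>m A = A"
  by (intro eq_matI) auto

lemma smult_smult_mat [simp]: "a \<cdot>\<^sub>m (b \<cdot>\<^sub>m A) = (a * b :: complex) \<cdot>\<^sub>m A"
  by (intro eq_matI) auto

definition glue_bits :: "nat \<Rightarrow> nat set \<Rightarrow> nat \<Rightarrow> nat \<Rightarrow> nat" where
  "glue_bits n S a c =
     inv_into {..<2 ^ n} (\<lambda>i. (restrict_bits S i, restrict_bits ({..<n} - S) i)) (a, c)"

lemma bit_restrict_bits:
  "finite S \<Longrightarrow> bit (restrict_bits S i) k \<longleftrightarrow> k < card S \<and> bit i (sorted_list_of_set S ! k)"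
  unfolding restrict_bits_def by (auto simp: bit_horner_sum_bit_iff)

lemma restrict_bits_less: "finite S \<Longrightarrow> restrict_bits S i < 2 ^ card S"
proof -
  assume "finite S"
  then have "take_bit (card S) (restrict_bits S i) = restrict_bits S i"
    by (auto simp: bit_eq_iff bit_take_bit_iff bit_restrict_bits)
  then show ?thesis by (metis take_bit_nat_less_exp)
qed

lemma restrict_bits_singleton: "restrict_bits {k} i = of_bool (bit i k)"
  unfolding restrict_bits_def by simp

lemma bij_betw_sorted_list_of_set_nth:
  "finite S \<Longrightarrow> bij_betw (\<lambda>k. sorted_list_of_set S ! k) {..<card S} S"
  by (rule bij_betw_nth) auto

lemma restrict_bits_eq_iff:
  assumes "finite S"
  shows "restrict_bits S i = restrict_bits S j \<longleftrightarrow> (\<forall>k\<in>S. bit i k = bit j k)"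
proof -
  have "restrict_bits S i = restrict_bits S j \<longleftrightarrow>
      (\<forall>k\<in>{..<card S}. bit i (sorted_list_of_set S ! k) = bit j (sorted_list_of_set S ! k))"
    by (auto simp: bit_eq_iff bit_restrict_bits assms)
  also have "\<dots> \<longleftrightarrow> (\<forall>k\<in>S. bit i k = bit j k)"
    using bij_betw_sorted_list_of_set_nth[OF assms, THEN bij_betw_imp_surj_on]
    by (metis (no_types, lifting) imageE image_eqI)
  finally show ?thesis .
qed

lemma nat_eq_iff_bits:
  assumes "i < 2 ^ n" "j < 2 ^ n"
  shows "i = (j::nat) \<longleftrightarrow> (\<forall>k<n. bit i k = bit j k)"
proof -
  have "take_bit n i = i" "take_bit n j = j" using assms by (simp_all add: take_bit_nat_eq_self)
  then show ?thesis by (metis bit_eq_iff bit_take_bit_iff)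
qed

lemma bij_betw_restrict_bits:
  assumes "S \<subseteq> {..<n}"
  shows "bij_betw (\<lambda>i. (restrict_bits S i, restrict_bits ({..<n} - S) i)) {..<2 ^ n}
    ({..<2 ^ card S} \<times> {..<2 ^ card ({..<n} - S)})"
proof -
  let ?f = "\<lambda>i. (restrict_bits S i, restrict_bits ({..<n} - S) i)"
  have fin: "finite S" using assms finite_subset by blast
  have inj: "inj_on ?f {..<2 ^ n}"
  proof (rule inj_onI)
    fix i j :: nat assume ij: "i \<in> {..<2 ^ n}" "j \<in> {..<2 ^ n}" "?f i = ?f j"
    then have "\<forall>k\<in>S \<union> ({..<n} - S). bit i k = bit j k"
      by (auto simp: restrict_bits_eq_iff fin)
    then show "i = j" using ij by (subst nat_eq_iff_bits[of _ n]) auto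
  qed
  have "card S + card ({..<n} - S) = n"
    using assms fin card_mono[OF _ assms] by (simp add: card_Diff_subset)
  then have "card ({..<(2::nat) ^ card S} \<times> {..<(2::nat) ^ card ({..<n} - S)}) = card {..<(2::nat) ^ n}"
    by (simp add: card_cartesian_product flip: power_add)
  moreover have "?f ` {..<2 ^ n} \<subseteq> {..<2 ^ card S} \<times> {..<2 ^ card ({..<n} - S)}"
    using fin by (auto simp: restrict_bits_less)
  ultimately have "?f ` {..<2 ^ n} = {..<2 ^ card S} \<times> {..<2 ^ card ({..<n} - S)}"
    using card_image[OF inj] by (intro card_subset_eq) simp_all
  then show ?thesis using inj by (simp add: bij_betw_def)
qed

lemma glue_bits:
  assumes "S \<subseteq> {..<n}" "a < 2 ^ card S" "c < 2 ^ card ({..<n} - S)"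
  shows "glue_bits n S a c < 2 ^ n" "restrict_bits S (glue_bits n S a c) = a"
    "restrict_bits ({..<n} - S) (glue_bits n S a c) = c"
proof -
  have *: "(a, c) \<in> (\<lambda>i. (restrict_bits S i, restrict_bits ({..<n} - S) i)) ` {..<2 ^ n}"
    using bij_betw_restrict_bits[OF assms(1)] assms by (simp add: bij_betw_def)
  show "glue_bits n S a c < 2 ^ n" using inv_into_into[OF *] by (simp add: glue_bits_def)
  show "restrict_bits S (glue_bits n S a c) = a"
    "restrict_bits ({..<n} - S) (glue_bits n S a c) = c"
    using f_inv_into_f[OF *] by (simp_all add: glue_bits_def)
qed

lemma glue_bits_restrict_bits:
  assumes "S \<subseteq> {..<n}" "i < 2 ^ n"
  shows "glue_bits n S (restrict_bits S i) (restrict_bits ({..<n} - S) i) = i"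
  unfolding glue_bits_def
  using inv_into_f_f[OF bij_betw_imp_inj_on[OF bij_betw_restrict_bits[OF assms(1)]], of i] assms
  by simp

lemma sum_glue_bits:
  assumes "S \<subseteq> {..<n}"
  shows "(\<Sum>i<(2::nat) ^ n. F i) = (\<Sum>a<2 ^ card S. \<Sum>c<2 ^ card ({..<n} - S). F (glue_bits n S a c))"
proof -
  have "(\<Sum>i<(2::nat) ^ n. F i) = (\<Sum>i<(2::nat) ^ n. (\<lambda>(a, c). F (glue_bits n S a c))
      (restrict_bits S i, restrict_bits ({..<n} - S) i))"
    using assms by (intro sum.cong) (auto simp: glue_bits_restrict_bits)
  also have "\<dots> = (\<Sum>(a, c) \<in> {..<2 ^ card S} \<times> {..<2 ^ card ({..<n} - S)}. F (glue_bits n S a c))"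
    by (rule sum.reindex_bij_betw[OF bij_betw_restrict_bits[OF assms]])
  finally show ?thesis by (simp add: sum.cartesian_product)
qed

lemma sum_prod_bits:
  fixes f :: "nat \<Rightarrow> bool \<Rightarrow> 'a::comm_semiring_1"
  shows "(\<Sum>i<(2::nat) ^ n. \<Prod>k<n. f k (bit i k)) = (\<Prod>k<n. f k False + f k True)"
proof (induction n)
  case (Suc n)
  have split: "{..<(2::nat) ^ Suc n} = {..<2 ^ n} \<union> (\<lambda>i. i + 2 ^ n) ` {..<2 ^ n}"
  proof -
    have "(\<lambda>i. i + 2 ^ n) ` {..<2 ^ n} = {2 ^ n..<2 ^ n + (2::nat) ^ n}"
      using image_add_atLeastLessThan'[of "2 ^ n" 0 "(2::nat) ^ n"]
      unfolding lessThan_atLeast0 by (simp only: add_0)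
    moreover have "{..<2 ^ n} \<union> {2 ^ n..<2 ^ n + (2::nat) ^ n} = {..<2 ^ Suc n}"
      unfolding lessThan_atLeast0 by (subst ivl_disj_un_two(3)) (simp_all only: power_Suc mult_2 zero_le le_add1)
    ultimately show ?thesis by (simp only:)
  qed
  have lo: "\<not> bit i n" if "i < 2 ^ n" for i :: nat
    using that by (metis bit_take_bit_iff less_irrefl take_bit_nat_eq_self)
  have hi: "bit (i + 2 ^ n) k \<longleftrightarrow> bit i k \<or> k = n" if "i < 2 ^ n" for i k :: nat
  proof -
    have "i + 2 ^ n = or i (2 ^ n)"
      by (rule disjunctive_add) (auto simp: bit_exp_iff lo[OF that])
    then show ?thesis by (auto simp: bit_or_iff bit_exp_iff)
  qed
  have "(\<Sum>i<(2::nat) ^ Suc n. \<Prod>k<Suc n. f k (bit i k)) =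
     (\<Sum>i<(2::nat) ^ n. \<Prod>k<Suc n. f k (bit i k)) + (\<Sum>i<(2::nat) ^ n. \<Prod>k<Suc n. f k (bit (i + 2 ^ n) k))"
    unfolding split by (subst sum.union_disjoint) (auto simp: sum.reindex inj_on_def)
  also have "\<dots> = (\<Sum>i<(2::nat) ^ n. (\<Prod>k<n. f k (bit i k)) * f n False) +
      (\<Sum>i<(2::nat) ^ n. (\<Prod>k<n. f k (bit i k)) * f n True)"
    by (intro arg_cong2[of _ _ _ _ "(+)"] sum.cong)
       (auto simp: lo hi intro!: arg_cong2[of _ _ _ _ "(*)"] prod.cong)
  also have "\<dots> = (\<Sum>i<(2::nat) ^ n. \<Prod>k<n. f k (bit i k)) * (f n False + f n True)"
    by (simp only: sum_distrib_right distrib_left)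
  finally show ?case using Suc by simp
qed simp

section \<open>Pauli strings\<close>

definition pauli_entry :: "pauli \<Rightarrow> bool \<Rightarrow> bool \<Rightarrow> complex" where
  "pauli_entry p a b = (case p of PI \<Rightarrow> of_bool (a = b) | PX \<Rightarrow> of_bool (a \<noteq> b)
     | PY \<Rightarrow> (if a = b then 0 else if a then \<i> else - \<i>)
     | PZ \<Rightarrow> (if a \<noteq> b then 0 else if a then - 1 else 1))"

lemma pauli_matrix_entry:
  "pauli_matrix p $$ (of_bool a, of_bool b) = pauli_entry p a b"
  by (cases p; cases a; cases b) (simp_all add: pauli_entry_def mat_of_rows_list_def)

lemma pauli_string_carrier[simp]: "pauli_string n P \<in> carrier_mat (2 ^ n) (2 ^ n)"
  and pauli_string_dim[simp]: "dim_row (pauli_string n P) = 2 ^ n" "dim_col (pauli_string n P) = 2 ^ n"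
  by (simp_all add: pauli_string_def)

lemma pauli_string_index:
  "i < 2 ^ n \<Longrightarrow> j < 2 ^ n \<Longrightarrow>
    pauli_string n P $$ (i, j) = (\<Prod>k<n. pauli_entry (P k) (bit i k) (bit j k))"
  by (simp add: pauli_string_def pauli_matrix_entry)

lemma pauli_string_cong: "(\<And>k. k < n \<Longrightarrow> P k = Q k) \<Longrightarrow> pauli_string n P = pauli_string n Q"
  by (intro eq_matI) (auto simp: pauli_string_index intro!: prod.cong)

fun pauli_mult :: "pauli \<Rightarrow> pauli \<Rightarrow> pauli" where
  "pauli_mult PI q = q"
| "pauli_mult p PI = p"
| "pauli_mult PX PX = PI" | "pauli_mult PY PY = PI" | "pauli_mult PZ PZ = PI"
| "pauli_mult PX PY = PZ" | "pauli_mult PY PX = PZ"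
| "pauli_mult PY PZ = PX" | "pauli_mult PZ PY = PX"
| "pauli_mult PX PZ = PY" | "pauli_mult PZ PX = PY"

fun pauli_phase :: "pauli \<Rightarrow> pauli \<Rightarrow> complex" where
  "pauli_phase PX PY = \<i>" | "pauli_phase PY PX = - \<i>"
| "pauli_phase PY PZ = \<i>" | "pauli_phase PZ PY = - \<i>"
| "pauli_phase PZ PX = \<i>" | "pauli_phase PX PZ = - \<i>"
| "pauli_phase p q = 1"

lemma pauli_entry_mult:
  "pauli_entry p a False * pauli_entry q False b + pauli_entry p a True * pauli_entry q True b =
    pauli_phase p q * pauli_entry (pauli_mult p q) a b"
  by (cases p; cases q; cases a; cases b) (simp_all add: pauli_entry_def)

lemma pauli_mult_commute: "pauli_mult p q = pauli_mult q p"
  by (cases p; cases q) simp_all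

lemma pauli_mult_eq_PI_iff: "pauli_mult p q = PI \<longleftrightarrow> p = q"
  by (cases p; cases q) simp_all

lemma pauli_phase_self[simp]: "pauli_phase p p = 1"
  by (cases p) simp_all

lemma cnj_pauli_phase: "cnj (pauli_phase p q) = pauli_phase q p"
  by (cases p; cases q) simp_all

lemma times_mat_index:
  "i < dim_row A \<Longrightarrow> j < dim_col B \<Longrightarrow> dim_col A = dim_row B \<Longrightarrow>
    (A * B) $$ (i, j) = (\<Sum>l<dim_row B. A $$ (i, l) * B $$ (l, j))"
  by (simp add: scalar_prod_def lessThan_atLeast0)

lemma pauli_string_mult:
  "pauli_string n P * pauli_string n Q =
    (\<Prod>k<n. pauli_phase (P k) (Q k)) \<cdot>\<^sub>m pauli_string n (\<lambda>k. pauli_mult (P k) (Q k))"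
proof (intro eq_matI)
  fix i j assume "i < dim_row ((\<Prod>k<n. pauli_phase (P k) (Q k)) \<cdot>\<^sub>m pauli_string n (\<lambda>k. pauli_mult (P k) (Q k)))"
    and "j < dim_col ((\<Prod>k<n. pauli_phase (P k) (Q k)) \<cdot>\<^sub>m pauli_string n (\<lambda>k. pauli_mult (P k) (Q k)))"
  then have ij: "i < 2 ^ n" "j < 2 ^ n" by simp_all
  then have "(pauli_string n P * pauli_string n Q) $$ (i, j) =
      (\<Sum>l<(2::nat) ^ n. \<Prod>k<n. pauli_entry (P k) (bit i k) (bit l k) * pauli_entry (Q k) (bit l k) (bit j k))"
    by (auto simp: times_mat_index pauli_string_index prod.distrib simp del: index_mult_mat intro!: sum.cong)
  also have "\<dots> = (\<Prod>k<n. pauli_phase (P k) (Q k) * pauli_entry (pauli_mult (P k) (Q k)) (bit i k) (bit j k))"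
    by (subst sum_prod_bits[where n = n and f = "\<lambda>k b. pauli_entry (P k) (bit i k) b * pauli_entry (Q k) b (bit j k)"])
       (simp add: pauli_entry_mult)
  finally show "(pauli_string n P * pauli_string n Q) $$ (i, j) =
     ((\<Prod>k<n. pauli_phase (P k) (Q k)) \<cdot>\<^sub>m pauli_string n (\<lambda>k. pauli_mult (P k) (Q k))) $$ (i, j)"
    using ij by (simp add: pauli_string_index prod.distrib)
qed simp_all

lemma pauli_string_PI: "pauli_string n (\<lambda>k. PI) = 1\<^sub>m (2 ^ n)"
proof (intro eq_matI)
  fix i j assume "i < dim_row (1\<^sub>m (2 ^ n) :: complex mat)" "j < dim_col (1\<^sub>m (2 ^ n) :: complex mat)"
  then have ij: "i < 2 ^ n" "j < 2 ^ n" by simp_all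
  then show "pauli_string n (\<lambda>k. PI) $$ (i, j) = 1\<^sub>m (2 ^ n) $$ (i, j)"
    by (auto simp: pauli_string_index pauli_entry_def nat_eq_iff_bits[of i n j])
qed simp_all

definition mtrace :: "complex mat \<Rightarrow> complex" where
  "mtrace M = (\<Sum>i<dim_row M. M $$ (i, i))"

lemma mtrace_pauli_string:
  "mtrace (pauli_string n P) = (if \<forall>k<n. P k = PI then 2 ^ n else 0)"
proof -
  have "mtrace (pauli_string n P) = (\<Sum>i<(2::nat) ^ n. \<Prod>k<n. pauli_entry (P k) (bit i k) (bit i k))"
    by (simp add: mtrace_def pauli_string_index)
  also have "\<dots> = (\<Prod>k<n. pauli_entry (P k) False False + pauli_entry (P k) True True)"
    by (rule sum_prod_bits[where n = n and f = "\<lambda>k b. pauli_entry (P k) b b"])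
  also have "\<dots> = (\<Prod>k<n. if P k = PI then 2 else 0)"
    by (intro prod.cong) (auto simp: pauli_entry_def split: pauli.splits)
  also have "\<dots> = (if \<forall>k<n. P k = PI then 2 ^ n else 0)"
    by auto
  finally show ?thesis .
qed

lemma pauli_string_eq_smultD:
  assumes "pauli_string n P = c \<cdot>\<^sub>m pauli_string n Q" "k < n"
  shows "P k = Q k"
proof -
  have "pauli_string n P * pauli_string n P = c \<cdot>\<^sub>m (pauli_string n Q * pauli_string n P)"
    by (subst assms(1)) (rule mult_smult_assoc_mat[OF pauli_string_carrier pauli_string_carrier])
  moreover have "pauli_string n P * pauli_string n P = 1\<^sub>m (2 ^ n)"
    unfolding pauli_string_PI[symmetric] pauli_string_mult
    by (simp add: pauli_string_cong[of n "\<lambda>k. pauli_mult (P k) (P k)" "\<lambda>k. PI"] pauli_mult_eq_PI_iff)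
  ultimately have "1\<^sub>m (2 ^ n) = c \<cdot>\<^sub>m (pauli_string n Q * pauli_string n P)" by simp
  then have "1\<^sub>m (2 ^ n) = (c * (\<Prod>k<n. pauli_phase (Q k) (P k))) \<cdot>\<^sub>m pauli_string n (\<lambda>k. pauli_mult (Q k) (P k))"
    by (simp add: pauli_string_mult )
  then have "mtrace (1\<^sub>m (2 ^ n)) =
      mtrace ((c * (\<Prod>k<n. pauli_phase (Q k) (P k))) \<cdot>\<^sub>m pauli_string n (\<lambda>k. pauli_mult (Q k) (P k)))"
    by simp
  also have "\<dots> = (c * (\<Prod>k<n. pauli_phase (Q k) (P k))) * mtrace (pauli_string n (\<lambda>k. pauli_mult (Q k) (P k)))"
    by (simp add: mtrace_def sum_distrib_left)
  finally have "mtrace (pauli_string n (\<lambda>k. pauli_mult (Q k) (P k))) \<noteq> 0"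
    by (auto simp: mtrace_def)
  then show ?thesis using assms(2) by (metis mtrace_pauli_string pauli_mult_eq_PI_iff)
qed

lemma pauli_string_adjoint_index:
  "i < 2 ^ n \<Longrightarrow> j < 2 ^ n \<Longrightarrow> cnj (pauli_string n P $$ (i, j)) = pauli_string n P $$ (j, i)"
proof -
  have "cnj (pauli_entry p a b) = pauli_entry p b a" for p a b
    by (cases p; cases a; cases b) (simp_all add: pauli_entry_def)
  then show "i < 2 ^ n \<Longrightarrow> j < 2 ^ n \<Longrightarrow> ?thesis" by (simp add: pauli_string_index)
qed

lemma pauli_phase_prod_cases:
  fixes P Q :: "nat \<Rightarrow> pauli" and n :: nat
  defines "z \<equiv> \<Prod>k<n. pauli_phase (P k) (Q k)"
  shows "z = 1 \<or> z = - 1 \<or> z = \<i> \<or> z = - \<i>"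
  unfolding z_def
proof (induction n)
  case (Suc n)
  have "pauli_phase p q = 1 \<or> pauli_phase p q = \<i> \<or> pauli_phase p q = - \<i>" for p q
    by (cases p; cases q) simp_all
  from this[of "P n" "Q n"] Suc show ?case by auto
qed simp

section \<open>Traces and sums of matrices\<close>

lemma mtrace_add: "A \<in> carrier_mat N N \<Longrightarrow> B \<in> carrier_mat N N \<Longrightarrow> mtrace (A + B) = mtrace A + mtrace B"
  by (auto simp: mtrace_def sum.distrib)

lemma mtrace_minus: "A \<in> carrier_mat N N \<Longrightarrow> B \<in> carrier_mat N N \<Longrightarrow> mtrace (A - B) = mtrace A - mtrace B"
  by (auto simp: mtrace_def sum_subtractf)

lemma mtrace_smult: "A \<in> carrier_mat N N \<Longrightarrow> mtrace (c \<cdot>\<^sub>m A) = c * mtrace A"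
  by (auto simp: mtrace_def sum_distrib_left)

lemma mtrace_uminus: "A \<in> carrier_mat N N \<Longrightarrow> mtrace (- A) = - mtrace A"
  by (auto simp: mtrace_def sum_negf)

lemma mtrace_one: "mtrace (1\<^sub>m N) = of_nat N"
  by (simp add: mtrace_def)

lemma mtrace_comm:
  assumes "A \<in> carrier_mat N N" "B \<in> carrier_mat N N"
  shows "mtrace (A * B) = mtrace (B * A)"
proof -
  have "mtrace (A * B) = (\<Sum>i<N. \<Sum>l<N. A $$ (i, l) * B $$ (l, i))"
    using assms by (auto simp: mtrace_def times_mat_index simp del: index_mult_mat(1) intro!: sum.cong)
  also have "\<dots> = (\<Sum>l<N. \<Sum>i<N. B $$ (l, i) * A $$ (i, l))"
    by (subst sum.swap) (simp add: mult.commute)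
  also have "\<dots> = mtrace (B * A)"
    using assms by (auto simp: mtrace_def times_mat_index simp del: index_mult_mat(1) intro!: sum.cong)
  finally show ?thesis .
qed

lemma mtrace_conj_eq_0:
  assumes "A \<in> carrier_mat N N" "Q \<in> carrier_mat N N" "Q * Q = 1\<^sub>m N" "Q * A = - (A * Q)"
  shows "mtrace A = 0"
proof -
  have "mtrace A = mtrace (A * (Q * Q))" using assms by simp
  also have "\<dots> = mtrace (A * Q * Q)" using assms by (simp add: assoc_mult_mat[of _ N N _ N _ N])
  also have "\<dots> = mtrace (Q * (A * Q))" using assms by (subst mtrace_comm) auto
  also have "\<dots> = mtrace (- (A * Q) * Q)" using assms by (simp flip: assoc_mult_mat[of _ N N _ N _ N])
  also have "\<dots> = - mtrace (A * Q * Q)" using assms by (simp add: mtrace_uminus[of _ N])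
  also have "mtrace (A * Q * Q) = mtrace A" using assms by (simp add: assoc_mult_mat[of _ N N _ N _ N])
  finally show ?thesis by simp
qed

lemma smult_mult_mat:
  "dim_col A = dim_row B \<Longrightarrow> (s \<cdot>\<^sub>m A) * B = (s :: complex) \<cdot>\<^sub>m (A * B)"
  by (rule mult_smult_assoc_mat[of _ "dim_row A" "dim_row B" _ "dim_col B"]) (intro carrier_matI; simp)+
lemma mult_smult_mat:
  "dim_col A = dim_row B \<Longrightarrow> A * (s \<cdot>\<^sub>m B) = (s :: complex) \<cdot>\<^sub>m (A * B)"
  by (rule mult_smult_distrib[of _ "dim_row A" "dim_row B" _ "dim_col B"]) (intro carrier_matI; simp)+
lemma smult_mult_smult_mat:
  "dim_col A = dim_row B \<Longrightarrow> (s \<cdot>\<^sub>m A) * (t \<cdot>\<^sub>m B) = (s * t :: complex) \<cdot>\<^sub>m (A * B)"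
  by (simp only: smult_mult_mat mult_smult_mat index_smult_mat smult_smult_mat mult.commute[of t s])

lemma mat_assoc:
  "dim_col A = dim_row B \<Longrightarrow> dim_col B = dim_row C \<Longrightarrow> A * B * C = A * (B * C :: complex mat)"
  by (rule assoc_mult_mat[of _ "dim_row A" "dim_row B" _ "dim_row C" _ "dim_col C"])
    (intro carrier_matI; simp)+

lemma mat_distrib:
  fixes A B C :: "complex mat"
  shows "dim_col A = dim_row B \<Longrightarrow> dim_row C = dim_row B \<Longrightarrow> dim_col C = dim_col B \<Longrightarrow> A * (B + C) = A * B + A * C"
    "dim_col A = dim_row B \<Longrightarrow> dim_row C = dim_row B \<Longrightarrow> dim_col C = dim_col B \<Longrightarrow> A * (B - C) = A * B - A * C"
    "dim_col A = dim_row C \<Longrightarrow> dim_row A = dim_row B \<Longrightarrow> dim_col B = dim_col A \<Longrightarrow> (A + B) * C = A * C + B * C"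
    "dim_col A = dim_row C \<Longrightarrow> dim_row A = dim_row B \<Longrightarrow> dim_col B = dim_col A \<Longrightarrow> (A - B) * C = A * C - B * C"
  subgoal by (rule mult_add_distrib_mat[of _ "dim_row A" "dim_row B" _ "dim_col B"]) (intro carrier_matI; simp)+
  subgoal by (rule mult_minus_distrib_mat[of _ "dim_row A" "dim_row B" _ "dim_col B"]) (intro carrier_matI; simp)+
  subgoal by (rule add_mult_distrib_mat[of _ "dim_row B" "dim_row C" _ _ "dim_col C"]) (intro carrier_matI; simp)+
  subgoal by (rule minus_mult_distrib_mat[of _ "dim_row B" "dim_row C" _ _ "dim_col C"]) (intro carrier_matI; simp)+
  done

definition mat_sum :: "nat \<Rightarrow> ('i \<Rightarrow> complex mat) \<Rightarrow> 'i set \<Rightarrow> complex mat" where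
  "mat_sum N f I = mat N N (\<lambda>ij. \<Sum>k\<in>I. f k $$ ij)"

lemma mat_sum_carrier[simp]: "mat_sum N f I \<in> carrier_mat N N"
  and mat_sum_dim[simp]: "dim_row (mat_sum N f I) = N" "dim_col (mat_sum N f I) = N"
  by (simp_all add: mat_sum_def)

lemma mat_sum_index[simp]:
  "i < N \<Longrightarrow> j < N \<Longrightarrow> mat_sum N f I $$ (i, j) = (\<Sum>k\<in>I. f k $$ (i, j))"
  by (simp add: mat_sum_def)

lemma mat_sum_cong: "(\<And>k. k \<in> I \<Longrightarrow> f k = h k) \<Longrightarrow> mat_sum N f I = mat_sum N h I"
  by (auto simp: mat_sum_def intro!: sum.cong)

lemma mat_sum_mult_left:
  assumes "A \<in> carrier_mat N N" "\<And>k. k \<in> I \<Longrightarrow> f k \<in> carrier_mat N N"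
  shows "A * mat_sum N f I = mat_sum N (\<lambda>k. A * f k) I"
proof (intro eq_matI)
  fix i j assume "i < dim_row (mat_sum N (\<lambda>k. A * f k) I)" "j < dim_col (mat_sum N (\<lambda>k. A * f k) I)"
  then have ij: "i < N" "j < N" by simp_all
  have "(A * mat_sum N f I) $$ (i, j) = (\<Sum>l<N. \<Sum>k\<in>I. A $$ (i, l) * f k $$ (l, j))"
    using ij assms by (simp add: times_mat_index sum_distrib_left del: index_mult_mat(1))
  also have "\<dots> = (\<Sum>k\<in>I. \<Sum>l<N. A $$ (i, l) * f k $$ (l, j))" by (rule sum.swap)
  also have "\<dots> = (\<Sum>k\<in>I. (A * f k) $$ (i, j))"
  proof (intro sum.cong refl)
    fix k assume "k \<in> I"
    from assms(2)[OF this] assms(1) ij show "(\<Sum>l<N. A $$ (i, l) * f k $$ (l, j)) = (A * f k) $$ (i, j)"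
      by (simp add: times_mat_index del: index_mult_mat(1))
  qed
  finally show "(A * mat_sum N f I) $$ (i, j) = mat_sum N (\<lambda>k. A * f k) I $$ (i, j)" using ij by simp
qed (use assms in auto)

lemma mat_sum_mult_right:
  assumes "A \<in> carrier_mat N N" "\<And>k. k \<in> I \<Longrightarrow> f k \<in> carrier_mat N N"
  shows "mat_sum N f I * A = mat_sum N (\<lambda>k. f k * A) I"
proof (intro eq_matI)
  fix i j assume "i < dim_row (mat_sum N (\<lambda>k. f k * A) I)" "j < dim_col (mat_sum N (\<lambda>k. f k * A) I)"
  then have ij: "i < N" "j < N" by simp_all
  have "(mat_sum N f I * A) $$ (i, j) = (\<Sum>l<N. \<Sum>k\<in>I. f k $$ (i, l) * A $$ (l, j))"
    using ij assms by (simp add: times_mat_index sum_distrib_right del: index_mult_mat(1))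
  also have "\<dots> = (\<Sum>k\<in>I. \<Sum>l<N. f k $$ (i, l) * A $$ (l, j))" by (rule sum.swap)
  also have "\<dots> = (\<Sum>k\<in>I. (f k * A) $$ (i, j))"
  proof (intro sum.cong refl)
    fix k assume "k \<in> I"
    from assms(2)[OF this] assms(1) ij show "(\<Sum>l<N. f k $$ (i, l) * A $$ (l, j)) = (f k * A) $$ (i, j)"
      by (simp add: times_mat_index del: index_mult_mat(1))
  qed
  finally show "(mat_sum N f I * A) $$ (i, j) = mat_sum N (\<lambda>k. f k * A) I $$ (i, j)" using ij by simp
qed (use assms in auto)

lemma mtrace_mat_sum:
  assumes "\<And>k. k \<in> I \<Longrightarrow> f k \<in> carrier_mat N N"
  shows "mtrace (mat_sum N f I) = (\<Sum>k\<in>I. mtrace (f k))"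
proof -
  have "mtrace (mat_sum N f I) = (\<Sum>k\<in>I. \<Sum>i<N. f k $$ (i, i))"
    unfolding mtrace_def by (simp add: sum.swap[of _ I])
  also have "\<dots> = (\<Sum>k\<in>I. mtrace (f k))"
    unfolding mtrace_def by (intro sum.cong refl) (use assms in auto)
  finally show ?thesis .
qed

lemma mat_sum_reindex:
  "inj_on h I \<Longrightarrow> mat_sum N f (h ` I) = mat_sum N (\<lambda>k. f (h k)) I"
  by (auto simp: mat_sum_def sum.reindex)

lemma mat_sum_Un_disjoint:
  "finite I \<Longrightarrow> finite J \<Longrightarrow> I \<inter> J = {} \<Longrightarrow> mat_sum N f (I \<union> J) = mat_sum N f I + mat_sum N f J"
  by (intro eq_matI) (auto simp: sum.union_disjoint)

section \<open>Hermitian Pauli operators\<close>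

lemma hermitian_pauli_cases:
  assumes "M \<in> hermitian_paulis n"
  obtains P where "M = pauli_string n P" | P where "M = - pauli_string n P"
proof -
  obtain s P where "M = s \<cdot>\<^sub>m pauli_string n P" "s = 1 \<or> s = - 1"
    using assms unfolding hermitian_paulis_def by blast
  moreover have "- 1 \<cdot>\<^sub>m A = - A" for A :: "complex mat" by (intro eq_matI) auto
  ultimately show ?thesis using that by (metis one_smult_mat)
qed

lemma uminus_eq_smult_mat: "- A = (- 1 :: complex) \<cdot>\<^sub>m A"
  by (intro eq_matI) auto

lemma pauli_string_hermitian_pauli[simp]: "pauli_string n P \<in> hermitian_paulis n"
  unfolding hermitian_paulis_def by (metis (mono_tags, lifting) insertI1 mem_Collect_eq one_smult_mat)

lemma uminus_uminus_mat[simp]: "- (- A) = (A :: complex mat)"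
  by (intro eq_matI) auto

lemma uminus_mat_eq_iff: "- A = B \<longleftrightarrow> A = - (B :: complex mat)"
  by (metis uminus_uminus_mat)

lemma uminus_hermitian_pauli[simp]: "- M \<in> hermitian_paulis n \<longleftrightarrow> M \<in> hermitian_paulis n"
proof -
  have "- pauli_string n P \<in> hermitian_paulis n" for P
    unfolding hermitian_paulis_def uminus_eq_smult_mat by blast
  then have "- M \<in> hermitian_paulis n" if "M \<in> hermitian_paulis n" for M
    using hermitian_pauli_cases[OF that] by (metis uminus_uminus_mat pauli_string_hermitian_pauli)
  then show ?thesis by (metis uminus_uminus_mat)
qed

lemma one_hermitian_pauli[simp]: "1\<^sub>m (2 ^ n) \<in> hermitian_paulis n"
  by (metis pauli_string_PI pauli_string_hermitian_pauli)

lemma hermitian_pauli_carrier[simp, intro]: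
  "M \<in> hermitian_paulis n \<Longrightarrow> M \<in> carrier_mat (2 ^ n) (2 ^ n)"
  by (auto simp: hermitian_paulis_def)

lemma hermitian_pauli_dim[simp]:
  "M \<in> hermitian_paulis n \<Longrightarrow> dim_row M = 2 ^ n" "M \<in> hermitian_paulis n \<Longrightarrow> dim_col M = 2 ^ n"
  using hermitian_pauli_carrier by blast+

lemma hermitian_pauli_square:
  assumes "M \<in> hermitian_paulis n" shows "M * M = 1\<^sub>m (2 ^ n)"
proof -
  have *: "pauli_string n P * pauli_string n P = 1\<^sub>m (2 ^ n)" for P
    unfolding pauli_string_PI[symmetric] pauli_string_mult
    by (simp add: pauli_string_cong[of n "\<lambda>k. pauli_mult (P k) (P k)" "\<lambda>k. PI"] pauli_mult_eq_PI_iff)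
  show ?thesis by (rule hermitian_pauli_cases[OF assms]) (simp_all add: *)
qed

lemma hermitian_pauli_cancel:
  assumes "M \<in> hermitian_paulis n" "dim_row A = 2 ^ n"
  shows "M * (M * A) = A"
proof -
  have "M * (M * A) = (M * M) * A"
    using assms by (simp add: mat_assoc del: assoc_mult_mat)
  then show ?thesis using assms by (simp add: hermitian_pauli_square[of _ n])
qed

lemma hermitian_pauli_cnj_index:
  assumes "M \<in> hermitian_paulis n" "i < 2 ^ n" "j < 2 ^ n"
  shows "cnj (M $$ (i, j)) = M $$ (j, i)"
  by (rule hermitian_pauli_cases[OF assms(1)]) (use assms in \<open>simp_all add: pauli_string_adjoint_index\<close>)

text \<open>The product of two Pauli strings is a phase \<open>z\<close> times a string, and exchanging the
  factors conjugates \<open>z\<close>: they commute for \<open>z \<in> {1, -1}\<close> and anticommute for \<open>z \<in> {i, -i}\<close>.\<close>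

lemma hermitian_pauli_mult_cases:
  assumes M: "M \<in> hermitian_paulis n" and N: "N \<in> hermitian_paulis n"
  shows "(M * N = N * M \<and> M * N \<in> hermitian_paulis n) \<or>
    (M * N = - (N * M) \<and> \<i> \<cdot>\<^sub>m (M * N) \<in> hermitian_paulis n)"
proof -
  have *: "\<exists>z R. M * N = z \<cdot>\<^sub>m pauli_string n R \<and> N * M = cnj z \<cdot>\<^sub>m pauli_string n R \<and>
      (z = 1 \<or> z = - 1 \<or> z = \<i> \<or> z = - \<i>)"
  proof -
    obtain s P where P: "M = s \<cdot>\<^sub>m pauli_string n P" "s \<in> {1, - 1}"
      using M unfolding hermitian_paulis_def by blast
    obtain t Q where Q: "N = t \<cdot>\<^sub>m pauli_string n Q" "t \<in> {1, - 1}"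
      using N unfolding hermitian_paulis_def by blast
    define z where "z = (\<Prod>k<n. pauli_phase (P k) (Q k))"
    define R where "R = (\<lambda>k. pauli_mult (P k) (Q k))"
    have c: "cnj z = (\<Prod>k<n. pauli_phase (Q k) (P k))"
      by (simp add: z_def cnj_pauli_phase)
    have "M * N = (s * t) \<cdot>\<^sub>m (pauli_string n P * pauli_string n Q)"
      unfolding P Q by (rule smult_mult_smult_mat) simp
    moreover have "N * M = (s * t) \<cdot>\<^sub>m (pauli_string n Q * pauli_string n P)"
      unfolding P Q by (subst mult.commute[of s], rule smult_mult_smult_mat) simp
    ultimately have "M * N = (s * t * z) \<cdot>\<^sub>m pauli_string n R" "N * M = (s * t * cnj z) \<cdot>\<^sub>m pauli_string n R"
      unfolding pauli_string_mult c by (simp_all add: z_def R_def pauli_mult_commute)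
    moreover have "cnj (s * t * z) = s * t * cnj z" using P(2) Q(2) by auto
    moreover have "s * t * z = 1 \<or> s * t * z = - 1 \<or> s * t * z = \<i> \<or> s * t * z = - \<i>"
      using P(2) Q(2) pauli_phase_prod_cases[where n = n and P = P and Q = Q] unfolding z_def by auto
    ultimately show ?thesis by metis
  qed
  then obtain z R where z: "M * N = z \<cdot>\<^sub>m pauli_string n R" "N * M = cnj z \<cdot>\<^sub>m pauli_string n R"
    "z = 1 \<or> z = - 1 \<or> z = \<i> \<or> z = - \<i>" by blast
  have "1 \<cdot>\<^sub>m pauli_string n R \<in> hermitian_paulis n" "- 1 \<cdot>\<^sub>m pauli_string n R \<in> hermitian_paulis n"
    unfolding hermitian_paulis_def by blast+
  then show ?thesis using z(3) unfolding z(1,2) uminus_eq_smult_mat by auto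
qed

lemma hermitian_pauli_mult_closed:
  assumes "M \<in> hermitian_paulis n" "N \<in> hermitian_paulis n" "M * N = N * M"
  shows "M * N \<in> hermitian_paulis n"
proof -
  consider "M * N \<in> hermitian_paulis n" | "M * N = - (N * M)" "M * N = N * M"
    using hermitian_pauli_mult_cases[OF assms(1,2)] assms(3) by auto
  then show ?thesis
  proof cases
    case 2
    have z: "(M * N) $$ (i, j) = 0" if "i < 2 ^ n" "j < 2 ^ n" for i j
    proof -
      have "(N * M) $$ (i, j) = (- (N * M)) $$ (i, j)" using 2 by simp
      then show ?thesis using assms(3) that assms(1,2)[THEN hermitian_pauli_carrier]
        by (simp del: index_mult_mat(1))
    qed
    have "M * N * (M * N) = M * N * (N * M)" using assms(3) by simp
    also have "\<dots> = M * (N * (N * M))"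
      using assms(1,2) by (simp add: mat_assoc del: assoc_mult_mat)
    finally have "M * N * (M * N) = 1\<^sub>m (2 ^ n)"
      using assms(1,2) by (simp add: hermitian_pauli_cancel[of _ n] hermitian_pauli_square[of _ n])
    moreover have "M * N = 0\<^sub>m (2 ^ n) (2 ^ n)" using z assms(1,2)[THEN hermitian_pauli_carrier]
      by (intro eq_matI) auto
    ultimately have "(0\<^sub>m (2 ^ n) (2 ^ n) :: complex mat) = 1\<^sub>m (2 ^ n)" by simp
    then have "(0\<^sub>m (2 ^ n) (2 ^ n) :: complex mat) $$ (0, 0) = 1\<^sub>m (2 ^ n) $$ (0, 0)" by simp
    then show ?thesis by simp
  qed simp
qed

lemma hermitian_pauli_anticommute:
  assumes "M \<in> hermitian_paulis n" "N \<in> hermitian_paulis n" "M * N \<noteq> N * M"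
  shows "M * N = - (N * M)" "\<i> \<cdot>\<^sub>m (M * N) \<in> hermitian_paulis n"
  using hermitian_pauli_mult_cases[OF assms(1,2)] assms(3) by auto

lemma one_neq_uminus_one_mat: "1\<^sub>m (2 ^ n) \<noteq> - (1\<^sub>m (2 ^ n) :: complex mat)"
proof
  assume "1\<^sub>m (2 ^ n) = - (1\<^sub>m (2 ^ n) :: complex mat)"
  then have "1\<^sub>m (2 ^ n) $$ (0, 0) = (- (1\<^sub>m (2 ^ n) :: complex mat)) $$ (0, 0)" by simp
  then show False by simp
qed

lemma hermitian_pauli_neq_uminus:
  assumes "M \<in> hermitian_paulis n" shows "M \<noteq> - M"
proof
  assume "M = - M"
  then have "M * M = - (M * M)" using assms by (metis uminus_mult_left_mat hermitian_pauli_dim)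
  then show False
    using assms one_neq_uminus_one_mat[of n] by (simp add: hermitian_pauli_square[of _ n])
qed

lemma hermitian_pauli_anticommute_neq:
  assumes "M \<in> hermitian_paulis n" "N \<in> hermitian_paulis n" "M * N = - (N * M)"
  shows "M * N \<noteq> N * M"
proof
  assume "M * N = N * M"
  then have "N * M = - (N * M)" using assms(3) by simp
  moreover have "N * M \<in> hermitian_paulis n" using hermitian_pauli_mult_closed assms \<open>M * N = N * M\<close> by metis
  ultimately show False using hermitian_pauli_neq_uminus by blast
qed

lemma mtrace_hermitian_pauli:
  assumes "M \<in> hermitian_paulis n" "M \<noteq> 1\<^sub>m (2 ^ n)" "M \<noteq> - 1\<^sub>m (2 ^ n)"
  shows "mtrace M = 0"
proof -
  have *: "mtrace (pauli_string n P) = 0" if "pauli_string n P \<noteq> 1\<^sub>m (2 ^ n)" for P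
    using that pauli_string_cong[of n P "\<lambda>k. PI"] by (auto simp: mtrace_pauli_string pauli_string_PI)
  have **: "mtrace (- pauli_string n P) = - mtrace (pauli_string n P)" for P
    by (rule mtrace_uminus[where N = "2 ^ n"]) simp
  show ?thesis
    by (rule hermitian_pauli_cases[OF assms(1)]) (use assms(2,3) in \<open>auto simp: * ** uminus_mat_eq_iff\<close>)
qed

lemma mtrace_hermitian_pauli_mult:
  assumes "M \<in> hermitian_paulis n" "N \<in> hermitian_paulis n" "M \<noteq> N" "M \<noteq> - N"
  shows "mtrace (M * N) = 0"
proof (cases "M * N = N * M")
  case True
  have M: "M = M * N * N"
    using assms by (simp add: mat_assoc hermitian_pauli_square[of _ n] del: assoc_mult_mat)
  then have "M * N \<noteq> 1\<^sub>m (2 ^ n)" "M * N \<noteq> - 1\<^sub>m (2 ^ n)"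
    using assms by (metis hermitian_pauli_carrier left_mult_one_mat, 
      metis hermitian_pauli_carrier left_mult_one_mat uminus_mult_left_mat carrier_matD one_carrier_mat)
  then show ?thesis
    using hermitian_pauli_mult_closed[OF assms(1,2) True] by (simp add: mtrace_hermitian_pauli)
next
  case False
  show ?thesis
  proof (rule mtrace_conj_eq_0[where Q = M and N = "2 ^ n"])
    have "M * N * M = - (N * M) * M" using hermitian_pauli_anticommute[OF assms(1,2) False] by simp
    also have "\<dots> = - N" 
      using assms by (simp add: mat_assoc hermitian_pauli_square[of _ n] del: assoc_mult_mat)
    finally show "M * (M * N) = - (M * N * M)"
      using assms by (simp add: hermitian_pauli_cancel[of _ n])
  qed (use assms in \<open>auto simp: hermitian_pauli_square\<close>)
qed

lemma finite_hermitian_paulis: "finite (hermitian_paulis n)"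
proof -
  have "hermitian_paulis n \<subseteq>
    (\<lambda>(s, P). s \<cdot>\<^sub>m pauli_string n P) ` ({1, - 1} \<times> ({..<n} \<rightarrow>\<^sub>E {PI, PX, PY, PZ}))"
  proof
    fix M assume "M \<in> hermitian_paulis n"
    then obtain s P where M: "M = s \<cdot>\<^sub>m pauli_string n P" "s \<in> {1, - 1}"
      unfolding hermitian_paulis_def by blast
    have "pauli_string n P = pauli_string n (restrict P {..<n})" by (rule pauli_string_cong) auto
    moreover have "restrict P {..<n} \<in> {..<n} \<rightarrow>\<^sub>E {PI, PX, PY, PZ}"
      using pauli.exhaust by (auto simp: PiE_iff)
    ultimately show "M \<in> (\<lambda>(s, P). s \<cdot>\<^sub>m pauli_string n P) ` ({1, - 1} \<times> ({..<n} \<rightarrow>\<^sub>E {PI, PX, PY, PZ}))"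
      using M by (intro image_eqI[where x = "(s, restrict P {..<n})"]) auto
  qed
  moreover have "finite ({..<n} \<rightarrow>\<^sub>E {PI, PX, PY, PZ})" by (intro finite_PiE) auto
  ultimately show ?thesis by (meson finite_SigmaI finite.intros finite_imageI finite_subset)
qed

section \<open>Operators on subsystems\<close>

lemma embed_operator_carrier[simp]: "embed_operator n S V \<in> carrier_mat (2 ^ n) (2 ^ n)"
  and embed_operator_dim[simp]: "dim_row (embed_operator n S V) = 2 ^ n" "dim_col (embed_operator n S V) = 2 ^ n"
  by (simp_all add: embed_operator_def)

lemma embed_operator_index:
  "i < 2 ^ n \<Longrightarrow> j < 2 ^ n \<Longrightarrow> embed_operator n S V $$ (i, j) =
    (if restrict_bits ({..<n} - S) i = restrict_bits ({..<n} - S) j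
     then V $$ (restrict_bits S i, restrict_bits S j) else 0)"
  by (simp add: embed_operator_def)

lemma reduced_state_dim[simp]:
  "dim_row (reduced_state n S M) = 2 ^ card S" "dim_col (reduced_state n S M) = 2 ^ card S"
  by (simp_all add: reduced_state_def)

lemma mat_adjoint_index:
  "i < dim_col A \<Longrightarrow> j < dim_row A \<Longrightarrow> mat_adjoint A $$ (i, j) = cnj (A $$ (j, i))"
  by (simp add: mat_adjoint_def mat_of_rows_index)

lemma mat_adjoint_dims[simp]: "dim_row (mat_adjoint A) = dim_col A" "dim_col (mat_adjoint A) = dim_row A"
  by (simp_all add: mat_adjoint_def)

lemma prod_sorted_list_of_set_nth:
  fixes f :: "nat \<Rightarrow> 'a::comm_monoid_mult"
  shows "finite R \<Longrightarrow> (\<Prod>k<card R. f (sorted_list_of_set R ! k)) = prod f R"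
  by (rule prod.reindex_bij_betw[OF bij_betw_sorted_list_of_set_nth])

lemma pauli_string_restrict_index:
  assumes "finite R"
  shows "pauli_string (card R) (\<lambda>k. P (sorted_list_of_set R ! k)) $$ (restrict_bits R i, restrict_bits R j) =
    (\<Prod>k\<in>R. pauli_entry (P k) (bit i k) (bit j k))"
proof -
  have "pauli_string (card R) (\<lambda>k. P (sorted_list_of_set R ! k)) $$ (restrict_bits R i, restrict_bits R j) =
      (\<Prod>k<card R. (\<lambda>k. pauli_entry (P k) (bit i k) (bit j k)) (sorted_list_of_set R ! k))"
    using assms by (auto simp: pauli_string_index restrict_bits_less bit_restrict_bits intro!: prod.cong)
  then show ?thesis using prod_sorted_list_of_set_nth[OF assms, of "\<lambda>k. pauli_entry (P k) (bit i k) (bit j k)"] by simp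
qed

lemma tensor_vec_carrier[simp]: "tensor_vec n S u v \<in> carrier_vec (2 ^ n)" "dim_vec (tensor_vec n S u v) = 2 ^ n"
  by (simp_all add: tensor_vec_def)

lemma tensor_vec_index:
  "i < 2 ^ n \<Longrightarrow> tensor_vec n S u v $ i = u $ restrict_bits S i * v $ restrict_bits ({..<n} - S) i"
  by (simp add: tensor_vec_def)

lemma mult_mat_vec_index:
  "i < dim_row A \<Longrightarrow> dim_vec v = dim_col A \<Longrightarrow> (A *\<^sub>v v) $ i = (\<Sum>l<dim_col A. A $$ (i, l) * v $ l)"
  by (simp add: scalar_prod_def lessThan_atLeast0)

lemma density_dim[simp]: "dim_row (density v) = dim_vec v" "dim_col (density v) = dim_vec v"
  by (simp_all add: density_def)

lemma mtrace_mult: 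
  "A \<in> carrier_mat N N \<Longrightarrow> B \<in> carrier_mat N N \<Longrightarrow> mtrace (A * B) = (\<Sum>i<N. \<Sum>l<N. A $$ (i, l) * B $$ (l, i))"
  by (auto simp: mtrace_def times_mat_index simp del: index_mult_mat(1) intro!: sum.cong)

lemma mtrace_mult_density:
  assumes "M \<in> carrier_mat N N" "dim_vec v = N"
  shows "mtrace (M * density v) = (\<Sum>i<N. \<Sum>l<N. M $$ (i, l) * (v $ l * cnj (v $ i)))"
  using assms by (subst mtrace_mult[of _ N]) (auto simp: density_def)

context
  fixes n :: nat and S :: "nat set"
  assumes S: "S \<subseteq> {..<n}"
begin

lemma finite_subsystem: "finite S" "finite ({..<n} - S)"
  using S finite_subset by blast+

lemma complement_complement: "{..<n} - ({..<n} - S) = S"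
  using S by blast

lemma restrict_bits_subsystem_less[simp]:
  "restrict_bits S i < 2 ^ card S" "restrict_bits ({..<n} - S) i < 2 ^ card ({..<n} - S)"
  using finite_subsystem by (simp_all add: restrict_bits_less)

lemma restrict_bits_subsystem_inject:
  assumes "i < 2 ^ n" "j < 2 ^ n"
  shows "restrict_bits S i = restrict_bits S j \<and>
    restrict_bits ({..<n} - S) i = restrict_bits ({..<n} - S) j \<longleftrightarrow> i = j"
  using glue_bits_restrict_bits[OF S] assms by metis

lemma embed_operator_mult:
  assumes "V \<in> carrier_mat (2 ^ card S) (2 ^ card S)" "W \<in> carrier_mat (2 ^ card S) (2 ^ card S)"
  shows "embed_operator n S V * embed_operator n S W = embed_operator n S (V * W)"
proof (intro eq_matI)
  fix i j assume "i < dim_row (embed_operator n S (V * W))" "j < dim_col (embed_operator n S (V * W))"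
  then have ij: "i < 2 ^ n" "j < 2 ^ n" by simp_all
  let ?T = "{..<n} - S"
  have "(embed_operator n S V * embed_operator n S W) $$ (i, j) =
     (\<Sum>l<2 ^ n. embed_operator n S V $$ (i, l) * embed_operator n S W $$ (l, j))"
    using ij by (simp add: times_mat_index del: index_mult_mat(1))
  also have "\<dots> = (\<Sum>a<2 ^ card S. \<Sum>c<2 ^ card ?T.
      if c = restrict_bits ?T i then (if restrict_bits ?T i = restrict_bits ?T j then
        V $$ (restrict_bits S i, a) * W $$ (a, restrict_bits S j) else 0) else 0)"
    unfolding sum_glue_bits[OF S] using ij
    by (intro sum.cong refl) (auto simp: embed_operator_index glue_bits[OF S])
  also have "\<dots> = embed_operator n S (V * W) $$ (i, j)"
    using ij assms by (auto simp: embed_operator_index times_mat_index simp del: index_mult_mat(1))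
  finally show "(embed_operator n S V * embed_operator n S W) $$ (i, j) = embed_operator n S (V * W) $$ (i, j)" .
qed simp_all

lemma embed_operator_one: "embed_operator n S (1\<^sub>m (2 ^ card S)) = 1\<^sub>m (2 ^ n)"
proof (intro eq_matI)
  fix i j assume "i < dim_row (1\<^sub>m (2 ^ n) :: complex mat)" "j < dim_col (1\<^sub>m (2 ^ n) :: complex mat)"
  then have ij: "i < 2 ^ n" "j < 2 ^ n" by simp_all
  then show "embed_operator n S (1\<^sub>m (2 ^ card S)) $$ (i, j) = 1\<^sub>m (2 ^ n) $$ (i, j)"
    using restrict_bits_subsystem_inject[OF ij] by (auto simp: embed_operator_index)
qed simp_all

lemma embed_operator_smult:
  assumes "V \<in> carrier_mat (2 ^ card S) (2 ^ card S)"
  shows "embed_operator n S (c \<cdot>\<^sub>m V) = c \<cdot>\<^sub>m embed_operator n S V"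
  using assms by (intro eq_matI) (auto simp: embed_operator_index)

lemma embed_operator_uminus:
  assumes "V \<in> carrier_mat (2 ^ card S) (2 ^ card S)"
  shows "embed_operator n S (- V) = - embed_operator n S V"
  using assms by (intro eq_matI) (auto simp: embed_operator_index)

lemma embed_operator_add:
  assumes "V \<in> carrier_mat (2 ^ card S) (2 ^ card S)" "W \<in> carrier_mat (2 ^ card S) (2 ^ card S)"
  shows "embed_operator n S (V + W) = embed_operator n S V + embed_operator n S W"
  using assms by (intro eq_matI) (auto simp: embed_operator_index)

lemma embed_operator_minus:
  assumes "V \<in> carrier_mat (2 ^ card S) (2 ^ card S)" "W \<in> carrier_mat (2 ^ card S) (2 ^ card S)"
  shows "embed_operator n S (V - W) = embed_operator n S V - embed_operator n S W"
  using assms by (intro eq_matI) (auto simp: embed_operator_index)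

lemma embed_operator_adjoint:
  assumes "V \<in> carrier_mat (2 ^ card S) (2 ^ card S)"
  shows "mat_adjoint (embed_operator n S V) = embed_operator n S (mat_adjoint V)"
  using assms by (intro eq_matI) (auto simp: embed_operator_index mat_adjoint_index)

lemma embed_operator_mult_complement:
  assumes "i < 2 ^ n" "j < 2 ^ n"
  shows "(embed_operator n S V * embed_operator n ({..<n} - S) W) $$ (i, j) =
      V $$ (restrict_bits S i, restrict_bits S j) * W $$ (restrict_bits ({..<n} - S) i, restrict_bits ({..<n} - S) j)"
    "(embed_operator n ({..<n} - S) W * embed_operator n S V) $$ (i, j) =
      V $$ (restrict_bits S i, restrict_bits S j) * W $$ (restrict_bits ({..<n} - S) i, restrict_bits ({..<n} - S) j)"
proof -
  let ?T = "{..<n} - S"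
  have "(embed_operator n S V * embed_operator n ?T W) $$ (i, j) =
     (\<Sum>l<2 ^ n. embed_operator n S V $$ (i, l) * embed_operator n ?T W $$ (l, j))"
    using assms by (simp add: times_mat_index del: index_mult_mat(1))
  also have "\<dots> = (\<Sum>a<2 ^ card S. \<Sum>c<2 ^ card ?T.
      if c = restrict_bits ?T i then (if a = restrict_bits S j then
        V $$ (restrict_bits S i, restrict_bits S j) * W $$ (restrict_bits ?T i, restrict_bits ?T j) else 0) else 0)"
    unfolding sum_glue_bits[OF S] using assms
    by (intro sum.cong refl) (auto simp: embed_operator_index glue_bits[OF S] complement_complement)
  finally show "(embed_operator n S V * embed_operator n ?T W) $$ (i, j) =
      V $$ (restrict_bits S i, restrict_bits S j) * W $$ (restrict_bits ?T i, restrict_bits ?T j)"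
    by simp
  have "(embed_operator n ?T W * embed_operator n S V) $$ (i, j) =
     (\<Sum>l<2 ^ n. embed_operator n ?T W $$ (i, l) * embed_operator n S V $$ (l, j))"
    using assms by (simp add: times_mat_index del: index_mult_mat(1))
  also have "\<dots> = (\<Sum>a<2 ^ card S. \<Sum>c<2 ^ card ?T.
      if c = restrict_bits ?T j then (if a = restrict_bits S i then
        V $$ (restrict_bits S i, restrict_bits S j) * W $$ (restrict_bits ?T i, restrict_bits ?T j) else 0) else 0)"
    unfolding sum_glue_bits[OF S] using assms
    by (intro sum.cong refl) (auto simp: embed_operator_index glue_bits[OF S] complement_complement)
  finally show "(embed_operator n ?T W * embed_operator n S V) $$ (i, j) =
      V $$ (restrict_bits S i, restrict_bits S j) * W $$ (restrict_bits ?T i, restrict_bits ?T j)"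
    by simp
qed

lemma embed_operator_complement_commute:
  "embed_operator n S V * embed_operator n ({..<n} - S) W = embed_operator n ({..<n} - S) W * embed_operator n S V"
  by (intro eq_matI) (simp_all add: embed_operator_mult_complement del: index_mult_mat(1))

lemma reduced_state_index:
  assumes "a < 2 ^ card S" "b < 2 ^ card S"
  shows "reduced_state n S M $$ (a, b) =
    (\<Sum>c<2 ^ card ({..<n} - S). M $$ (glue_bits n S a c, glue_bits n S b c))"
proof -
  let ?f = "\<lambda>c. (glue_bits n S a c, glue_bits n S b c)"
  have inj: "inj_on ?f {..<2 ^ card ({..<n} - S)}"
    by (rule inj_onI) (metis Pair_inject assms(1) glue_bits(3)[OF S] lessThan_iff)
  have "{(i, j). i < 2 ^ n \<and> j < 2 ^ n \<and> restrict_bits S i = a \<and> restrict_bits S j = b \<and>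
      restrict_bits ({..<n} - S) i = restrict_bits ({..<n} - S) j} = ?f ` {..<2 ^ card ({..<n} - S)}"
    (is "?L = ?R")
  proof (intro Set.set_eqI iffI)
    fix p assume "p \<in> ?L"
    then obtain i j where p: "p = (i, j)" "i < 2 ^ n" "j < 2 ^ n" "restrict_bits S i = a" "restrict_bits S j = b"
      "restrict_bits ({..<n} - S) i = restrict_bits ({..<n} - S) j" by blast
    then have "p = ?f (restrict_bits ({..<n} - S) i)"
      using glue_bits_restrict_bits[OF S] by metis
    then show "p \<in> ?R" by simp
  next
    fix p assume "p \<in> ?R"
    then show "p \<in> ?L" using assms by (auto simp: glue_bits[OF S])
  qed
  then show ?thesis
    using assms by (simp add: reduced_state_def sum.reindex[OF inj])
qed

lemma reduced_state_embed:
  assumes "V \<in> carrier_mat (2 ^ card S) (2 ^ card S)"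
  shows "reduced_state n S (embed_operator n S V) = 2 ^ card ({..<n} - S) \<cdot>\<^sub>m V"
  using assms by (intro eq_matI) (auto simp: reduced_state_index embed_operator_index glue_bits[OF S])

lemma embed_operator_inject:
  assumes "V \<in> carrier_mat (2 ^ card S) (2 ^ card S)" "W \<in> carrier_mat (2 ^ card S) (2 ^ card S)"
  shows "embed_operator n S V = embed_operator n S W \<longleftrightarrow> V = W"
proof
  assume "embed_operator n S V = embed_operator n S W"
  then have "(2 ^ card ({..<n} - S)) \<cdot>\<^sub>m V = (2 ^ card ({..<n} - S)) \<cdot>\<^sub>m W"
    using reduced_state_embed assms by metis
  then have "(1 / 2 ^ card ({..<n} - S)) \<cdot>\<^sub>m (2 ^ card ({..<n} - S) \<cdot>\<^sub>m V) =
      (1 / 2 ^ card ({..<n} - S)) \<cdot>\<^sub>m (2 ^ card ({..<n} - S) \<cdot>\<^sub>m W)" by metis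
  then show "V = W" by simp
qed simp

lemma reduced_state_mult_embed:
  assumes M: "M \<in> carrier_mat (2 ^ n) (2 ^ n)" and V: "V \<in> carrier_mat (2 ^ card S) (2 ^ card S)"
  shows "reduced_state n S (M * embed_operator n S V) = reduced_state n S M * V"
proof (intro eq_matI)
  fix a b assume "a < dim_row (reduced_state n S M * V)" "b < dim_col (reduced_state n S M * V)"
  then have ab: "a < 2 ^ card S" "b < 2 ^ card S" using V by simp_all
  let ?T = "{..<n} - S"
  have "(M * embed_operator n S V) $$ (glue_bits n S a c, glue_bits n S b c) =
      (\<Sum>d<2 ^ card S. M $$ (glue_bits n S a c, glue_bits n S d c) * V $$ (d, b))" 
    if c: "c < 2 ^ card ?T" for c
  proof -
    have "(M * embed_operator n S V) $$ (glue_bits n S a c, glue_bits n S b c) =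
       (\<Sum>l<2 ^ n. M $$ (glue_bits n S a c, l) * embed_operator n S V $$ (l, glue_bits n S b c))"
      using M c ab by (simp add: times_mat_index glue_bits[OF S] del: index_mult_mat(1))
    also have "\<dots> = (\<Sum>d<2 ^ card S. \<Sum>e<2 ^ card ?T. if e = c then
        M $$ (glue_bits n S a c, glue_bits n S d c) * V $$ (d, b) else 0)"
      unfolding sum_glue_bits[OF S] using c ab
      by (intro sum.cong refl) (auto simp: embed_operator_index glue_bits[OF S])
    finally show ?thesis using c by simp
  qed
  then have "reduced_state n S (M * embed_operator n S V) $$ (a, b) =
      (\<Sum>c<2 ^ card ?T. \<Sum>d<2 ^ card S. M $$ (glue_bits n S a c, glue_bits n S d c) * V $$ (d, b))"
    using ab by (simp add: reduced_state_index del: index_mult_mat(1))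
  also have "\<dots> = (\<Sum>d<2 ^ card S. \<Sum>c<2 ^ card ?T. M $$ (glue_bits n S a c, glue_bits n S d c) * V $$ (d, b))"
    by (rule sum.swap)
  also have "\<dots> = (reduced_state n S M * V) $$ (a, b)"
    using ab V by (simp add: times_mat_index reduced_state_index sum_distrib_right del: index_mult_mat(1))
  finally show "reduced_state n S (M * embed_operator n S V) $$ (a, b) = (reduced_state n S M * V) $$ (a, b)" .
qed (use V in simp_all)

lemma reduced_state_add:
  assumes "M \<in> carrier_mat (2 ^ n) (2 ^ n)" "N \<in> carrier_mat (2 ^ n) (2 ^ n)"
  shows "reduced_state n S (M + N) = reduced_state n S M + reduced_state n S N"
  using assms by (intro eq_matI) (auto simp: reduced_state_index glue_bits[OF S] sum.distrib)

lemma reduced_state_minus: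
  assumes "M \<in> carrier_mat (2 ^ n) (2 ^ n)" "N \<in> carrier_mat (2 ^ n) (2 ^ n)"
  shows "reduced_state n S (M - N) = reduced_state n S M - reduced_state n S N"
  using assms by (intro eq_matI) (auto simp: reduced_state_index glue_bits[OF S] sum_subtractf)

lemma reduced_state_smult:
  assumes "M \<in> carrier_mat (2 ^ n) (2 ^ n)"
  shows "reduced_state n S (c \<cdot>\<^sub>m M) = c \<cdot>\<^sub>m reduced_state n S M"
  using assms by (intro eq_matI) (auto simp: reduced_state_index glue_bits[OF S] sum_distrib_left)

lemma reduced_state_mat_sum:
  "reduced_state n S (mat_sum (2 ^ n) f I) = mat_sum (2 ^ card S) (\<lambda>k. reduced_state n S (f k)) I"
  by (intro eq_matI) (auto simp: reduced_state_index glue_bits[OF S] intro: sum.swap)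

section \<open>Pauli operators supported on a subsystem\<close>

lemma pauli_string_split_index:
  assumes "i < 2 ^ n" "j < 2 ^ n"
  shows "pauli_string n P $$ (i, j) =
    pauli_string (card S) (\<lambda>k. P (sorted_list_of_set S ! k)) $$ (restrict_bits S i, restrict_bits S j) *
    pauli_string (card ({..<n} - S)) (\<lambda>k. P (sorted_list_of_set ({..<n} - S) ! k)) $$
      (restrict_bits ({..<n} - S) i, restrict_bits ({..<n} - S) j)"
proof -
  have "(\<Prod>k<n. pauli_entry (P k) (bit i k) (bit j k)) =
      (\<Prod>k\<in>S \<union> ({..<n} - S). pauli_entry (P k) (bit i k) (bit j k))"
    using S by (intro prod.cong) auto
  also have "\<dots> = (\<Prod>k\<in>S. pauli_entry (P k) (bit i k) (bit j k)) * (\<Prod>k\<in>{..<n} - S. pauli_entry (P k) (bit i k) (bit j k))"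
    using finite_subsystem by (intro prod.union_disjoint) auto
  finally show ?thesis
    by (simp only: pauli_string_index[OF assms] pauli_string_restrict_index[OF finite_subsystem(1)]
      pauli_string_restrict_index[OF finite_subsystem(2)])
qed

lemma pauli_string_split:
  "pauli_string n P = embed_operator n S (pauli_string (card S) (\<lambda>k. P (sorted_list_of_set S ! k))) *
    embed_operator n ({..<n} - S) (pauli_string (card ({..<n} - S)) (\<lambda>k. P (sorted_list_of_set ({..<n} - S) ! k)))"
  by (intro eq_matI) (simp_all add: embed_operator_mult_complement pauli_string_split_index del: index_mult_mat(1))

lemma sorted_list_of_complement_nth_mem:
  "k < card ({..<n} - S) \<Longrightarrow> sorted_list_of_set ({..<n} - S) ! k \<in> {..<n} - S"
  using bij_betw_sorted_list_of_set_nth[OF finite_subsystem(2)] bij_betwE by blast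

lemma pauli_string_embed:
  assumes "\<forall>k<n. k \<notin> S \<longrightarrow> P k = PI"
  shows "pauli_string n P = embed_operator n S (pauli_string (card S) (\<lambda>k. P (sorted_list_of_set S ! k)))"
proof (intro eq_matI)
  let ?Q = "pauli_string (card S) (\<lambda>k. P (sorted_list_of_set S ! k))"
  fix i j assume "i < dim_row (embed_operator n S ?Q)" "j < dim_col (embed_operator n S ?Q)"
  then have ij: "i < 2 ^ n" "j < 2 ^ n" by simp_all
  have "pauli_string (card ({..<n} - S)) (\<lambda>k. P (sorted_list_of_set ({..<n} - S) ! k)) = 1\<^sub>m (2 ^ card ({..<n} - S))"
    unfolding pauli_string_PI[symmetric] using sorted_list_of_complement_nth_mem assms
    by (intro pauli_string_cong) auto
  then show "pauli_string n P $$ (i, j) = embed_operator n S ?Q $$ (i, j)"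
    using ij by (simp add: pauli_string_split_index embed_operator_index)
qed simp_all

lemma reduced_state_pauli_string_eq_0:
  assumes "k < n" "k \<notin> S" "P k \<noteq> PI"
  shows "reduced_state n S (pauli_string n P) = 0\<^sub>m (2 ^ card S) (2 ^ card S)"
proof (intro eq_matI)
  fix a b assume "a < dim_row (0\<^sub>m (2 ^ card S) (2 ^ card S) :: complex mat)"
    "b < dim_col (0\<^sub>m (2 ^ card S) (2 ^ card S) :: complex mat)"
  then have ab: "a < 2 ^ card S" "b < 2 ^ card S" by simp_all
  let ?T = "{..<n} - S" let ?R = "pauli_string (card ?T) (\<lambda>k. P (sorted_list_of_set ?T ! k))"
  have "k \<in> (\<lambda>k. sorted_list_of_set ?T ! k) ` {..<card ?T}"
    using bij_betw_sorted_list_of_set_nth[OF finite_subsystem(2)] assms by (simp add: bij_betw_def)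
  then have "mtrace ?R = 0" using assms(3) by (auto simp: mtrace_pauli_string)
  then have "(\<Sum>c<2 ^ card ?T. ?R $$ (c, c)) = 0" by (simp add: mtrace_def)
  then show "reduced_state n S (pauli_string n P) $$ (a, b) = 0\<^sub>m (2 ^ card S) (2 ^ card S) $$ (a, b)"
    using ab by (simp add: reduced_state_index pauli_string_split_index glue_bits[OF S] flip: sum_distrib_left)
qed simp_all

lemma supported_on_iff: "supported_on n S M \<longleftrightarrow> (\<exists>N\<in>hermitian_paulis (card S). M = embed_operator n S N)"
proof
  assume "supported_on n S M"
  then obtain s P where M: "s \<in> {1, - 1}" "M = s \<cdot>\<^sub>m pauli_string n P" "\<forall>k<n. k \<notin> S \<longrightarrow> P k = PI"
    unfolding supported_on_def by blast
  let ?N = "s \<cdot>\<^sub>m pauli_string (card S) (\<lambda>k. P (sorted_list_of_set S ! k))"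
  have "?N \<in> hermitian_paulis (card S)" using M(1) unfolding hermitian_paulis_def by blast
  moreover have "M = embed_operator n S ?N"
    using pauli_string_embed[OF M(3)] M(2) by (simp add: embed_operator_smult)
  ultimately show "\<exists>N\<in>hermitian_paulis (card S). M = embed_operator n S N" by blast
next
  assume "\<exists>N\<in>hermitian_paulis (card S). M = embed_operator n S N"
  then obtain s Q where M: "s \<in> {1, - 1}" "M = embed_operator n S (s \<cdot>\<^sub>m pauli_string (card S) Q)"
    unfolding hermitian_paulis_def by blast
  let ?h = "the_inv_into {..<card S} (\<lambda>k. sorted_list_of_set S ! k)"
  define P where "P = (\<lambda>k. if k \<in> S then Q (?h k) else PI)"
  have b: "bij_betw (\<lambda>k. sorted_list_of_set S ! k) {..<card S} S"
    by (rule bij_betw_sorted_list_of_set_nth[OF finite_subsystem(1)])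
  have "P (sorted_list_of_set S ! k) = Q k" if "k < card S" for k
  proof -
    have "sorted_list_of_set S ! k \<in> S" using b that bij_betwE by blast
    moreover have "?h (sorted_list_of_set S ! k) = k"
      using the_inv_into_f_f[OF bij_betw_imp_inj_on[OF b], of k] that by simp
    ultimately show ?thesis by (simp add: P_def)
  qed
  then have "pauli_string (card S) Q = pauli_string (card S) (\<lambda>k. P (sorted_list_of_set S ! k))"
    by (intro pauli_string_cong) simp
  moreover have P: "\<forall>k<n. k \<notin> S \<longrightarrow> P k = PI" by (simp add: P_def)
  ultimately have "M = s \<cdot>\<^sub>m pauli_string n P"
    using M(2) pauli_string_embed[OF P] by (simp add: embed_operator_smult)
  then show "supported_on n S M" unfolding supported_on_def using M(1) P by blast
qed

lemma embed_hermitian_pauli: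
  assumes "N \<in> hermitian_paulis (card S)"
  shows "embed_operator n S N \<in> hermitian_paulis n"
proof -
  have "supported_on n S (embed_operator n S N)" using supported_on_iff assms by blast
  then show ?thesis unfolding supported_on_def hermitian_paulis_def by blast
qed

lemma reduced_state_not_supported:
  assumes "M \<in> hermitian_paulis n" "\<not> supported_on n S M"
  shows "reduced_state n S M = 0\<^sub>m (2 ^ card S) (2 ^ card S)"
proof -
  obtain s P where M: "s \<in> {1, - 1}" "M = s \<cdot>\<^sub>m pauli_string n P"
    using assms(1) unfolding hermitian_paulis_def by blast
  then obtain k where "k < n" "k \<notin> S" "P k \<noteq> PI"
    using assms(2) unfolding supported_on_def by blast
  then show ?thesis using M(2) by (simp add: reduced_state_smult reduced_state_pauli_string_eq_0)
qed

lemma hermitian_pauli_embedD: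
  assumes "embed_operator n S W \<in> hermitian_paulis n" "W \<in> carrier_mat (2 ^ card S) (2 ^ card S)"
  shows "supported_on n S (embed_operator n S W)"
proof (rule ccontr)
  assume "\<not> supported_on n S (embed_operator n S W)"
  then have "2 ^ card ({..<n} - S) \<cdot>\<^sub>m W = 0\<^sub>m (2 ^ card S) (2 ^ card S)"
    using reduced_state_not_supported[OF assms(1)] reduced_state_embed[OF assms(2)] by simp
  then have "(1 / 2 ^ card ({..<n} - S)) \<cdot>\<^sub>m (2 ^ card ({..<n} - S) \<cdot>\<^sub>m W) = 0\<^sub>m (2 ^ card S) (2 ^ card S)"
    by simp
  then have "W = 0\<^sub>m (2 ^ card S) (2 ^ card S)" by simp
  then have "embed_operator n S W = 0\<^sub>m (2 ^ n) (2 ^ n)"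
    by (intro eq_matI) (auto simp: embed_operator_index)
  then have "(0\<^sub>m (2 ^ n) (2 ^ n) :: complex mat) = 1\<^sub>m (2 ^ n)"
    using hermitian_pauli_square[OF assms(1)] by simp
  then have "(0\<^sub>m (2 ^ n) (2 ^ n) :: complex mat) $$ (0, 0) = 1\<^sub>m (2 ^ n) $$ (0, 0)" by simp
  then show False by simp
qed

section \<open>Product vectors\<close>

lemma embed_operator_tensor_vec:
  assumes "V \<in> carrier_mat (2 ^ card S) (2 ^ card S)" "dim_vec u = 2 ^ card S"
  shows "embed_operator n S V *\<^sub>v tensor_vec n S u v = tensor_vec n S (V *\<^sub>v u) v"
proof (intro eq_vecI)
  fix i assume "i < dim_vec (tensor_vec n S (V *\<^sub>v u) v)"
  then have i: "i < 2 ^ n" by simp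
  let ?T = "{..<n} - S"
  have "(embed_operator n S V *\<^sub>v tensor_vec n S u v) $ i =
      (\<Sum>l<2 ^ n. embed_operator n S V $$ (i, l) * tensor_vec n S u v $ l)"
    using i by (simp add: mult_mat_vec_index del: index_mult_mat_vec)
  also have "\<dots> = (\<Sum>a<2 ^ card S. \<Sum>c<2 ^ card ?T. if c = restrict_bits ?T i then
        V $$ (restrict_bits S i, a) * u $ a * v $ restrict_bits ?T i else 0)"
    unfolding sum_glue_bits[OF S] using i
    by (intro sum.cong refl) (auto simp: embed_operator_index tensor_vec_index glue_bits[OF S])
  also have "\<dots> = (\<Sum>a<2 ^ card S. V $$ (restrict_bits S i, a) * u $ a) * v $ restrict_bits ?T i"
    by (simp add: sum_distrib_right)
  also have "\<dots> = tensor_vec n S (V *\<^sub>v u) v $ i"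
    using i assms by (simp add: tensor_vec_index mult_mat_vec_index del: index_mult_mat_vec)
  finally show "(embed_operator n S V *\<^sub>v tensor_vec n S u v) $ i = tensor_vec n S (V *\<^sub>v u) v $ i" .
qed simp_all

lemma mtrace_tensor_density:
  assumes "V \<in> carrier_mat (2 ^ card S) (2 ^ card S)"
    "W \<in> carrier_mat (2 ^ card ({..<n} - S)) (2 ^ card ({..<n} - S))"
    "dim_vec u = 2 ^ card S" "dim_vec v = 2 ^ card ({..<n} - S)"
  shows "mtrace (embed_operator n S V * embed_operator n ({..<n} - S) W * density (tensor_vec n S u v)) =
    mtrace (V * density u) * mtrace (W * density v)"
proof -
  let ?T = "{..<n} - S"
  let ?f = "\<lambda>a b. V $$ (a, b) * (u $ b * cnj (u $ a))" and ?g = "\<lambda>c d. W $$ (c, d) * (v $ d * cnj (v $ c))"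
  have "mtrace (embed_operator n S V * embed_operator n ?T W * density (tensor_vec n S u v)) =
     (\<Sum>i<2 ^ n. \<Sum>l<2 ^ n. ?f (restrict_bits S i) (restrict_bits S l) * ?g (restrict_bits ?T i) (restrict_bits ?T l))"
    by (subst mtrace_mult_density[where N = "2 ^ n"])
      (auto intro!: sum.cong simp: embed_operator_mult_complement tensor_vec_index simp del: index_mult_mat(1))
  also have "\<dots> = (\<Sum>a<2 ^ card S. \<Sum>c<2 ^ card ?T. \<Sum>b<2 ^ card S. \<Sum>d<2 ^ card ?T. ?f a b * ?g c d)"
    unfolding sum_glue_bits[OF S] by (intro sum.cong refl) (simp add: glue_bits[OF S])
  also have "\<dots> = (\<Sum>a<2 ^ card S. \<Sum>c<2 ^ card ?T. (\<Sum>b<2 ^ card S. ?f a b) * (\<Sum>d<2 ^ card ?T. ?g c d))"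
    by (simp only: sum_product)
  also have "\<dots> = (\<Sum>a<2 ^ card S. \<Sum>b<2 ^ card S. ?f a b) * (\<Sum>c<2 ^ card ?T. \<Sum>d<2 ^ card ?T. ?g c d)"
    by (simp only: sum_product)
  finally show ?thesis using assms by (simp add: mtrace_mult_density)
qed

end

section \<open>Isotropic groups of Pauli operators\<close>

definition isotropic :: "nat \<Rightarrow> complex mat set \<Rightarrow> bool" where
  "isotropic n H \<longleftrightarrow> H \<subseteq> hermitian_paulis n \<and> 1\<^sub>m (2 ^ n) \<in> H \<and>
     (\<forall>a\<in>H. \<forall>b\<in>H. a * b \<in> H \<and> a * b = b * a) \<and> - 1\<^sub>m (2 ^ n) \<notin> H"

lemma isotropicD:
  assumes "isotropic n H"
  shows "a \<in> H \<Longrightarrow> a \<in> hermitian_paulis n" "1\<^sub>m (2 ^ n) \<in> H" "- 1\<^sub>m (2 ^ n) \<notin> H"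
    "a \<in> H \<Longrightarrow> b \<in> H \<Longrightarrow> a * b \<in> H" "a \<in> H \<Longrightarrow> b \<in> H \<Longrightarrow> a * b = b * a"
  using assms unfolding isotropic_def by blast+

lemma isotropic_finite: "isotropic n H \<Longrightarrow> finite H"
  unfolding isotropic_def using finite_hermitian_paulis finite_subset by blast

lemma isotropic_uminus_notin:
  assumes "isotropic n H" "a \<in> H" shows "- a \<notin> H"
proof
  assume "- a \<in> H"
  then have "- a * a \<in> H" using isotropicD[OF assms(1)] assms(2) by blast
  moreover have "- a * a = - 1\<^sub>m (2 ^ n)"
    using hermitian_pauli_square[OF isotropicD(1)[OF assms]] isotropicD(1)[OF assms] by simp
  ultimately show False using isotropicD(3)[OF assms(1)] by simp
qed

lemma hermitian_pauli_inj_mult: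
  assumes "P \<in> hermitian_paulis n" "H \<subseteq> hermitian_paulis n"
  shows "inj_on ((*) P) H"
proof (rule inj_onI)
  fix a b assume "a \<in> H" "b \<in> H" "P * a = P * b"
  then have "P * (P * a) = P * (P * b)" "dim_row a = 2 ^ n" "dim_row b = 2 ^ n"
    using assms hermitian_pauli_dim(1) by auto
  then show "a = b" using assms(1) by (simp add: hermitian_pauli_cancel)
qed

context
  fixes n H P
  assumes iso: "isotropic n H" and P: "P \<in> hermitian_paulis n"
    and comm: "\<forall>h\<in>H. P * h = h * P" and notin: "P \<notin> H" "- P \<notin> H"
begin

lemma isotropic_coset:
  assumes "a \<in> H" "P * a \<in> H \<or> - (P * a) \<in> H" shows False
proof -
  note a = isotropicD(1)[OF iso assms(1)]
  have Pa: "P * a = a * P" using comm assms by simp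
  have *: "a * (P * a) = P" using a P unfolding Pa by (simp add: hermitian_pauli_cancel[of _ n])
  have "a * (P * a) \<in> H \<or> a * (- (P * a)) \<in> H" using assms isotropicD(4)[OF iso] by blast
  moreover have "a * (- (P * a)) = - (a * (P * a))" using a P by simp
  ultimately show False using * notin by simp
qed

lemma isotropic_extend: "isotropic n (H \<union> (*) P ` H)"
proof -
  have sub: "H \<subseteq> hermitian_paulis n" using isotropicD(1)[OF iso] by blast
  have 1: "(P * a) * b = P * (a * b)" "b * (P * a) = P * (b * a)" if "a \<in> H" "b \<in> H" for a b
  proof -
    have ab: "a \<in> hermitian_paulis n" "b \<in> hermitian_paulis n" using that sub by auto
    then show "(P * a) * b = P * (a * b)" using P by (simp add: mat_assoc del: assoc_mult_mat)
    have "b * (P * a) = (b * P) * a" using ab P by (simp add: mat_assoc del: assoc_mult_mat)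
    also have "\<dots> = (P * b) * a" using comm that by simp
    finally show "b * (P * a) = P * (b * a)" using ab P by (simp add: mat_assoc del: assoc_mult_mat)
  qed
  have 2: "(P * a) * (P * b) = a * b" if "a \<in> H" "b \<in> H" for a b
  proof -
    have ab: "a \<in> hermitian_paulis n" "b \<in> hermitian_paulis n" using that sub by auto
    have "(P * a) * (P * b) = P * (P * (a * b))"
      using 1(2)[of b a] that ab P by (simp add: mat_assoc del: assoc_mult_mat)
    then show ?thesis using ab P by (simp add: hermitian_pauli_cancel[of _ n])
  qed
  have "P * a \<in> hermitian_paulis n" if "a \<in> H" for a
    using hermitian_pauli_mult_closed[OF P] sub comm that by blast
  moreover have "- 1\<^sub>m (2 ^ n) \<notin> (*) P ` H"
  proof
    assume "- 1\<^sub>m (2 ^ n) \<in> (*) P ` H"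
    then obtain a where "a \<in> H" "- 1\<^sub>m (2 ^ n) = P * a" by blast
    then have "a \<in> H" "- (P * a) = 1\<^sub>m (2 ^ n)" by (simp, metis uminus_uminus_mat)
    then have "a \<in> H" "- (P * a) \<in> H" using isotropicD(2)[OF iso] by simp_all
    then show False using isotropic_coset by blast
  qed
  moreover have "a * b \<in> H \<union> (*) P ` H \<and> a * b = b * a" if "a \<in> H \<union> (*) P ` H" "b \<in> H \<union> (*) P ` H" for a b
    using that isotropicD(4,5)[OF iso] by (auto simp: 1 2 simp del: assoc_mult_mat)
  ultimately show ?thesis unfolding isotropic_def using sub isotropicD(2,3)[OF iso] by blast
qed

lemma isotropic_coset_disjoint: "H \<inter> (*) P ` H = {}"
  using isotropic_coset by blast

lemma isotropic_extend_card: "card (H \<union> (*) P ` H) = 2 * card H"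
proof -
  have "inj_on ((*) P) H" using hermitian_pauli_inj_mult[OF P] isotropicD(1)[OF iso] by blast
  then show ?thesis
    using isotropic_finite[OF iso] isotropic_coset_disjoint by (simp add: card_Un_disjoint card_image)
qed

end

section \<open>Counting the Pauli strings that commute with an isotropic group\<close>

definition strings :: "nat \<Rightarrow> (nat \<Rightarrow> pauli) set" where
  "strings n = {..<n} \<rightarrow>\<^sub>E UNIV"

lemma UNIV_pauli: "UNIV = {PI, PX, PY, PZ}"
  using pauli.exhaust by auto

lemma finite_strings: "finite (strings n)" and card_strings: "card (strings n) = 4 ^ n"
proof -
  have "card (UNIV :: pauli set) = 4" by (simp add: UNIV_pauli)
  then show "card (strings n) = 4 ^ n" by (simp add: strings_def card_PiE)
  show "finite (strings n)" by (auto simp: strings_def UNIV_pauli intro!: finite_PiE)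
qed

definition pauli_sign :: "pauli \<Rightarrow> pauli \<Rightarrow> int" where
  "pauli_sign p q = (if p = PI \<or> q = PI \<or> p = q then 1 else - 1)"

lemma pauli_phase_sign: "pauli_phase p q = of_int (pauli_sign p q) * pauli_phase q p"
  by (cases p; cases q) (simp_all add: pauli_sign_def)

lemma sum_pauli_sign: "(\<Sum>p\<in>UNIV. pauli_sign p q) = (if q = PI then 4 else 0)"
  by (cases q) (simp_all add: UNIV_pauli pauli_sign_def)

definition commutation_sign :: "complex mat \<Rightarrow> complex mat \<Rightarrow> int" where
  "commutation_sign M N = (if M * N = N * M then 1 else - 1)"

lemma commutation_sign_pauli_string:
  "commutation_sign (pauli_string n P) (pauli_string n Q) = (\<Prod>k<n. pauli_sign (P k) (Q k))"
proof -
  let ?M = "pauli_string n P" and ?N = "pauli_string n Q"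
  let ?s = "\<Prod>k<n. pauli_sign (P k) (Q k)"
  have s: "?s = 1 \<or> ?s = - 1"
    by (induction n) (auto simp: pauli_sign_def)
  have "(\<Prod>k<n. pauli_phase (P k) (Q k)) = of_int ?s * (\<Prod>k<n. pauli_phase (Q k) (P k))"
    by (subst pauli_phase_sign) (simp add: prod.distrib)
  then have MN: "?M * ?N = of_int ?s \<cdot>\<^sub>m (?N * ?M)"
    by (simp add: pauli_string_mult pauli_mult_commute)
  show ?thesis
  proof (cases "?s = 1")
    case True
    then show ?thesis using MN by (simp add: commutation_sign_def)
  next
    case False
    then have "?s = - 1" using s by blast
    then have "?M * ?N = - (?N * ?M)" using MN by (simp add: uminus_eq_smult_mat)
    then have "?M * ?N \<noteq> ?N * ?M" by (rule hermitian_pauli_anticommute_neq[where n = n, rotated 2]) simp_all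
    then show ?thesis using \<open>?s = - 1\<close> by (simp add: commutation_sign_def)
  qed
qed

lemma commutation_sign_uminus:
  assumes "M \<in> hermitian_paulis n" "N \<in> hermitian_paulis n"
  shows "commutation_sign M (- N) = commutation_sign M N"
  using assms by (simp add: commutation_sign_def uminus_mat_eq_iff)

lemma sum_commutation_sign:
  assumes "h \<in> hermitian_paulis n" "h \<noteq> - 1\<^sub>m (2 ^ n)"
  shows "(\<Sum>P\<in>strings n. commutation_sign (pauli_string n P) h) = (if h = 1\<^sub>m (2 ^ n) then 4 ^ n else 0)"
proof (cases "h = 1\<^sub>m (2 ^ n)")
  case True
  then show ?thesis by (simp add: commutation_sign_def card_strings)
next
  case False
  obtain Q where Q: "h = pauli_string n Q \<or> h = - pauli_string n Q"
    using hermitian_pauli_cases[OF assms(1)] by metis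
  have "pauli_string n Q \<noteq> 1\<^sub>m (2 ^ n)" using Q False assms(2) by auto
  then obtain k where k: "k < n" "Q k \<noteq> PI" using pauli_string_cong[of n Q "\<lambda>k. PI"] pauli_string_PI by auto
  have "(\<Sum>P\<in>strings n. commutation_sign (pauli_string n P) h) = (\<Sum>P\<in>strings n. \<Prod>k<n. pauli_sign (P k) (Q k))"
    using Q by (auto simp: commutation_sign_uminus[of _ n] commutation_sign_pauli_string)
  also have "\<dots> = (\<Prod>k<n. \<Sum>p\<in>UNIV. pauli_sign p (Q k))"
    unfolding strings_def by (subst prod_sum_PiE) (auto simp: UNIV_pauli)
  also have "\<dots> = 0"
    using k by (intro prod_zero) (auto simp: sum_pauli_sign)
  finally show ?thesis using False by simp
qed

lemma commutation_sign_mult: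
  assumes M: "M \<in> hermitian_paulis n" and N: "N \<in> hermitian_paulis n" and h: "h \<in> hermitian_paulis n"
    and "N * h = h * N" and "M * N \<noteq> N * M"
  shows "commutation_sign M (N * h) = - commutation_sign M h"
proof -
  have MN: "M * N = - (N * M)" using hermitian_pauli_anticommute[OF M N] assms by blast
  have 1: "M * (N * h) = - (N * (M * h))"
  proof -
    have "M * (N * h) = (M * N) * h" using M N h by (simp add: mat_assoc del: assoc_mult_mat)
    then show ?thesis unfolding MN using M N h by (simp add: mat_assoc del: assoc_mult_mat)
  qed
  have 2: "N * h * M = N * (h * M)" using M N h by (simp add: mat_assoc del: assoc_mult_mat)
  show ?thesis
  proof (cases "M * h = h * M")
    case True
    have "M * (N * h) = - (N * h * M)" using 1 2 True by simp
    then have "M * (N * h) \<noteq> N * h * M"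
      using M hermitian_pauli_mult_closed[OF N h] assms(4) by (intro hermitian_pauli_anticommute_neq)
    then show ?thesis using True by (simp add: commutation_sign_def)
  next
    case False
    then have "M * h = - (h * M)" using hermitian_pauli_anticommute[OF M h] by blast
    then have "M * (N * h) = N * h * M" using 1 2 M N h by simp
    then show ?thesis using False by (simp add: commutation_sign_def)
  qed
qed

text \<open>Summing the commutation signs over strings first leaves only \<open>h = 1\<close>; summing over \<open>H\<close> first
  leaves only the strings that commute with all of \<open>H\<close>.\<close>

lemma card_commuting_strings:
  assumes iso: "isotropic n H"
  shows "card H * card {P \<in> strings n. \<forall>h\<in>H. pauli_string n P * h = h * pauli_string n P} = 4 ^ n"
proof -
  let ?C = "{P \<in> strings n. \<forall>h\<in>H. pauli_string n P * h = h * pauli_string n P}"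
  let ?s = "\<lambda>P h. commutation_sign (pauli_string n P) h"
  have "(\<Sum>h\<in>H. \<Sum>P\<in>strings n. ?s P h) = (\<Sum>h\<in>H. if h = 1\<^sub>m (2 ^ n) then 4 ^ n else 0)"
    by (intro sum.cong refl sum_commutation_sign) (use isotropicD[OF iso] in auto)
  also have "\<dots> = 4 ^ n" using isotropic_finite[OF iso] isotropicD(2)[OF iso] by simp
  finally have 1: "(\<Sum>h\<in>H. \<Sum>P\<in>strings n. ?s P h) = 4 ^ n" .
  have 2: "(\<Sum>h\<in>H. ?s P h) = (if P \<in> ?C then int (card H) else 0)" if P: "P \<in> strings n" for P
  proof (cases "P \<in> ?C")
    case True
    then show ?thesis by (simp add: commutation_sign_def)
  next
    case False
    then obtain N where N: "N \<in> H" "pauli_string n P * N \<noteq> N * pauli_string n P" using P by blast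
    have "(*) N ` H \<subseteq> H" using isotropicD(4)[OF iso] N by blast
    moreover have inj: "inj_on ((*) N) H"
      using hermitian_pauli_inj_mult[of N n H] isotropicD(1)[OF iso] N by blast
    ultimately have "(*) N ` H = H" using isotropic_finite[OF iso] by (metis endo_inj_surj)
    then have "(\<Sum>h\<in>H. ?s P h) = (\<Sum>h\<in>H. ?s P (N * h))"
      using sum.reindex[OF inj, of "?s P"] by simp
    also have "\<dots> = (\<Sum>h\<in>H. - ?s P h)"
      by (intro sum.cong refl commutation_sign_mult[of _ n]) (use N isotropicD[OF iso] in auto)
    finally have "(\<Sum>h\<in>H. ?s P h) = 0" by (simp add: sum_negf)
    then show ?thesis using False by (simp only: if_False)
  qed
  have "(\<Sum>P\<in>strings n. \<Sum>h\<in>H. ?s P h) = (\<Sum>P\<in>strings n. if P \<in> ?C then int (card H) else 0)"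
    by (intro sum.cong refl 2)
  also have "\<dots> = int (card H) * int (card ?C)"
    using finite_strings by (simp flip: sum.inter_filter)
  finally have "int (card H * card ?C) = 4 ^ n" using 1 by (subst (asm) sum.swap) simp
  then have "int (card H * card ?C) = int (4 ^ n)" by simp
  then show ?thesis by (simp only: of_nat_eq_iff)
qed

definition maximal_isotropic :: "nat \<Rightarrow> complex mat set \<Rightarrow> bool" where
  "maximal_isotropic n H \<longleftrightarrow> isotropic n H \<and>
     (\<forall>P\<in>hermitian_paulis n. (\<forall>h\<in>H. P * h = h * P) \<longrightarrow> P \<in> H \<or> - P \<in> H)"

lemma pauli_string_inject:
  assumes "P \<in> strings n" "Q \<in> strings n" "pauli_string n P = pauli_string n Q \<or> pauli_string n P = - pauli_string n Q"
  shows "P = Q"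
proof -
  have "\<exists>c. pauli_string n P = c \<cdot>\<^sub>m pauli_string n Q"
    using assms(3) by (metis one_smult_mat uminus_eq_smult_mat)
  then obtain c where c: "pauli_string n P = c \<cdot>\<^sub>m pauli_string n Q" ..
  show ?thesis
    using assms(1,2) pauli_string_eq_smultD[OF c] unfolding strings_def by (intro PiE_ext) auto
qed

lemma hermitian_pauli_string:
  assumes "M \<in> hermitian_paulis n"
  obtains P where "P \<in> strings n" "M = pauli_string n P \<or> M = - pauli_string n P"
proof -
  obtain P where P: "M = pauli_string n P \<or> M = - pauli_string n P"
    using hermitian_pauli_cases[OF assms] by metis
  have "pauli_string n P = pauli_string n (restrict P {..<n})" by (rule pauli_string_cong) auto
  then show ?thesis using P by (intro that[of "restrict P {..<n}"]) (auto simp: strings_def)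
qed

lemma maximal_isotropic_iff_card:
  assumes iso: "isotropic n H"
  shows "maximal_isotropic n H \<longleftrightarrow> card H = 2 ^ n"
proof -
  let ?C = "{P \<in> strings n. \<forall>h\<in>H. pauli_string n P * h = h * pauli_string n P}"
  have "\<forall>h\<in>H. \<exists>P. P \<in> strings n \<and> (h = pauli_string n P \<or> h = - pauli_string n P)"
    using isotropicD(1)[OF iso] hermitian_pauli_string by metis
  then obtain f where f: "\<And>h. h \<in> H \<Longrightarrow> f h \<in> strings n"
    "\<And>h. h \<in> H \<Longrightarrow> h = pauli_string n (f h) \<or> h = - pauli_string n (f h)"
    by metis
  have inj: "inj_on f H"
  proof (rule inj_onI)
    fix a b assume "a \<in> H" "b \<in> H" "f a = f b"
    then have "a = b \<or> a = - b" using f(2)[of a] f(2)[of b] by (metis uminus_uminus_mat)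
    then show "a = b" using \<open>a \<in> H\<close> \<open>b \<in> H\<close> isotropic_uminus_notin[OF iso] by blast
  qed
  have sub: "f ` H \<subseteq> ?C"
  proof (intro image_subsetI CollectI conjI ballI)
    fix a h assume "a \<in> H" "h \<in> H"
    then have *: "a * h = h * a" "h \<in> hermitian_paulis n" using isotropicD[OF iso] by auto
    show "pauli_string n (f a) * h = h * pauli_string n (f a)"
    proof (cases "a = pauli_string n (f a)")
      case True
      then show ?thesis using *(1) by simp
    next
      case False
      then have "pauli_string n (f a) = - a" using f(2)[OF \<open>a \<in> H\<close>] by (metis uminus_uminus_mat)
      moreover have "a \<in> hermitian_paulis n" using isotropicD(1)[OF iso \<open>a \<in> H\<close>] .
      ultimately show ?thesis using * by simp
    qed
  qed (use f in auto)
  have fin: "finite ?C" using finite_strings by simp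
  have card: "card H * card ?C = 2 ^ n * 2 ^ n"
    using card_commuting_strings[OF iso] by (simp add: power_mult_distrib[symmetric])
  have *: "maximal_isotropic n H \<longleftrightarrow> f ` H = ?C"
  proof
    assume max: "maximal_isotropic n H"
    have "P \<in> f ` H" if "P \<in> ?C" for P
    proof -
      have "pauli_string n P \<in> H \<or> - pauli_string n P \<in> H"
        using max that unfolding maximal_isotropic_def by simp
      then obtain h where h: "h \<in> H" "h = pauli_string n P \<or> h = - pauli_string n P" by blast
      then have "pauli_string n (f h) = pauli_string n P \<or> pauli_string n (f h) = - pauli_string n P"
        using f(2)[OF h(1)] by (metis uminus_uminus_mat)
      then have "f h = P" using f(1)[OF h(1)] that by (intro pauli_string_inject[of _ n]) auto
      then show ?thesis using h(1) by blast
    qed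
    then show "f ` H = ?C" using sub by blast
  next
    assume eq: "f ` H = ?C"
    have "M \<in> H \<or> - M \<in> H" if M: "M \<in> hermitian_paulis n" "\<forall>h\<in>H. M * h = h * M" for M
    proof -
      obtain P where P: "P \<in> strings n" "M = pauli_string n P \<or> M = - pauli_string n P"
        using hermitian_pauli_string[OF M(1)] .
      have "pauli_string n P * h = h * pauli_string n P" if "h \<in> H" for h
      proof (cases "M = pauli_string n P")
        case False
        then have "pauli_string n P = - M" using P(2) by (metis uminus_uminus_mat)
        moreover have "h \<in> hermitian_paulis n" using isotropicD(1)[OF iso that] .
        ultimately show ?thesis using M that by simp
      qed (use M that in simp)
      then have "P \<in> f ` H" using P(1) eq by blast
      then obtain h where h: "h \<in> H" "P = f h" by blast
      then have "M = h \<or> - M = h" using P(2) f(2)[OF h(1)] by (metis uminus_uminus_mat)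
      then show ?thesis using h(1) by blast
    qed
    then show "maximal_isotropic n H" unfolding maximal_isotropic_def using iso by blast
  qed
  show ?thesis
  proof
    assume "maximal_isotropic n H"
    then have "card H = card ?C" using * card_image[OF inj] by simp
    then have "card H * card H = 2 ^ n * 2 ^ n" using card by simp
    then show "card H = 2 ^ n" by (metis power2_eq_square power2_nat_le_eq_le dual_order.antisym order_refl)
  next
    assume "card H = 2 ^ n"
    then have "card ?C = card (f ` H)" using card card_image[OF inj] by simp
    then show "maximal_isotropic n H" using * card_subset_eq[OF fin sub] by simp
  qed
qed

section \<open>Generators\<close>

lemma pauli_group_simps:
  "\<one>\<^bsub>pauli_group n\<^esub> = 1\<^sub>m (2 ^ n)" "a \<otimes>\<^bsub>pauli_group n\<^esub> b = a * b"
  by (simp_all add: pauli_group_def)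

lemma pauli_group_inv:
  assumes "h \<in> hermitian_paulis n"
  shows "inv\<^bsub>pauli_group n\<^esub> h = h"
  unfolding m_inv_def pauli_group_simps
proof (rule the_equality)
  show "h \<in> carrier (pauli_group n) \<and> h * h = 1\<^sub>m (2 ^ n) \<and> h * h = 1\<^sub>m (2 ^ n)"
    using hermitian_pauli_square[OF assms] assms unfolding pauli_group_def hermitian_paulis_def by auto
  fix y assume y: "y \<in> carrier (pauli_group n) \<and> h * y = 1\<^sub>m (2 ^ n) \<and> y * h = 1\<^sub>m (2 ^ n)"
  then have "dim_row y = 2 ^ n" by (auto simp: pauli_group_def)
  then have "y = h * (h * y)" using assms by (simp add: hermitian_pauli_cancel)
  then show "y = h" using y assms by simp
qed

lemma generate_mono:
  assumes "A \<subseteq> B" shows "generate \<G> A \<subseteq> generate \<G> B"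
proof
  fix x assume "x \<in> generate \<G> A"
  then show "x \<in> generate \<G> B"
    by induction (use assms in \<open>auto intro: generate.intros\<close>)
qed

lemma generate_empty_pauli: "generate (pauli_group n) {} = {1\<^sub>m (2 ^ n)}"
proof
  show "generate (pauli_group n) {} \<subseteq> {1\<^sub>m (2 ^ n)}"
  proof
    fix x assume "x \<in> generate (pauli_group n) {}"
    then show "x \<in> {1\<^sub>m (2 ^ n)}" by induction (auto simp: pauli_group_simps)
  qed
  show "{1\<^sub>m (2 ^ n)} \<subseteq> generate (pauli_group n) {}"
    using generate.one[of "pauli_group n" "{}"] by (simp add: pauli_group_simps)
qed

lemma generate_insert_pauli:
  assumes iso: "isotropic n (generate (pauli_group n) X)" and P: "P \<in> hermitian_paulis n"
    and "\<forall>h\<in>generate (pauli_group n) X. P * h = h * P"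
    and "P \<notin> generate (pauli_group n) X" "- P \<notin> generate (pauli_group n) X"
  shows "generate (pauli_group n) (insert P X) =
    generate (pauli_group n) X \<union> (*) P ` generate (pauli_group n) X" (is "?L = ?K \<union> (*) P ` ?K")
proof
  have ext: "isotropic n (?K \<union> (*) P ` ?K)" by (rule isotropic_extend) (use assms in auto)
  show "?L \<subseteq> ?K \<union> (*) P ` ?K"
  proof
    fix x assume "x \<in> ?L"
    then show "x \<in> ?K \<union> (*) P ` ?K"
    proof induction
      case one
      then show ?case using isotropicD(2)[OF iso] by (simp add: pauli_group_simps)
    next
      case (incl h)
      have "P = P * 1\<^sub>m (2 ^ n)" using P by simp
      then have "P \<in> (*) P ` ?K" using isotropicD(2)[OF iso] by blast
      then show ?case using incl by (auto intro: generate.incl)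
    next
      case (inv h)
      have "P = P * 1\<^sub>m (2 ^ n)" using P by simp
      then have "P \<in> (*) P ` ?K" using isotropicD(2)[OF iso] by blast
      then have "h \<in> ?K \<union> (*) P ` ?K" using inv by (auto intro: generate.incl)
      then show ?case using pauli_group_inv isotropicD(1)[OF ext] by metis
    next
      case (eng a b)
      then show ?case using isotropicD(4)[OF ext] by (simp add: pauli_group_simps)
    qed
  qed
  have K: "?K \<subseteq> ?L" by (rule generate_mono) blast
  have "P * a \<in> ?L" if "a \<in> ?K" for a
    using generate.eng[of P "pauli_group n" "insert P X" a] generate.incl[of P "insert P X" "pauli_group n"] K that
    by (auto simp: pauli_group_simps)
  then show "?K \<union> (*) P ` ?K \<subseteq> ?L" using K by blast
qed

lemma stabilizer_groupD:
  assumes "stabilizer_group n J g G"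
  shows "generate (pauli_group n) (g ` J) = G"
    "j \<in> J \<Longrightarrow> g j \<notin> generate (pauli_group n) (g ` (J - {j}))"
    "G \<subseteq> hermitian_paulis n" "a \<in> G \<Longrightarrow> b \<in> G \<Longrightarrow> a * b = b * a" "- 1\<^sub>m (2 ^ n) \<notin> G"
proof -
  note c = assms[unfolded stabilizer_group_def, THEN conjunct2]
  show "generate (pauli_group n) (g ` J) = G" by (rule c[THEN conjunct1, symmetric])
  note c = c[THEN conjunct2]
  show "j \<in> J \<Longrightarrow> g j \<notin> generate (pauli_group n) (g ` (J - {j}))" by (rule c[THEN conjunct1, rule_format])
  note c = c[THEN conjunct2]
  show "G \<subseteq> hermitian_paulis n" by (rule c[THEN conjunct1])
  note c = c[THEN conjunct2]
  show "a \<in> G \<Longrightarrow> b \<in> G \<Longrightarrow> a * b = b * a" by (rule c[THEN conjunct1, rule_format])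
  show "- 1\<^sub>m (2 ^ n) \<notin> G" by (rule c[THEN conjunct2])
qed

lemma stabilizer_group_isotropic_generate:
  assumes G: "stabilizer_group n J g G" and "I \<subseteq> J"
  shows "isotropic n (generate (pauli_group n) (g ` I))" "generate (pauli_group n) (g ` I) \<subseteq> G"
proof -
  show sub: "generate (pauli_group n) (g ` I) \<subseteq> G"
    using generate_mono[OF image_mono[OF assms(2)]] stabilizer_groupD(1)[OF G] by metis
  have "1\<^sub>m (2 ^ n) \<in> generate (pauli_group n) (g ` I)"
    using generate.one[of "pauli_group n" "g ` I"] by (simp add: pauli_group_simps)
  moreover have "a * b \<in> generate (pauli_group n) (g ` I)"
    if "a \<in> generate (pauli_group n) (g ` I)" "b \<in> generate (pauli_group n) (g ` I)" for a b
    using generate.eng[OF that] by (simp add: pauli_group_simps)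
  ultimately show "isotropic n (generate (pauli_group n) (g ` I))"
    using sub stabilizer_groupD(3-5)[OF G] unfolding isotropic_def by (meson subset_iff)
qed

lemma stabilizer_group_isotropic:
  assumes "stabilizer_group n J g G" shows "isotropic n G"
  using stabilizer_group_isotropic_generate(1)[OF assms order_refl] stabilizer_groupD(1)[OF assms] by simp

lemma stabilizer_group_generator:
  assumes G: "stabilizer_group n J g G" and J: "insert j I \<subseteq> J" and "j \<notin> I"
  shows "g j \<in> hermitian_paulis n" "\<forall>h\<in>generate (pauli_group n) (g ` I). g j * h = h * g j"
    "g j \<notin> generate (pauli_group n) (g ` I)" "- g j \<notin> generate (pauli_group n) (g ` I)"
proof -
  have gj: "g j \<in> G" using J generate.incl[of "g j" "g ` J" "pauli_group n"] stabilizer_groupD(1)[OF G] by simp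
  have sub: "generate (pauli_group n) (g ` I) \<subseteq> G"
    using stabilizer_group_isotropic_generate(2)[OF G] J by blast
  show "g j \<in> hermitian_paulis n" "\<forall>h\<in>generate (pauli_group n) (g ` I). g j * h = h * g j"
    using isotropicD[OF stabilizer_group_isotropic[OF G]] gj sub by blast+
  have "g ` I \<subseteq> g ` (J - {j})" using J \<open>j \<notin> I\<close> by blast
  then show "g j \<notin> generate (pauli_group n) (g ` I)"
    using J generate_mono[of "g ` I" "g ` (J - {j})" "pauli_group n"] stabilizer_groupD(2)[OF G, of j] by blast
  show "- g j \<notin> generate (pauli_group n) (g ` I)"
    using isotropic_uminus_notin[OF stabilizer_group_isotropic[OF G] gj] sub by blast
qed

lemma stabilizer_group_generate_insert:
  assumes G: "stabilizer_group n J g G" and "insert j I \<subseteq> J" and "j \<notin> I"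
  shows "generate (pauli_group n) (g ` insert j I) =
    generate (pauli_group n) (g ` I) \<union> (*) (g j) ` generate (pauli_group n) (g ` I)"
  unfolding image_insert
  by (rule generate_insert_pauli)
     (use stabilizer_group_isotropic_generate(1)[OF G, of I] stabilizer_group_generator[OF assms] assms(2) in auto)

lemma card_stabilizer_group:
  assumes G: "stabilizer_group n J g G" and "finite J"
  shows "card G = 2 ^ card J"
proof -
  have "I \<subseteq> J \<Longrightarrow> card (generate (pauli_group n) (g ` I)) = 2 ^ card I" if "finite I" for I
    using that
  proof (induction I)
    case empty
    then show ?case by (simp add: generate_empty_pauli)
  next
    case (insert j I)
    note gen = stabilizer_group_generator[OF G insert.prems insert.hyps(2)]
    have iso: "isotropic n (generate (pauli_group n) (g ` I))"
      using stabilizer_group_isotropic_generate(1)[OF G] insert.prems by blast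
    show ?case
      unfolding stabilizer_group_generate_insert[OF G insert.prems insert.hyps(2)]
      using isotropic_extend_card[OF iso gen] insert by simp
  qed
  from this[OF assms(2)] stabilizer_groupD(1)[OF G] show ?thesis by simp
qed

lemma foldr_stabilizer_generators:
  assumes G: "stabilizer_group n J g G" and "set js \<subseteq> J" "distinct js"
  shows "foldr (\<lambda>j M. (1\<^sub>m (2 ^ n) + g j) * M) js (1\<^sub>m (2 ^ n)) =
    mat_sum (2 ^ n) (\<lambda>h. h) (generate (pauli_group n) (g ` set js))"
  using assms(2,3)
proof (induction js)
  case Nil
  then show ?case by (intro eq_matI) (auto simp: generate_empty_pauli)
next
  case (Cons j js)
  let ?K = "generate (pauli_group n) (g ` set js)"
  have J: "insert j (set js) \<subseteq> J" "j \<notin> set js" using Cons.prems by auto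
  note gen = stabilizer_group_generator[OF G J]
  have iso: "isotropic n ?K"
    using stabilizer_group_isotropic_generate(1)[OF G] Cons.prems by auto
  have K: "?K \<subseteq> hermitian_paulis n" using isotropicD(1)[OF iso] by blast
  have "mat_sum (2 ^ n) (\<lambda>h. h) (?K \<union> (*) (g j) ` ?K) = mat_sum (2 ^ n) (\<lambda>h. h) ?K + mat_sum (2 ^ n) (\<lambda>h. h) ((*) (g j) ` ?K)"
    using isotropic_finite[OF iso] isotropic_coset_disjoint[OF iso gen] by (intro mat_sum_Un_disjoint) auto
  also have "mat_sum (2 ^ n) (\<lambda>h. h) ((*) (g j) ` ?K) = mat_sum (2 ^ n) (\<lambda>k. g j * k) ?K"
    using hermitian_pauli_inj_mult[OF gen(1) K] by (simp add: mat_sum_reindex)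
  also have "\<dots> = g j * mat_sum (2 ^ n) (\<lambda>h. h) ?K"
    using gen(1) K by (intro mat_sum_mult_left[symmetric]) auto
  also have "mat_sum (2 ^ n) (\<lambda>h. h) ?K + g j * mat_sum (2 ^ n) (\<lambda>h. h) ?K = (1\<^sub>m (2 ^ n) + g j) * mat_sum (2 ^ n) (\<lambda>h. h) ?K"
    using gen(1) by (simp add: mat_distrib)
  finally show ?case
    using Cons stabilizer_group_generate_insert[OF G J] by simp
qed

lemma stabilizer_group_extend:
  assumes G: "stabilizer_group n {1..k} g K" and P: "P \<in> hermitian_paulis n"
    and comm: "\<forall>h\<in>K. P * h = h * P" and notin: "P \<notin> K" "- P \<notin> K"
  shows "stabilizer_group n {1..Suc k} (g(Suc k := P)) (K \<union> (*) P ` K)"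
proof -
  let ?g = "g(Suc k := P)"
  have K: "K = generate (pauli_group n) (g ` {1..k})" using stabilizer_groupD(1)[OF G] by simp
  have iso: "isotropic n K" using stabilizer_group_isotropic[OF G] .
  note ext = isotropic_extend[OF iso P comm notin]
  have img: "?g ` {1..Suc k} = insert P (g ` {1..k})"
    by (auto simp: atLeastAtMostSuc_conv)
  have gen: "K \<union> (*) P ` K = generate (pauli_group n) (?g ` {1..Suc k})"
    unfolding img using generate_insert_pauli[of n "g ` {1..k}" P] iso P comm notin K by simp
  have "?g j \<notin> generate (pauli_group n) (?g ` ({1..Suc k} - {j}))" if j: "j \<in> {1..Suc k}" for j
  proof (cases "j = Suc k")
    case True
    then have "?g ` ({1..Suc k} - {j}) = g ` {1..k}" by auto
    then show ?thesis using True notin K by simp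
  next
    case False
    let ?X = "g ` ({1..k} - {j})" let ?K' = "generate (pauli_group n) ?X"
    have *: "?g ` ({1..Suc k} - {j}) = insert P ?X" using False j
      by (auto simp: atLeastAtMostSuc_conv)
    have jk: "j \<in> {1..k}" using j False by auto
    have iso': "isotropic n ?K'" "?K' \<subseteq> K" using stabilizer_group_isotropic_generate[OF G, of "{1..k} - {j}"] by auto
    have gj: "g j \<in> K" unfolding K using jk by (intro generate.incl) auto
    have "g j \<notin> ?K'" using stabilizer_groupD(2)[OF G jk] .
    moreover have "g j \<notin> (*) P ` ?K'"
    proof
      assume "g j \<in> (*) P ` ?K'"
      then obtain h where "h \<in> ?K'" "g j = P * h" by blast
      then show False using isotropic_coset_disjoint[OF iso P comm notin] gj iso'(2) by blast
    qed
    moreover have "generate (pauli_group n) (insert P ?X) = ?K' \<union> (*) P ` ?K'"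
      by (rule generate_insert_pauli[OF iso'(1) P]) (use comm notin iso'(2) in blast)+
    ultimately show ?thesis
      unfolding * using False by simp
  qed
  moreover have "?g ` {1..Suc k} \<subseteq> hermitian_paulis n"
    unfolding img using P G unfolding stabilizer_group_def by simp
  ultimately show ?thesis
    unfolding stabilizer_group_def
  proof (intro conjI)
    show "K \<union> (*) P ` K = generate (pauli_group n) (?g ` {1..Suc k})" by (rule gen)
    show "K \<union> (*) P ` K \<subseteq> hermitian_paulis n" using isotropicD(1)[OF ext] by (rule subsetI)
    show "\<forall>a\<in>K \<union> (*) P ` K. \<forall>b\<in>K \<union> (*) P ` K. a * b = b * a"
      by (intro ballI isotropicD(5)[OF ext])
    show "- 1\<^sub>m (2 ^ n) \<notin> K \<union> (*) P ` K" by (rule isotropicD(3)[OF ext])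
  qed blast+
qed

lemma isotropic_has_generators:
  assumes iso: "isotropic n H"
  shows "\<exists>(k::nat) g. stabilizer_group n {1..k} g H"
proof -
  have "\<exists>(k::nat) g. stabilizer_group n {1..k} g H" if "stabilizer_group n {1..k} g K" "K \<subseteq> H" for k :: nat and g K
    using that
  proof (induction "card H - card K" arbitrary: k g K rule: less_induct)
    case less
    show ?case
    proof (cases "K = H")
      case False
      then obtain P where P: "P \<in> H" "P \<notin> K" using less.prems by blast
      have "- P \<notin> K" using isotropic_uminus_notin[OF iso P(1)] less.prems by blast
      moreover have "\<forall>h\<in>K. P * h = h * P" using isotropicD(5)[OF iso P(1)] less.prems by blast
      moreover have PH: "P \<in> hermitian_paulis n" using isotropicD(1)[OF iso P(1)] .
      ultimately have ext: "stabilizer_group n {1..Suc k} (g(Suc k := P)) (K \<union> (*) P ` K)"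
        using stabilizer_group_extend[OF less.prems(1)] P(2) by blast
      have sub: "K \<union> (*) P ` K \<subseteq> H" using isotropicD(4)[OF iso P(1)] less.prems(2) by blast
      have "P = P * 1\<^sub>m (2 ^ n)" using PH by simp
      then have "P \<in> (*) P ` K" using isotropicD(2)[OF stabilizer_group_isotropic[OF less.prems(1)]] by blast
      then have "card K < card (K \<union> (*) P ` K)" "card (K \<union> (*) P ` K) \<le> card H"
        using sub P(2) isotropic_finite[OF iso] by (auto intro!: psubset_card_mono card_mono finite_subset[OF sub])
      then show ?thesis using less.hyps[OF _ ext sub] by simp
    qed (use less.prems in blast)
  qed
  moreover have "stabilizer_group n {1..0::nat} undefined {1\<^sub>m (2 ^ n)}"
    unfolding stabilizer_group_def using one_neq_uminus_one_mat[of n] by (simp add: generate_empty_pauli)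
  ultimately show ?thesis using isotropicD(2)[OF iso] by blast
qed

section \<open>Stabilizer states\<close>

definition stabilizer_projector :: "nat \<Rightarrow> complex mat set \<Rightarrow> complex mat" where
  "stabilizer_projector n H = (1 / 2 ^ n) \<cdot>\<^sub>m mat_sum (2 ^ n) (\<lambda>h. h) H"

lemma stabilizer_projector_carrier[simp]: "stabilizer_projector n H \<in> carrier_mat (2 ^ n) (2 ^ n)"
  and stabilizer_projector_dim[simp]:
    "dim_row (stabilizer_projector n H) = 2 ^ n" "dim_col (stabilizer_projector n H) = 2 ^ n"
  by (simp_all add: stabilizer_projector_def)

lemma isotropic_mult_image:
  assumes iso: "isotropic n H" and "h \<in> H"
  shows "(*) h ` H = H" "inj_on ((*) h) H"
proof -
  show inj: "inj_on ((*) h) H"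
    using hermitian_pauli_inj_mult[of h n H] isotropicD(1)[OF iso] assms(2) by blast
  have "(*) h ` H \<subseteq> H" using isotropicD(4)[OF iso] assms(2) by blast
  then show "(*) h ` H = H" using isotropic_finite[OF iso] inj by (metis endo_inj_surj)
qed

lemma stabilizer_projector_absorb:
  assumes iso: "isotropic n H" and h: "h \<in> H"
  shows "h * stabilizer_projector n H = stabilizer_projector n H"
    "stabilizer_projector n H * h = stabilizer_projector n H"
proof -
  have c: "h \<in> carrier_mat (2 ^ n) (2 ^ n)" "\<And>k. k \<in> H \<Longrightarrow> k \<in> carrier_mat (2 ^ n) (2 ^ n)"
    using isotropicD(1)[OF iso] h by blast+
  have sum: "mat_sum (2 ^ n) (\<lambda>k. h * k) H = mat_sum (2 ^ n) (\<lambda>h. h) H"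
    using mat_sum_reindex[OF isotropic_mult_image(2)[OF assms], of "2 ^ n" "\<lambda>h. h"]
      isotropic_mult_image(1)[OF assms] by simp
  have "h * mat_sum (2 ^ n) (\<lambda>h. h) H = mat_sum (2 ^ n) (\<lambda>h. h) H"
    using mat_sum_mult_left[OF c(1), of H "\<lambda>h. h"] c(2) sum by simp
  then show "h * stabilizer_projector n H = stabilizer_projector n H"
    using c(1) by (simp add: stabilizer_projector_def mult_smult_mat)
  have "mat_sum (2 ^ n) (\<lambda>h. h) H * h = mat_sum (2 ^ n) (\<lambda>k. k * h) H"
    using mat_sum_mult_right[OF c(1), of H "\<lambda>h. h"] c(2) by simp
  also have "\<dots> = mat_sum (2 ^ n) (\<lambda>k. h * k) H"
    using isotropicD(5)[OF iso h] by (intro mat_sum_cong) simp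
  finally have "mat_sum (2 ^ n) (\<lambda>h. h) H * h = mat_sum (2 ^ n) (\<lambda>h. h) H" using sum by simp
  then show "stabilizer_projector n H * h = stabilizer_projector n H"
    using c(1) by (simp add: stabilizer_projector_def smult_mult_mat)
qed

lemma stabilizer_projector_idem:
  assumes iso: "isotropic n H" and "card H = 2 ^ n"
  shows "stabilizer_projector n H * stabilizer_projector n H = stabilizer_projector n H"
proof -
  have c: "\<And>k. k \<in> H \<Longrightarrow> k \<in> carrier_mat (2 ^ n) (2 ^ n)" using isotropicD(1)[OF iso] by blast
  have "stabilizer_projector n H * mat_sum (2 ^ n) (\<lambda>h. h) H =
      mat_sum (2 ^ n) (\<lambda>h. stabilizer_projector n H * h) H"
    by (rule mat_sum_mult_left) (use c in auto)
  also have "\<dots> = mat_sum (2 ^ n) (\<lambda>h. stabilizer_projector n H) H"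
    using stabilizer_projector_absorb[OF iso] by (intro mat_sum_cong) simp
  also have "\<dots> = 2 ^ n \<cdot>\<^sub>m stabilizer_projector n H"
    using assms(2) by (intro eq_matI) simp_all
  finally show ?thesis
    by (subst (2) stabilizer_projector_def) (simp add: mult_smult_mat)
qed

lemma mtrace_isotropic_mult:
  assumes iso: "isotropic n H" and h: "h \<in> H"
  shows "mtrace h = (if h = 1\<^sub>m (2 ^ n) then 2 ^ n else 0)"
  using mtrace_hermitian_pauli[of h n] isotropicD[OF iso] h by (auto simp: mtrace_one)

lemma mtrace_stabilizer_projector:
  assumes iso: "isotropic n H"
  shows "mtrace (stabilizer_projector n H) = 1"
proof -
  have "mtrace (mat_sum (2 ^ n) (\<lambda>h. h) H) = (\<Sum>h\<in>H. mtrace h)"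
    using isotropicD(1)[OF iso] by (intro mtrace_mat_sum) blast
  also have "\<dots> = (\<Sum>h\<in>H. if h = 1\<^sub>m (2 ^ n) then 2 ^ n else 0)"
    by (intro sum.cong refl mtrace_isotropic_mult[OF iso])
  also have "\<dots> = 2 ^ n" using isotropic_finite[OF iso] isotropicD(2)[OF iso] by simp
  finally show ?thesis by (simp add: stabilizer_projector_def mtrace_smult[of _ "2 ^ n"])
qed

lemma stabilizer_projector_hermitian:
  assumes iso: "isotropic n H" and "i < 2 ^ n" "j < 2 ^ n"
  shows "cnj (stabilizer_projector n H $$ (i, j)) = stabilizer_projector n H $$ (j, i)"
proof -
  have "(\<Sum>h\<in>H. cnj (h $$ (i, j))) = (\<Sum>h\<in>H. h $$ (j, i))"
    using hermitian_pauli_cnj_index[OF isotropicD(1)[OF iso] assms(2,3)] by (rule sum.cong[OF refl])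
  then show ?thesis using assms(2,3) by (simp add: stabilizer_projector_def)
qed

lemma density_carrier[simp]: "dim_vec v = N \<Longrightarrow> density v \<in> carrier_mat N N"
  by (simp add: density_def)

lemma density_index[simp]: "i < dim_vec v \<Longrightarrow> j < dim_vec v \<Longrightarrow> density v $$ (i, j) = v $ i * cnj (v $ j)"
  by (simp add: density_def)

lemma density_mult_left:
  assumes "M \<in> carrier_mat N N" "dim_vec v = N" "M *\<^sub>v v = v"
  shows "M * density v = density v"
proof (intro eq_matI)
  fix i j assume "i < dim_row (density v)" "j < dim_col (density v)"
  then have ij: "i < N" "j < N" using assms by simp_all
  have "(M * density v) $$ (i, j) = (\<Sum>l<N. M $$ (i, l) * v $ l) * cnj (v $ j)"
    using ij assms(1,2) by (auto simp: times_mat_index sum_distrib_right mult.assoc simp del: index_mult_mat(1) intro!: sum.cong)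
  also have "(\<Sum>l<N. M $$ (i, l) * v $ l) = (M *\<^sub>v v) $ i"
    using ij assms(1,2) by (simp add: mult_mat_vec_index del: index_mult_mat_vec)
  finally show "(M * density v) $$ (i, j) = density v $$ (i, j)" using ij assms by simp
qed (use assms in simp_all)

lemma density_mult_right:
  assumes "M \<in> carrier_mat N N" "dim_vec v = N" "M *\<^sub>v v = v"
    "\<And>i j. i < N \<Longrightarrow> j < N \<Longrightarrow> cnj (M $$ (i, j)) = M $$ (j, i)"
  shows "density v * M = density v"
proof (intro eq_matI)
  fix i j assume "i < dim_row (density v)" "j < dim_col (density v)"
  then have ij: "i < N" "j < N" using assms by simp_all
  have "(density v * M) $$ (i, j) = (\<Sum>l<N. v $ i * (cnj (v $ l) * cnj (M $$ (j, l))))"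
    using ij assms(1,2,4) by (auto simp: times_mat_index mult.assoc simp del: index_mult_mat(1) intro!: sum.cong)
  also have "\<dots> = v $ i * cnj (\<Sum>l<N. M $$ (j, l) * v $ l)"
    by (simp add: sum_distrib_left mult.commute)
  also have "(\<Sum>l<N. M $$ (j, l) * v $ l) = (M *\<^sub>v v) $ j"
    using ij assms(1,2) by (simp add: mult_mat_vec_index del: index_mult_mat_vec)
  finally show "(density v * M) $$ (i, j) = density v $$ (i, j)" using ij assms by simp
qed (use assms in simp_all)

lemma cscalar_prod_sum: "dim_vec v = dim_vec w \<Longrightarrow> v \<bullet>c w = (\<Sum>i<dim_vec v. v $ i * cnj (w $ i))"
  by (simp add: scalar_prod_def lessThan_atLeast0)

lemma mtrace_density: "mtrace (density v) = v \<bullet>c v"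
  by (simp add: mtrace_def cscalar_prod_sum)

lemma density_mult_self:
  assumes "v \<bullet>c v = 1" shows "density v *\<^sub>v v = v"
proof (intro eq_vecI)
  fix i assume "i < dim_vec v"
  then have "(density v *\<^sub>v v) $ i = (\<Sum>l<dim_vec v. v $ i * (v $ l * cnj (v $ l)))"
    by (simp add: mult_mat_vec_index ac_simps del: index_mult_mat_vec)
  also have "\<dots> = v $ i * (v \<bullet>c v)" by (simp add: cscalar_prod_sum sum_distrib_left)
  finally show "(density v *\<^sub>v v) $ i = v $ i" using assms by simp
qed simp

lemma hermitian_idem_trace_0:
  assumes "Q \<in> carrier_mat N N" "Q * Q = Q" "mtrace Q = 0"
    "\<And>i j. i < N \<Longrightarrow> j < N \<Longrightarrow> cnj (Q $$ (i, j)) = Q $$ (j, i)"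
  shows "Q = 0\<^sub>m N N"
proof -
  have "0 = mtrace (Q * Q)" using assms(2,3) by simp
  also have "\<dots> = (\<Sum>i<N. \<Sum>l<N. Q $$ (i, l) * Q $$ (l, i))" by (rule mtrace_mult[OF assms(1,1)])
  also have "\<dots> = (\<Sum>i<N. \<Sum>l<N. Q $$ (i, l) * cnj (Q $$ (i, l)))" using assms(4) by simp
  also have "\<dots> = of_real (\<Sum>i<N. \<Sum>l<N. (cmod (Q $$ (i, l)))\<^sup>2)" by (simp only: of_real_sum complex_norm_square)
  finally have "complex_of_real (\<Sum>i<N. \<Sum>l<N. (cmod (Q $$ (i, l)))\<^sup>2) = 0" by (rule sym)
  then have "(\<Sum>i<N. \<Sum>l<N. (cmod (Q $$ (i, l)))\<^sup>2) = 0" by (simp only: of_real_eq_0_iff)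
  then have "\<forall>i<N. \<forall>l<N. (cmod (Q $$ (i, l)))\<^sup>2 = 0"
    by (simp add: sum_nonneg_eq_0_iff sum_nonneg)
  then show ?thesis using assms(1) by (intro eq_matI) auto
qed

lemma normalize_vec:
  fixes w :: "complex vec"
  assumes "dim_vec w = N" "i < N" "w $ i \<noteq> 0"
  shows "\<exists>c. (c \<cdot>\<^sub>v w) \<bullet>c (c \<cdot>\<^sub>v w) = 1"
proof -
  define r where "r = (\<Sum>j<N. (cmod (w $ j))\<^sup>2)"
  have "r > 0" unfolding r_def using assms by (intro sum_pos2[of _ i]) auto
  define c :: complex where "c = of_real (1 / sqrt r)"
  have "c * cnj c = of_real (1 / r)"
    using \<open>r > 0\<close> by (simp add: c_def flip: of_real_mult)
  have "(c \<cdot>\<^sub>v w) \<bullet>c (c \<cdot>\<^sub>v w) = (\<Sum>j<N. (c * cnj c) * (w $ j * cnj (w $ j)))"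
    using assms(1) by (simp add: cscalar_prod_sum mult_ac)
  also have "\<dots> = (c * cnj c) * of_real r"
    by (simp only: r_def of_real_sum complex_norm_square sum_distrib_left)
  also have "\<dots> = 1" using \<open>r > 0\<close> \<open>c * cnj c = of_real (1 / r)\<close> by simp
  finally show ?thesis ..
qed

lemma maximal_isotropic_stabilizer_state:
  assumes max: "maximal_isotropic n H"
  shows "stabilizer_projector n H \<in> stabilizer_states n"
proof -
  let ?T = "stabilizer_projector n H"
  have iso: "isotropic n H" using max by (simp add: maximal_isotropic_def)
  have card: "card H = 2 ^ n" using max maximal_isotropic_iff_card[OF iso] by simp
  obtain k :: nat and g where g: "stabilizer_group n {1..k} g H" using isotropic_has_generators[OF iso] by blast
  have "k = n" using card_stabilizer_group[OF g] card by simp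
  have "\<exists>i<2 ^ n. ?T $$ (i, i) \<noteq> 0"
  proof (rule ccontr)
    assume "\<not> (\<exists>i<2 ^ n. ?T $$ (i, i) \<noteq> 0)"
    then have "mtrace ?T = 0" by (auto simp: mtrace_def intro!: sum.neutral)
    then show False using mtrace_stabilizer_projector[OF iso] by simp
  qed
  then obtain i where i: "i < 2 ^ n" "?T $$ (i, i) \<noteq> 0" by blast
  define w where "w = col ?T i"
  have w: "dim_vec w = 2 ^ n" "w \<in> carrier_vec (2 ^ n)" "w $ i \<noteq> 0" using i by (auto simp: w_def)
  obtain c where c: "(c \<cdot>\<^sub>v w) \<bullet>c (c \<cdot>\<^sub>v w) = 1" using normalize_vec[OF w(1) i(1) w(3)] by blast
  define v where "v = c \<cdot>\<^sub>v w"
  have v: "dim_vec v = 2 ^ n" "v \<bullet>c v = 1" using c w by (simp_all add: v_def)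
  have fixes_v: "M *\<^sub>v v = v" if "M \<in> carrier_mat (2 ^ n) (2 ^ n)" "M * ?T = ?T" for M
  proof -
    have "M *\<^sub>v w = col (M * ?T) i" unfolding w_def by (rule col_mult2[symmetric, OF that(1)]) (use i in simp_all)
    then have "M *\<^sub>v w = w" using that by (simp add: w_def)
    then show ?thesis unfolding v_def using mult_mat_vec[OF that(1) w(2)] by simp
  qed
  have Hv: "h *\<^sub>v v = v" if "h \<in> H" for h
    using fixes_v stabilizer_projector_absorb(1)[OF iso that] isotropicD(1)[OF iso that] by blast
  have idem: "?T * ?T = ?T" by (rule stabilizer_projector_idem[OF iso card])
  have Tv: "?T *\<^sub>v v = v" by (rule fixes_v) (simp_all add: idem)
  have 1: "?T * density v = density v" by (rule density_mult_left[OF _ v(1) Tv]) simp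
  have 2: "density v * ?T = density v"
    by (rule density_mult_right[OF _ v(1) Tv stabilizer_projector_hermitian[OF iso]]) simp_all
  have 3: "density v * density v = density v"
  proof (rule density_mult_left[OF _ v(1)])
    show "density v *\<^sub>v v = v" by (rule density_mult_self[OF v(2)])
  qed (use v in simp)
  \<comment> \<open>Two projections of trace \<open>1\<close>, the second below the first: their difference is a projection of trace \<open>0\<close>.\<close>
  have "?T - density v = 0\<^sub>m (2 ^ n) (2 ^ n)"
  proof (rule hermitian_idem_trace_0)
    show "(?T - density v) * (?T - density v) = ?T - density v"
    proof -
      have "(?T - density v) * (?T - density v) = (?T - density v) * ?T - (?T - density v) * density v"
        using v(1) by (intro mat_distrib) simp_all
      also have "(?T - density v) * ?T = ?T - density v"
        using v(1) by (simp add: mat_distrib idem 2)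
      also have "(?T - density v) * density v = 0\<^sub>m (2 ^ n) (2 ^ n)"
        using v(1) by (simp add: mat_distrib 1 3)
      finally show ?thesis using v(1) by (simp, intro eq_matI) auto
    qed
    show "mtrace (?T - density v) = 0"
      using v by (subst mtrace_minus[of _ "2 ^ n"]) (simp_all add: mtrace_stabilizer_projector[OF iso] mtrace_density)
    show "cnj ((?T - density v) $$ (i, j)) = (?T - density v) $$ (j, i)" if "i < 2 ^ n" "j < 2 ^ n" for i j
      using that v(1) by (simp add: stabilizer_projector_hermitian[OF iso] mult.commute)
  qed (rule minus_carrier_mat, use v in simp)
  then have "?T = density v"
  proof (intro eq_matI)
    fix i j assume *: "?T - density v = 0\<^sub>m (2 ^ n) (2 ^ n)" "i < dim_row (density v)" "j < dim_col (density v)"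
    then have "(?T - density v) $$ (i, j) = 0" using v by simp
    then show "?T $$ (i, j) = density v $$ (i, j)" using *(2,3) v by simp
  qed (use v in simp_all)
  moreover have "pure_state n v" unfolding pure_state_def by (intro conjI carrier_vecI v)
  ultimately show ?thesis
    unfolding stabilizer_states_def using g Hv unfolding \<open>k = n\<close> by blast
qed

lemma stabilizer_state_expectation:
  assumes "\<sigma> \<in> stabilizer_states n"
  obtains H where "maximal_isotropic n H" "\<And>h. h \<in> H \<Longrightarrow> h * \<sigma> = \<sigma>" "\<And>h. h \<in> H \<Longrightarrow> \<sigma> * h = \<sigma>"
    "\<sigma> \<in> carrier_mat (2 ^ n) (2 ^ n)" "mtrace \<sigma> = 1"
proof -
  obtain v g H where v: "\<sigma> = density v" "pure_state n v" "stabilizer_group n {1..n} g H" "\<forall>h\<in>H. h *\<^sub>v v = v"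
    using assms unfolding stabilizer_states_def by blast
  have iso: "isotropic n H" by (rule stabilizer_group_isotropic[OF v(3)])
  have dim: "dim_vec v = 2 ^ n" using v(2) by (simp add: pure_state_def)
  show ?thesis
  proof
    show "maximal_isotropic n H"
      using card_stabilizer_group[OF v(3)] maximal_isotropic_iff_card[OF iso] by simp
    fix h assume h: "h \<in> H"
    have hp: "h \<in> hermitian_paulis n" by (rule isotropicD(1)[OF iso h])
    show "h * \<sigma> = \<sigma>" unfolding v(1) using v(4) h hp dim by (intro density_mult_left) auto
    show "\<sigma> * h = \<sigma>" unfolding v(1) using v(4) h hp dim hermitian_pauli_cnj_index[OF hp]
      by (intro density_mult_right[of h "2 ^ n"]) auto
  qed (use v dim in \<open>simp_all add: mtrace_density pure_state_def\<close>)
qed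

lemma stabilizer_state_pauli_expectation:
  assumes max: "maximal_isotropic n H" and absorb: "\<And>h. h \<in> H \<Longrightarrow> h * \<sigma> = \<sigma>" "\<And>h. h \<in> H \<Longrightarrow> \<sigma> * h = \<sigma>"
    and \<sigma>: "\<sigma> \<in> carrier_mat (2 ^ n) (2 ^ n)" "mtrace \<sigma> = 1" and P: "P \<in> hermitian_paulis n"
  shows "P \<in> H \<or> - P \<in> H \<Longrightarrow> mtrace (P * \<sigma>) = 1 \<or> mtrace (P * \<sigma>) = - 1"
    "P \<notin> H \<Longrightarrow> - P \<notin> H \<Longrightarrow> mtrace (P * \<sigma>) = 0"
proof -
  have iso: "isotropic n H" using max by (simp add: maximal_isotropic_def)
  assume "P \<in> H \<or> - P \<in> H"
  then show "mtrace (P * \<sigma>) = 1 \<or> mtrace (P * \<sigma>) = - 1"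
  proof
    assume "P \<in> H" then show ?thesis using absorb \<sigma> by simp
  next
    assume "- P \<in> H"
    then have "- (P * \<sigma>) = \<sigma>" using absorb P \<sigma>(1) by fastforce
    then have "P * \<sigma> = - \<sigma>" by (metis uminus_uminus_mat)
    then show ?thesis using \<sigma> by (simp add: mtrace_uminus[of _ "2 ^ n"])
  qed
next
  have iso: "isotropic n H" using max by (simp add: maximal_isotropic_def)
  assume "P \<notin> H" "- P \<notin> H"
  then obtain h where h: "h \<in> H" "P * h \<noteq> h * P" using max P unfolding maximal_isotropic_def by blast
  have hp: "h \<in> hermitian_paulis n" using isotropicD(1)[OF iso h(1)] .
  have "h * (P * \<sigma>) = (h * P) * \<sigma>" using hp P \<sigma>(1) by (simp add: mat_assoc del: assoc_mult_mat)
  also have "h * P = - (P * h)" using hermitian_pauli_anticommute(1)[OF P hp h(2)] by simp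
  also have "- (P * h) * \<sigma> = - (P * (h * \<sigma>))" using hp P \<sigma>(1) by (simp add: mat_assoc del: assoc_mult_mat)
  also have "h * \<sigma> = \<sigma>" using absorb h by simp
  finally have "h * (P * \<sigma>) = - (P * \<sigma>)" .
  moreover have "P * \<sigma> * h = P * \<sigma>" using hp P \<sigma>(1) absorb(2)[OF h(1)] by (simp add: mat_assoc del: assoc_mult_mat)
  ultimately show "mtrace (P * \<sigma>) = 0"
    using hp P \<sigma>(1) by (intro mtrace_conj_eq_0[of _ "2 ^ n" h]) (auto simp: hermitian_pauli_square[of _ n])
qed

lemma stabilizer_state_anticommuting_bound:
  assumes "\<sigma> \<in> stabilizer_states n" "P \<in> hermitian_paulis n" "Q \<in> hermitian_paulis n" "P * Q \<noteq> Q * P"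
  shows "\<bar>Re (mtrace (P * \<sigma>)) - Re (mtrace (Q * \<sigma>))\<bar> \<le> 1"
proof -
  obtain H where H: "maximal_isotropic n H" "\<And>h. h \<in> H \<Longrightarrow> h * \<sigma> = \<sigma>" "\<And>h. h \<in> H \<Longrightarrow> \<sigma> * h = \<sigma>"
    "\<sigma> \<in> carrier_mat (2 ^ n) (2 ^ n)" "mtrace \<sigma> = 1"
    using stabilizer_state_expectation[OF assms(1)] by blast
  have iso: "isotropic n H" using H(1) by (simp add: maximal_isotropic_def)
  have e: "P \<in> H \<or> - P \<in> H \<Longrightarrow> mtrace (P * \<sigma>) = 1 \<or> mtrace (P * \<sigma>) = - 1"
    "P \<notin> H \<Longrightarrow> - P \<notin> H \<Longrightarrow> mtrace (P * \<sigma>) = 0" if "P \<in> hermitian_paulis n" for P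
    using stabilizer_state_pauli_expectation[of n H \<sigma> P] H that by blast+
  have "\<not> ((P \<in> H \<or> - P \<in> H) \<and> (Q \<in> H \<or> - Q \<in> H))"
  proof
    assume "(P \<in> H \<or> - P \<in> H) \<and> (Q \<in> H \<or> - Q \<in> H)"
    then have "P * Q = Q * P \<or> - P * Q = Q * (- P) \<or> P * (- Q) = - Q * P \<or> (- P) * (- Q) = (- Q) * (- P)"
      using isotropicD(5)[OF iso] by blast
    then show False using assms(2-4) by (auto simp: uminus_mat_eq_iff)
  qed
  then consider "P \<notin> H" "- P \<notin> H" | "Q \<notin> H" "- Q \<notin> H" by blast
  then show ?thesis
  proof cases
    case 1
    then have "mtrace (P * \<sigma>) = 0" using e(2)[OF assms(2)] by simp
    moreover have "mtrace (Q * \<sigma>) = 1 \<or> mtrace (Q * \<sigma>) = - 1 \<or> mtrace (Q * \<sigma>) = 0"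
      using e[OF assms(3)] by blast
    ultimately show ?thesis by auto
  next
    case 2
    then have "mtrace (Q * \<sigma>) = 0" using e(2)[OF assms(3)] by simp
    moreover have "mtrace (P * \<sigma>) = 1 \<or> mtrace (P * \<sigma>) = - 1 \<or> mtrace (P * \<sigma>) = 0"
      using e[OF assms(2)] by blast
    ultimately show ?thesis by auto
  qed
qed

section \<open>Combinations of stabilizer states\<close>

definition stabilizer_combination :: "nat \<Rightarrow> complex mat set \<Rightarrow> (complex mat \<Rightarrow> real) \<Rightarrow> complex mat" where
  "stabilizer_combination n F x = mat (2 ^ n) (2 ^ n) (\<lambda>(i, j). \<Sum>s\<in>F. complex_of_real (x s) * s $$ (i, j))"

definition stabilizer_decomposable :: "nat \<Rightarrow> complex mat \<Rightarrow> real \<Rightarrow> real \<Rightarrow> bool" where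
  "stabilizer_decomposable n M t r \<longleftrightarrow> (\<exists>F x. finite F \<and> F \<subseteq> stabilizer_states n \<and>
     M = stabilizer_combination n F x \<and> (\<Sum>s\<in>F. x s) = t \<and> (\<Sum>s\<in>F. \<bar>x s\<bar>) \<le> r)"

lemma stabilizer_state_carrier: "\<sigma> \<in> stabilizer_states n \<Longrightarrow> \<sigma> \<in> carrier_mat (2 ^ n) (2 ^ n)"
  by (auto simp: stabilizer_states_def pure_state_def)

lemma stabilizer_decomposable_state:
  assumes "\<sigma> \<in> stabilizer_states n" shows "stabilizer_decomposable n \<sigma> 1 1"
  unfolding stabilizer_decomposable_def
  using assms stabilizer_state_carrier[OF assms]
  by (intro exI[of _ "{\<sigma>}"] exI[of _ "\<lambda>_. 1"]) (auto simp: stabilizer_combination_def)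

lemma stabilizer_decomposable_combine:
  assumes "stabilizer_decomposable n M t r" "stabilizer_decomposable n M' t' r'"
  shows "stabilizer_decomposable n (complex_of_real a \<cdot>\<^sub>m M + complex_of_real b \<cdot>\<^sub>m M') (a * t + b * t') (\<bar>a\<bar> * r + \<bar>b\<bar> * r')"
proof -
  obtain F x where F: "finite F" "F \<subseteq> stabilizer_states n" "M = stabilizer_combination n F x"
    "(\<Sum>s\<in>F. x s) = t" "(\<Sum>s\<in>F. \<bar>x s\<bar>) \<le> r" using assms(1) unfolding stabilizer_decomposable_def by blast
  obtain F' x' where F': "finite F'" "F' \<subseteq> stabilizer_states n" "M' = stabilizer_combination n F' x'"
    "(\<Sum>s\<in>F'. x' s) = t'" "(\<Sum>s\<in>F'. \<bar>x' s\<bar>) \<le> r'" using assms(2) unfolding stabilizer_decomposable_def by blast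
  define y where "y s = (if s \<in> F then x s else 0)" for s
  define y' where "y' s = (if s \<in> F' then x' s else 0)" for s
  have ext: "(\<Sum>s\<in>F \<union> F'. f (y s) s) = (\<Sum>s\<in>F. f (x s) s)" if "\<And>s. f 0 s = 0"
    for f :: "real \<Rightarrow> complex mat \<Rightarrow> 'z::comm_monoid_add"
    using F(1) F'(1) that by (intro sum.mono_neutral_cong_right) (auto simp: y_def)
  have ext': "(\<Sum>s\<in>F \<union> F'. f (y' s) s) = (\<Sum>s\<in>F'. f (x' s) s)" if "\<And>s. f 0 s = 0"
    for f :: "real \<Rightarrow> complex mat \<Rightarrow> 'z::comm_monoid_add"
    using F(1) F'(1) that by (intro sum.mono_neutral_cong_right) (auto simp: y'_def)
  let ?z = "\<lambda>s. a * y s + b * y' s"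
  have "complex_of_real a \<cdot>\<^sub>m M + complex_of_real b \<cdot>\<^sub>m M' = stabilizer_combination n (F \<union> F') ?z"
  proof (intro eq_matI)
    fix i j assume "i < dim_row (stabilizer_combination n (F \<union> F') ?z)" "j < dim_col (stabilizer_combination n (F \<union> F') ?z)"
    then have ij: "i < 2 ^ n" "j < 2 ^ n" by (simp_all add: stabilizer_combination_def)
    have "stabilizer_combination n (F \<union> F') ?z $$ (i, j) =
      of_real a * (\<Sum>s\<in>F \<union> F'. of_real (y s) * s $$ (i, j)) + of_real b * (\<Sum>s\<in>F \<union> F'. of_real (y' s) * s $$ (i, j))"
      using ij by (simp add: stabilizer_combination_def sum_distrib_left sum.distrib ring_distribs mult.assoc)
    also have "\<dots> = of_real a * (\<Sum>s\<in>F. of_real (x s) * s $$ (i, j)) + of_real b * (\<Sum>s\<in>F'. of_real (x' s) * s $$ (i, j))"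
      using ext[of "\<lambda>r s. of_real r * s $$ (i, j)"] ext'[of "\<lambda>r s. of_real r * s $$ (i, j)"] by simp
    finally show "(complex_of_real a \<cdot>\<^sub>m M + complex_of_real b \<cdot>\<^sub>m M') $$ (i, j) = stabilizer_combination n (F \<union> F') ?z $$ (i, j)"
      using ij F(3) F'(3) by (simp add: stabilizer_combination_def)
  qed (simp_all add: F(3) F'(3) stabilizer_combination_def)
  moreover have "(\<Sum>s\<in>F \<union> F'. ?z s) = a * t + b * t'"
    using ext[of "\<lambda>r s. r"] ext'[of "\<lambda>r s. r"] F(4) F'(4) by (simp add: sum.distrib flip: sum_distrib_left)
  moreover have "(\<Sum>s\<in>F \<union> F'. \<bar>?z s\<bar>) \<le> \<bar>a\<bar> * r + \<bar>b\<bar> * r'"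
  proof -
    have "(\<Sum>s\<in>F \<union> F'. \<bar>?z s\<bar>) \<le> (\<Sum>s\<in>F \<union> F'. \<bar>a\<bar> * \<bar>y s\<bar> + \<bar>b\<bar> * \<bar>y' s\<bar>)"
      by (intro sum_mono) (metis abs_mult abs_triangle_ineq)
    also have "\<dots> = \<bar>a\<bar> * (\<Sum>s\<in>F. \<bar>x s\<bar>) + \<bar>b\<bar> * (\<Sum>s\<in>F'. \<bar>x' s\<bar>)"
      using ext[of "\<lambda>r s. \<bar>r\<bar>"] ext'[of "\<lambda>r s. \<bar>r\<bar>"] by (simp add: sum.distrib flip: sum_distrib_left)
    also have "\<dots> \<le> \<bar>a\<bar> * r + \<bar>b\<bar> * r'" using F(5) F'(5) by (intro add_mono mult_left_mono) auto
    finally show ?thesis .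
  qed
  ultimately show ?thesis
    unfolding stabilizer_decomposable_def using F(1,2) F'(1,2) by (intro exI[of _ "F \<union> F'"] exI[of _ ?z]) auto
qed

lemma stabilizer_projector_extend:
  assumes iso: "isotropic n H" and P: "P \<in> hermitian_paulis n"
    and "\<forall>h\<in>H. P * h = h * P" and "P \<notin> H" "- P \<notin> H"
  shows "stabilizer_projector n (H \<union> (*) P ` H) = stabilizer_projector n H + P * stabilizer_projector n H"
proof -
  have sub: "H \<subseteq> hermitian_paulis n" using isotropicD(1)[OF iso] by blast
  have "mat_sum (2 ^ n) (\<lambda>h. h) (H \<union> (*) P ` H) =
      mat_sum (2 ^ n) (\<lambda>h. h) H + mat_sum (2 ^ n) (\<lambda>h. h) ((*) P ` H)"
    using isotropic_finite[OF iso] isotropic_coset_disjoint[OF assms] by (intro mat_sum_Un_disjoint) auto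
  also have "mat_sum (2 ^ n) (\<lambda>h. h) ((*) P ` H) = mat_sum (2 ^ n) (\<lambda>k. P * k) H"
    using hermitian_pauli_inj_mult[OF P sub] by (simp add: mat_sum_reindex)
  also have "\<dots> = P * mat_sum (2 ^ n) (\<lambda>h. h) H"
    using P sub by (intro mat_sum_mult_left[symmetric]) auto
  finally have "stabilizer_projector n (H \<union> (*) P ` H) =
      (1 / 2 ^ n) \<cdot>\<^sub>m (mat_sum (2 ^ n) (\<lambda>h. h) H + P * mat_sum (2 ^ n) (\<lambda>h. h) H)"
    by (simp add: stabilizer_projector_def)
  also have "\<dots> = stabilizer_projector n H + P * stabilizer_projector n H"
    unfolding stabilizer_projector_def using P
    by (subst add_smult_distrib_left_mat[of _ "2 ^ n" "2 ^ n"]) (auto simp: mult_smult_mat)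
  finally show ?thesis .
qed

lemma stabilizer_projector_decomposable:
  assumes "isotropic n H"
  shows "stabilizer_decomposable n (stabilizer_projector n H) 1 1"
  using assms
proof (induction "card (hermitian_paulis n) - card H" arbitrary: H rule: less_induct)
  case less
  show ?case
  proof (cases "maximal_isotropic n H")
    case True
    then show ?thesis by (intro stabilizer_decomposable_state maximal_isotropic_stabilizer_state)
  next
    case False
    then obtain P where P: "P \<in> hermitian_paulis n" "\<forall>h\<in>H. P * h = h * P" "P \<notin> H" "- P \<notin> H"
      using less.prems unfolding maximal_isotropic_def by blast
    have "- P * h = h * - P" if "h \<in> H" for h
    proof -
      have "dim_row h = 2 ^ n" "dim_col h = 2 ^ n" using isotropicD(1)[OF less.prems that] by simp_all
      then show ?thesis using P(1,2) that by simp
    qed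
    then have mP: "- P \<in> hermitian_paulis n" "\<forall>h\<in>H. - P * h = h * - P" "- P \<notin> H" "- (- P) \<notin> H"
      using P by simp_all
    have step: "stabilizer_decomposable n (stabilizer_projector n (H \<union> (*) R ` H)) 1 1"
      if R: "R \<in> hermitian_paulis n" "\<forall>h\<in>H. R * h = h * R" "R \<notin> H" "- R \<notin> H" for R
    proof (rule less.hyps)
      note ext = isotropic_extend[OF less.prems R]
      have "card (H \<union> (*) R ` H) \<le> card (hermitian_paulis n)"
        using isotropicD(1)[OF ext] by (intro card_mono[OF finite_hermitian_paulis]) blast
      moreover have "card H > 0" using isotropicD(2)[OF less.prems] isotropic_finite[OF less.prems] card_gt_0_iff by blast
      ultimately show "card (hermitian_paulis n) - card (H \<union> (*) R ` H) < card (hermitian_paulis n) - card H"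
        using isotropic_extend_card[OF less.prems R] by linarith
      show "isotropic n (H \<union> (*) R ` H)" by (rule ext)
    qed
    have "stabilizer_projector n H = complex_of_real (1 / 2) \<cdot>\<^sub>m stabilizer_projector n (H \<union> (*) P ` H) +
        complex_of_real (1 / 2) \<cdot>\<^sub>m stabilizer_projector n (H \<union> (*) (- P) ` H)"
      unfolding stabilizer_projector_extend[OF less.prems P] stabilizer_projector_extend[OF less.prems mP]
      using P(1) by (intro eq_matI) (simp_all add: field_simps del: index_mult_mat(1))
    then show ?thesis
      using stabilizer_decomposable_combine[OF step[OF P] step[OF mP], of "1 / 2" "1 / 2"] by simp
  qed
qed

lemma robustness_alt:
  "robustness n M = Inf {(\<Sum>s\<in>F. \<bar>x s\<bar>) | F x. finite F \<and> F \<subseteq> stabilizer_states n \<and>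
     M = stabilizer_combination n F x \<and> (\<Sum>s\<in>F. x s) = 1}"
  unfolding robustness_def stabilizer_combination_def ..

lemma robustness_le:
  assumes "stabilizer_decomposable n M 1 r" shows "robustness n M \<le> r"
proof -
  obtain F x where F: "finite F" "F \<subseteq> stabilizer_states n" "M = stabilizer_combination n F x"
    "(\<Sum>s\<in>F. x s) = 1" "(\<Sum>s\<in>F. \<bar>x s\<bar>) \<le> r" using assms unfolding stabilizer_decomposable_def by blast
  have "robustness n M \<le> (\<Sum>s\<in>F. \<bar>x s\<bar>)"
    unfolding robustness_alt using F
    by (intro cInf_lower bdd_belowI[of _ 0]) (auto intro!: sum_nonneg)
  then show ?thesis using F(5) by linarith
qed

lemma robustness_ge:
  assumes "stabilizer_decomposable n M 1 r"
    and "\<And>F x. finite F \<Longrightarrow> F \<subseteq> stabilizer_states n \<Longrightarrow> M = stabilizer_combination n F x \<Longrightarrow>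
      (\<Sum>s\<in>F. x s) = 1 \<Longrightarrow> c \<le> (\<Sum>s\<in>F. \<bar>x s\<bar>)"
  shows "c \<le> robustness n M"
  unfolding robustness_alt
proof (rule cInf_greatest)
  show "{(\<Sum>s\<in>F. \<bar>x s\<bar>) | F x. finite F \<and> F \<subseteq> stabilizer_states n \<and>
     M = stabilizer_combination n F x \<and> (\<Sum>s\<in>F. x s) = 1} \<noteq> {}"
    using assms(1) unfolding stabilizer_decomposable_def by blast
qed (use assms(2) in blast)

section \<open>A witness for magic\<close>

lemma stabilizer_projector_commute:
  assumes iso: "isotropic n H" and P: "P \<in> carrier_mat (2 ^ n) (2 ^ n)" and "\<forall>h\<in>H. P * h = h * P"
  shows "P * stabilizer_projector n H = stabilizer_projector n H * P"
proof -
  have c: "\<And>k. k \<in> H \<Longrightarrow> k \<in> carrier_mat (2 ^ n) (2 ^ n)" using isotropicD(1)[OF iso] by blast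
  have "P * mat_sum (2 ^ n) (\<lambda>h. h) H = mat_sum (2 ^ n) (\<lambda>h. P * h) H"
    by (rule mat_sum_mult_left[OF P]) (rule c)
  also have "\<dots> = mat_sum (2 ^ n) (\<lambda>h. h * P) H" using assms(3) by (intro mat_sum_cong) simp
  also have "\<dots> = mat_sum (2 ^ n) (\<lambda>h. h) H * P"
    by (rule mat_sum_mult_right[OF P, symmetric]) (rule c)
  finally show ?thesis
    using P by (simp add: stabilizer_projector_def mult_smult_mat smult_mult_mat)
qed

definition half_root :: real where "half_root = 1 / sqrt 2"

lemma half_root: "half_root > 0" "half_root < 1" "2 * half_root = sqrt 2" "half_root * half_root = 1 / 2" "sqrt 2 * half_root = 1"
  by (simp_all add: half_root_def real_div_sqrt)

definition magic_operator :: "nat \<Rightarrow> complex mat set \<Rightarrow> complex mat \<Rightarrow> complex mat \<Rightarrow> complex mat" where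
  "magic_operator n H Z Y =
     (1\<^sub>m (2 ^ n) + complex_of_real half_root \<cdot>\<^sub>m (Z - Y)) * stabilizer_projector n H"

lemma magic_operator_alt:
  assumes "Z \<in> carrier_mat (2 ^ n) (2 ^ n)" "Y \<in> carrier_mat (2 ^ n) (2 ^ n)"
  shows "magic_operator n H Z Y = stabilizer_projector n H +
    complex_of_real half_root \<cdot>\<^sub>m (Z * stabilizer_projector n H - Y * stabilizer_projector n H)"
  using assms by (simp add: magic_operator_def mat_distrib smult_mult_mat)

context
  fixes n H Z Y
  assumes iso: "isotropic n H" and Z: "Z \<in> hermitian_paulis n" and Y: "Y \<in> hermitian_paulis n"
    and Z_comm: "\<forall>h\<in>H. Z * h = h * Z" and Y_comm: "\<forall>h\<in>H. Y * h = h * Y" and ZY: "Z * Y \<noteq> Y * Z"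
begin

abbreviation (input) "T \<equiv> stabilizer_projector n H"

lemma witness_commute: "Z * T = T * Z" "Y * T = T * Y"
  using stabilizer_projector_commute[OF iso] Z Y Z_comm Y_comm by blast+

lemma witness_anticommute: "Z * Y = - (Y * Z)" "Y * Z = - (Z * Y)"
  using hermitian_pauli_anticommute(1)[OF Z Y] hermitian_pauli_anticommute(1)[OF Y Z] ZY by (blast, metis)

lemma witness_left: 
  assumes "dim_row M = 2 ^ n"
  shows "Z * (Z * M) = M" "Y * (Y * M) = M" "Y * (Z * M) = - (Z * (Y * M))"
proof -
  show "Z * (Z * M) = M" "Y * (Y * M) = M" using hermitian_pauli_cancel Z Y assms by blast+
  have "Y * (Z * M) = Y * Z * M" using Z Y assms by (simp add: mat_assoc del: assoc_mult_mat)
  also have "\<dots> = - (Z * (Y * M))"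
    unfolding witness_anticommute(2) using Z Y assms by (simp add: mat_assoc del: assoc_mult_mat)
  finally show "Y * (Z * M) = - (Z * (Y * M))" .
qed

lemma witness_traces: "mtrace (Z * T) = 0" "mtrace (Y * T) = 0" "mtrace (Z * (Y * T)) = 0"
proof -
  have cZ: "Z \<in> carrier_mat (2 ^ n) (2 ^ n)" and cY: "Y \<in> carrier_mat (2 ^ n) (2 ^ n)" using Z Y by auto
  have TZ: "M * T * Z = M * (Z * T)" "M * T * Y = M * (Y * T)" if "dim_col M = 2 ^ n" for M
    using that Z Y witness_commute by (simp_all add: mat_assoc del: assoc_mult_mat)
  show "mtrace (Z * T) = 0"
  proof (rule mtrace_conj_eq_0[OF _ cY hermitian_pauli_square[OF Y]])
    show "Y * (Z * T) = - (Z * T * Y)" using Z Y by (simp add: TZ witness_left del: assoc_mult_mat)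
  qed (use cZ cY in auto)
  show "mtrace (Y * T) = 0"
  proof (rule mtrace_conj_eq_0[OF _ cZ hermitian_pauli_square[OF Z]])
    show "Z * (Y * T) = - (Y * T * Z)" using Z Y by (simp add: TZ witness_left del: assoc_mult_mat)
  qed (use cZ cY in auto)
  show "mtrace (Z * (Y * T)) = 0"
  proof (rule mtrace_conj_eq_0[OF _ cZ hermitian_pauli_square[OF Z]])
    have "Z * (Y * T) * Z = (Z * Y) * T * Z" using Z Y by (simp add: mat_assoc del: assoc_mult_mat)
    also have "\<dots> = Z * (Y * (Z * T))" using Z Y by (simp add: TZ) (simp add: mat_assoc del: assoc_mult_mat)
    finally show "Z * (Z * (Y * T)) = - (Z * (Y * T) * Z)"
      using Z Y by (simp add: witness_left del: assoc_mult_mat)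
  qed (use cZ cY in auto)
qed

lemma witness_value: "Re (mtrace (Z * magic_operator n H Z Y)) - Re (mtrace (Y * magic_operator n H Z Y)) = sqrt 2"
proof -
  have cZ: "Z \<in> carrier_mat (2 ^ n) (2 ^ n)" and cY: "Y \<in> carrier_mat (2 ^ n) (2 ^ n)" using Z Y by auto
  have c: "Z * (Y * T) \<in> carrier_mat (2 ^ n) (2 ^ n)" using cZ cY by auto
  have "Z * magic_operator n H Z Y = Z * T + complex_of_real half_root \<cdot>\<^sub>m (T - Z * (Y * T))"
    unfolding magic_operator_alt[OF cZ cY] using Z Y
    by (simp add: mat_distrib mult_smult_mat witness_left del: assoc_mult_mat)
  moreover have "mtrace \<dots> = half_root"
    using cZ cY c
    by (simp add: mtrace_add[of _ "2 ^ n"] mtrace_smult[of _ "2 ^ n"] mtrace_minus[of _ "2 ^ n"] minus_carrier_mat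
      witness_traces mtrace_stabilizer_projector[OF iso] del: assoc_mult_mat)
  moreover have "Y * magic_operator n H Z Y = Y * T + complex_of_real half_root \<cdot>\<^sub>m (- (Z * (Y * T)) - T)"
    unfolding magic_operator_alt[OF cZ cY] using Z Y
    by (simp add: mat_distrib mult_smult_mat witness_left del: assoc_mult_mat)
  moreover have "mtrace \<dots> = - half_root"
    using cZ cY c
    by (simp add: mtrace_add[of _ "2 ^ n"] mtrace_smult[of _ "2 ^ n"] mtrace_minus[of _ "2 ^ n"] minus_carrier_mat
      mtrace_uminus[of _ "2 ^ n"] witness_traces mtrace_stabilizer_projector[OF iso] del: assoc_mult_mat)
  ultimately show ?thesis using half_root(3) by simp
qed

lemma witness_notin: "Z \<notin> H" "- Z \<notin> H" "Y \<notin> H" "- Y \<notin> H"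
proof -
  have "Z * P \<noteq> P * Z" if "P = Y \<or> P = - Y" for P using that ZY Z Y by (auto simp: uminus_mat_eq_iff)
  then show "Y \<notin> H" "- Y \<notin> H" using Z_comm by blast+
  have "Y * P \<noteq> P * Y" if "P = Z \<or> P = - Z" for P using that ZY Z Y by (auto simp: uminus_mat_eq_iff)
  then show "Z \<notin> H" "- Z \<notin> H" using Y_comm by blast+
qed

lemma magic_operator_decomposable: "\<exists>r. stabilizer_decomposable n (magic_operator n H Z Y) 1 r"
proof -
  have mY: "- Y \<in> hermitian_paulis n" "\<forall>h\<in>H. - Y * h = h * - Y" "- (- Y) \<notin> H"
  proof -
    show "\<forall>h\<in>H. - Y * h = h * - Y"
    proof
      fix h assume h: "h \<in> H"
      have "dim_row h = 2 ^ n" "dim_col h = 2 ^ n" using isotropicD(1)[OF iso h] by simp_all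
      then show "- Y * h = h * - Y" using Y Y_comm h by simp
    qed
  qed (use Y witness_notin in simp_all)
  note TZ = stabilizer_projector_extend[OF iso Z Z_comm witness_notin(1,2)]
  note TY = stabilizer_projector_extend[OF iso mY(1,2) witness_notin(4) mY(3)]
  have "stabilizer_decomposable n (complex_of_real half_root \<cdot>\<^sub>m (T + Z * T) + complex_of_real half_root \<cdot>\<^sub>m (T + - Y * T))
     (half_root * 1 + half_root * 1) (\<bar>half_root\<bar> * 1 + \<bar>half_root\<bar> * 1)"
    using stabilizer_projector_decomposable[OF isotropic_extend[OF iso Z Z_comm witness_notin(1,2)]]
      stabilizer_projector_decomposable[OF isotropic_extend[OF iso mY(1,2) witness_notin(4) mY(3)]]
    unfolding TZ TY by (rule stabilizer_decomposable_combine)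
  from stabilizer_decomposable_combine[OF this stabilizer_projector_decomposable[OF iso], of 1 "1 - 2 * half_root"]
  have "\<exists>r. stabilizer_decomposable n (complex_of_real 1 \<cdot>\<^sub>m (complex_of_real half_root \<cdot>\<^sub>m (T + Z * T) + complex_of_real half_root \<cdot>\<^sub>m (T + - Y * T)) +
      complex_of_real (1 - 2 * half_root) \<cdot>\<^sub>m T) 1 r"
    by auto
  moreover have "complex_of_real 1 \<cdot>\<^sub>m (complex_of_real half_root \<cdot>\<^sub>m (T + Z * T) + complex_of_real half_root \<cdot>\<^sub>m (T + - Y * T)) +
      complex_of_real (1 - 2 * half_root) \<cdot>\<^sub>m T = magic_operator n H Z Y"
    using Z Y by (subst magic_operator_alt) (auto simp: algebra_simps simp del: index_mult_mat(1) intro!: eq_matI)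
  ultimately show ?thesis by simp
qed

lemma robustness_magic_operator: "robustness n (magic_operator n H Z Y) > 1"
proof -
  obtain r where r: "stabilizer_decomposable n (magic_operator n H Z Y) 1 r" using magic_operator_decomposable by blast
  have "sqrt 2 \<le> robustness n (magic_operator n H Z Y)"
  proof (rule robustness_ge[OF r])
    fix F :: "complex mat set" and x
    assume F: "finite F" "F \<subseteq> stabilizer_states n" "magic_operator n H Z Y = stabilizer_combination n F x"
    have car: "s \<in> carrier_mat (2 ^ n) (2 ^ n)" if "s \<in> F" for s
      using that F(2) stabilizer_state_carrier by blast
    have comb: "stabilizer_combination n F x = mat_sum (2 ^ n) (\<lambda>s. complex_of_real (x s) \<cdot>\<^sub>m s) F"
    proof (intro eq_matI)
      fix i j assume ij: "i < dim_row (mat_sum (2 ^ n) (\<lambda>s. complex_of_real (x s) \<cdot>\<^sub>m s) F)" "j < dim_col (mat_sum (2 ^ n) (\<lambda>s. complex_of_real (x s) \<cdot>\<^sub>m s) F)"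
      have "(complex_of_real (x s) \<cdot>\<^sub>m s) $$ (i, j) = complex_of_real (x s) * s $$ (i, j)" if "s \<in> F" for s
        using car[OF that] ij by auto
      then show "stabilizer_combination n F x $$ (i, j) = mat_sum (2 ^ n) (\<lambda>s. complex_of_real (x s) \<cdot>\<^sub>m s) F $$ (i, j)"
        using ij by (simp add: stabilizer_combination_def)
    qed (simp_all add: stabilizer_combination_def)
    have lin: "mtrace (P * magic_operator n H Z Y) = (\<Sum>s\<in>F. complex_of_real (x s) * mtrace (P * s))"
      if P: "P \<in> hermitian_paulis n" for P
    proof -
      have cP: "P \<in> carrier_mat (2 ^ n) (2 ^ n)" using P by blast
      have "P * magic_operator n H Z Y = mat_sum (2 ^ n) (\<lambda>s. P * (complex_of_real (x s) \<cdot>\<^sub>m s)) F"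
        unfolding F(3) comb by (rule mat_sum_mult_left[OF cP]) (use car in auto)
      also have "mtrace \<dots> = (\<Sum>s\<in>F. mtrace (P * (complex_of_real (x s) \<cdot>\<^sub>m s)))"
        by (rule mtrace_mat_sum) (use car cP in auto)
      also have "\<dots> = (\<Sum>s\<in>F. complex_of_real (x s) * mtrace (P * s))"
      proof (intro sum.cong refl)
        fix s assume "s \<in> F"
        then have s: "s \<in> carrier_mat (2 ^ n) (2 ^ n)" by (rule car)
        then have "P * s \<in> carrier_mat (2 ^ n) (2 ^ n)" using cP by simp
        then show "mtrace (P * (complex_of_real (x s) \<cdot>\<^sub>m s)) = complex_of_real (x s) * mtrace (P * s)"
          using s cP by (simp add: mult_smult_mat mtrace_smult[of _ "2 ^ n"])
      qed
      finally show ?thesis .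
    qed
    have "sqrt 2 = (\<Sum>s\<in>F. x s * (Re (mtrace (Z * s)) - Re (mtrace (Y * s))))"
      unfolding witness_value[symmetric] lin[OF Z] lin[OF Y]
      by (simp add: sum_subtractf right_diff_distrib)
    also have "\<dots> \<le> (\<Sum>s\<in>F. \<bar>x s\<bar> * 1)"
    proof (intro sum_mono)
      fix s assume "s \<in> F"
      then have "\<bar>Re (mtrace (Z * s)) - Re (mtrace (Y * s))\<bar> \<le> 1"
        using stabilizer_state_anticommuting_bound[OF _ Z Y ZY] F(2) by blast
      then have "\<bar>x s * (Re (mtrace (Z * s)) - Re (mtrace (Y * s)))\<bar> \<le> \<bar>x s\<bar> * 1"
        unfolding abs_mult by (intro mult_left_mono) simp_all
      then show "x s * (Re (mtrace (Z * s)) - Re (mtrace (Y * s))) \<le> \<bar>x s\<bar> * 1" by linarith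
    qed
    finally show "sqrt 2 \<le> (\<Sum>s\<in>F. \<bar>x s\<bar>)" by simp
  qed
  moreover have "1 < sqrt (2::real)" by simp
  ultimately show ?thesis by linarith
qed

end

lemma robustness_partial:
  assumes iso: "isotropic n H" and P: "P \<in> hermitian_paulis n" "\<forall>h\<in>H. P * h = h * P" "P \<notin> H" "- P \<notin> H"
    and a: "0 \<le> a" "a \<le> 1"
  shows "robustness n (stabilizer_projector n H + complex_of_real a \<cdot>\<^sub>m (P * stabilizer_projector n H)) \<le> 1"
proof (rule robustness_le)
  let ?T = "stabilizer_projector n H"
  have "stabilizer_decomposable n (complex_of_real (1 - a) \<cdot>\<^sub>m ?T + complex_of_real a \<cdot>\<^sub>m (?T + P * ?T)) ((1 - a) * 1 + a * 1) (\<bar>1 - a\<bar> * 1 + \<bar>a\<bar> * 1)"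
    using stabilizer_projector_decomposable[OF iso] stabilizer_projector_decomposable[OF isotropic_extend[OF iso P]]
    unfolding stabilizer_projector_extend[OF iso P] by (rule stabilizer_decomposable_combine)
  moreover have "complex_of_real (1 - a) \<cdot>\<^sub>m ?T + complex_of_real a \<cdot>\<^sub>m (?T + P * ?T) = ?T + complex_of_real a \<cdot>\<^sub>m (P * ?T)"
    using P(1) by (intro eq_matI) (auto simp: algebra_simps simp del: index_mult_mat(1))
  ultimately show "stabilizer_decomposable n (?T + complex_of_real a \<cdot>\<^sub>m (P * ?T)) 1 1" using a by simp
qed

section \<open>The reduced state\<close>

locale code =
  fixes L :: nat and A :: "nat set" and G :: "complex mat set" and X Y Z :: "complex mat"
  assumes A: "A \<subseteq> {..<L}" and G_iso: "isotropic L G"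
    and X: "X \<in> hermitian_paulis L" and Y: "Y \<in> hermitian_paulis L" and Z: "Z \<in> hermitian_paulis L"
    and X_comm: "\<forall>h\<in>G. X * h = h * X" and Y_comm: "\<forall>h\<in>G. Y * h = h * Y" and Z_comm: "\<forall>h\<in>G. Z * h = h * Z"
    and XZ: "X * Z = - (Z * X)" and YZ: "Y * Z = - (Z * Y)" and XY: "X * Y = - (Y * X)"
    and Y_eq: "Y = \<i> \<cdot>\<^sub>m (X * Z)"
begin

definition restricted_group :: "complex mat set" where
  "restricted_group = {N \<in> hermitian_paulis (card A). embed_operator L A N \<in> G}"

lemma restricted_group_isotropic: "isotropic (card A) restricted_group"
proof -
  have car: "N \<in> carrier_mat (2 ^ card A) (2 ^ card A)" if "N \<in> restricted_group" for N
    using that by (auto simp: restricted_group_def)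
  have hom: "embed_operator L A (a * b) = embed_operator L A a * embed_operator L A b"
    if "a \<in> restricted_group" "b \<in> restricted_group" for a b
    using embed_operator_mult[OF A] car that by simp
  have comm: "a * b = b * a" if "a \<in> restricted_group" "b \<in> restricted_group" for a b
  proof -
    have "embed_operator L A a * embed_operator L A b = embed_operator L A b * embed_operator L A a"
      using isotropicD(5)[OF G_iso] that by (simp add: restricted_group_def)
    then have "embed_operator L A (a * b) = embed_operator L A (b * a)" using hom that by simp
    then show ?thesis using embed_operator_inject[OF A, of "a * b" "b * a"] car[OF that(1)] car[OF that(2)] by simp
  qed
  show ?thesis
    unfolding isotropic_def
  proof (intro conjI ballI)
    show "1\<^sub>m (2 ^ card A) \<in> restricted_group"
      using isotropicD(2)[OF G_iso] by (simp add: restricted_group_def embed_operator_one[OF A])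
    show "- 1\<^sub>m (2 ^ card A) \<notin> restricted_group"
      using isotropicD(3)[OF G_iso] by (simp add: restricted_group_def embed_operator_uminus[OF A] embed_operator_one[OF A])
    fix a b assume ab: "a \<in> restricted_group" "b \<in> restricted_group"
    show "a * b = b * a" by (rule comm[OF ab])
    show "a * b \<in> restricted_group"
      using ab hermitian_pauli_mult_closed[of a "card A" b] comm[OF ab] hom[OF ab] isotropicD(4)[OF G_iso]
      by (simp add: restricted_group_def)
  qed (auto simp: restricted_group_def)
qed

lemma card_complement: "card A + card ({..<L} - A) = L"
  using A finite_subsystem[OF A] card_mono[OF _ A] by (simp add: card_Diff_subset)

lemma reduced_projector:
  "reduced_state L A (stabilizer_projector L G) = stabilizer_projector (card A) restricted_group"
proof -
  let ?c = "2 ^ card ({..<L} - A) :: complex"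
  have sub: "embed_operator L A ` restricted_group \<subseteq> G" by (auto simp: restricted_group_def)
  have inj: "inj_on (embed_operator L A) restricted_group"
    by (rule inj_onI) (metis embed_operator_inject[OF A] hermitian_pauli_carrier isotropicD(1)[OF restricted_group_isotropic])
  have zero: "reduced_state L A h = 0\<^sub>m (2 ^ card A) (2 ^ card A)" if "h \<in> G - embed_operator L A ` restricted_group" for h
  proof (rule reduced_state_not_supported[OF A])
    show "h \<in> hermitian_paulis L" using that isotropicD(1)[OF G_iso] by blast
    show "\<not> supported_on L A h" using that unfolding supported_on_iff[OF A] restricted_group_def by blast
  qed
  have car: "N \<in> carrier_mat (2 ^ card A) (2 ^ card A)" if "N \<in> restricted_group" for N
    using that by (auto simp: restricted_group_def)
  have "reduced_state L A (mat_sum (2 ^ L) (\<lambda>h. h) G) = mat_sum (2 ^ card A) (reduced_state L A) G"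
    by (rule reduced_state_mat_sum[OF A])
  also have "\<dots> = mat_sum (2 ^ card A) (reduced_state L A) (embed_operator L A ` restricted_group)"
  proof (intro eq_matI)
    fix i j assume "i < dim_row (mat_sum (2 ^ card A) (reduced_state L A) (embed_operator L A ` restricted_group))"
      "j < dim_col (mat_sum (2 ^ card A) (reduced_state L A) (embed_operator L A ` restricted_group))"
    then have ij: "i < 2 ^ card A" "j < 2 ^ card A" by simp_all
    have "(\<Sum>h\<in>G. reduced_state L A h $$ (i, j)) = (\<Sum>h\<in>embed_operator L A ` restricted_group. reduced_state L A h $$ (i, j))"
      using isotropic_finite[OF G_iso] sub zero ij by (intro sum.mono_neutral_right) auto
    then show "mat_sum (2 ^ card A) (reduced_state L A) G $$ (i, j) =
      mat_sum (2 ^ card A) (reduced_state L A) (embed_operator L A ` restricted_group) $$ (i, j)" using ij by simp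
  qed simp_all
  also have "\<dots> = mat_sum (2 ^ card A) (\<lambda>N. reduced_state L A (embed_operator L A N)) restricted_group"
    by (rule mat_sum_reindex[OF inj])
  also have "\<dots> = mat_sum (2 ^ card A) (\<lambda>N. ?c \<cdot>\<^sub>m N) restricted_group"
    using car by (intro mat_sum_cong reduced_state_embed[OF A])
  also have "\<dots> = ?c \<cdot>\<^sub>m mat_sum (2 ^ card A) (\<lambda>h. h) restricted_group"
  proof (intro eq_matI)
    fix i j assume "i < dim_row (?c \<cdot>\<^sub>m mat_sum (2 ^ card A) (\<lambda>h. h) restricted_group)" "j < dim_col (?c \<cdot>\<^sub>m mat_sum (2 ^ card A) (\<lambda>h. h) restricted_group)"
    then have ij: "i < 2 ^ card A" "j < 2 ^ card A" by simp_all
    have "(?c \<cdot>\<^sub>m N) $$ (i, j) = ?c * N $$ (i, j)" if "N \<in> restricted_group" for N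
      using car[OF that] ij by auto
    then show "mat_sum (2 ^ card A) (\<lambda>N. ?c \<cdot>\<^sub>m N) restricted_group $$ (i, j) =
      (?c \<cdot>\<^sub>m mat_sum (2 ^ card A) (\<lambda>h. h) restricted_group) $$ (i, j)" using ij by (simp add: sum_distrib_left)
  qed simp_all
  finally have "reduced_state L A (stabilizer_projector L G) =
      (1 / 2 ^ L * ?c) \<cdot>\<^sub>m mat_sum (2 ^ card A) (\<lambda>h. h) restricted_group"
    by (simp add: stabilizer_projector_def reduced_state_smult[OF A])
  moreover have "1 / 2 ^ L * ?c = 1 / 2 ^ card A"
  proof -
    have "(2::complex) ^ L = 2 ^ card A * ?c" by (simp add: card_complement flip: power_add)
    then show ?thesis by simp
  qed
  ultimately show ?thesis by (simp add: stabilizer_projector_def)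
qed

lemma reduced_logical:
  assumes P: "P \<in> hermitian_paulis L" and comm: "\<forall>h\<in>G. P * h = h * P"
  shows "\<not> reducible_to L G P A \<Longrightarrow>
      reduced_state L A (P * stabilizer_projector L G) = 0\<^sub>m (2 ^ card A) (2 ^ card A)"
    "reducible_to L G P A \<Longrightarrow> \<exists>N\<in>hermitian_paulis (card A). \<exists>h\<in>G.
      embed_operator L A N = h * P \<and> (\<forall>k\<in>restricted_group. N * k = k * N) \<and>
      reduced_state L A (P * stabilizer_projector L G) = N * stabilizer_projector (card A) restricted_group"
proof -
  assume not: "\<not> reducible_to L G P A"
  have zero: "reduced_state L A (P * h) = 0\<^sub>m (2 ^ card A) (2 ^ card A)" if "h \<in> G" for h
  proof (rule reduced_state_not_supported[OF A])
    show "P * h \<in> hermitian_paulis L"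
      using hermitian_pauli_mult_closed[OF P] isotropicD(1)[OF G_iso that] comm that by blast
    show "\<not> supported_on L A (P * h)" using not comm that unfolding reducible_to_def by metis
  qed
  have "P * mat_sum (2 ^ L) (\<lambda>h. h) G = mat_sum (2 ^ L) (\<lambda>h. P * h) G"
    using P isotropicD(1)[OF G_iso] by (intro mat_sum_mult_left) auto
  then have "reduced_state L A (P * mat_sum (2 ^ L) (\<lambda>h. h) G) = mat_sum (2 ^ card A) (\<lambda>h. reduced_state L A (P * h)) G"
    by (simp add: reduced_state_mat_sum[OF A])
  also have "\<dots> = 0\<^sub>m (2 ^ card A) (2 ^ card A)" by (intro eq_matI) (simp_all add: zero)
  finally show "reduced_state L A (P * stabilizer_projector L G) = 0\<^sub>m (2 ^ card A) (2 ^ card A)"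
    using P reduced_state_smult[OF A, of "P * mat_sum (2 ^ L) (\<lambda>h. h) G" "1 / 2 ^ L"]
      mult_carrier_mat[OF hermitian_pauli_carrier[OF P] mat_sum_carrier, of "\<lambda>h. h" G]
    by (simp add: stabilizer_projector_def mult_smult_mat)
next
  let ?T = "stabilizer_projector L G" and ?TA = "stabilizer_projector (card A) restricted_group"
  assume "reducible_to L G P A"
  then obtain h N where h: "h \<in> G" and N: "N \<in> hermitian_paulis (card A)" "h * P = embed_operator L A N"
    unfolding reducible_to_def supported_on_iff[OF A] by blast
  have hp: "h \<in> hermitian_paulis L" by (rule isotropicD(1)[OF G_iso h])
  have cN: "N \<in> carrier_mat (2 ^ card A) (2 ^ card A)" using N by auto
  have E: "embed_operator L A N * k = k * embed_operator L A N" if k: "k \<in> G" for k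
  proof -
    have kp: "k \<in> hermitian_paulis L" by (rule isotropicD(1)[OF G_iso k])
    have "h * P * k = h * (k * P)" using hp P kp comm k by (simp add: mat_assoc del: assoc_mult_mat)
    also have "\<dots> = (h * k) * P" using hp P kp by (simp add: mat_assoc del: assoc_mult_mat)
    also have "h * k = k * h" using isotropicD(5)[OF G_iso h k] .
    finally show ?thesis unfolding N(2)[symmetric] using hp P kp by (simp add: mat_assoc del: assoc_mult_mat)
  qed
  have comm_N: "N * k = k * N" if k: "k \<in> restricted_group" for k
  proof -
    have kc: "k \<in> carrier_mat (2 ^ card A) (2 ^ card A)" "embed_operator L A k \<in> G"
      using k by (auto simp: restricted_group_def)
    have "embed_operator L A (N * k) = embed_operator L A (k * N)"
      using E[OF kc(2)] embed_operator_mult[OF A] cN kc(1) by simp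
    then show ?thesis using embed_operator_inject[OF A, of "N * k" "k * N"] cN kc(1) by simp
  qed
  have "P * ?T = P * (h * ?T)" using stabilizer_projector_absorb(1)[OF G_iso h] by simp
  also have "\<dots> = (h * P) * ?T" using comm h P hp by (simp flip: mat_assoc)
  also have "\<dots> = ?T * embed_operator L A N"
    unfolding N(2) by (rule stabilizer_projector_commute[OF G_iso]) (use E in auto)
  finally have "reduced_state L A (P * ?T) = ?TA * N"
    using reduced_state_mult_embed[OF A _ cN, of ?T] reduced_projector by simp
  also have "\<dots> = N * ?TA"
    by (rule stabilizer_projector_commute[OF restricted_group_isotropic cN, symmetric]) (use comm_N in blast)
  finally show "\<exists>N\<in>hermitian_paulis (card A). \<exists>h\<in>G. embed_operator L A N = h * P \<and>
      (\<forall>k\<in>restricted_group. N * k = k * N) \<and> reduced_state L A (P * ?T) = N * ?TA"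
    using N h comm_N by metis
qed

lemma coset_mult:
  assumes "h \<in> G" "k \<in> G" "P \<in> hermitian_paulis L" "Q \<in> hermitian_paulis L" "\<forall>h\<in>G. P * h = h * P"
  shows "(h * P) * (k * Q) = (h * k) * (P * Q)"
proof -
  have hk: "h \<in> hermitian_paulis L" "k \<in> hermitian_paulis L" using assms isotropicD(1)[OF G_iso] by auto
  have "(h * P) * (k * Q) = h * ((P * k) * Q)" using hk assms(3,4) by (simp add: mat_assoc del: assoc_mult_mat)
  also have "P * k = k * P" using assms by blast
  finally show ?thesis using hk assms(3,4) by (simp add: mat_assoc del: assoc_mult_mat)
qed

lemma YZ_neq: "Z * Y \<noteq> Y * Z" "Y * Z \<noteq> Z * Y"
  using hermitian_pauli_anticommute_neq[OF Y Z YZ] by auto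

lemma logical_notin: "Z \<notin> G" "- Z \<notin> G" "Y \<notin> G" "- Y \<notin> G"
  using witness_notin[OF G_iso Z Y Z_comm Y_comm YZ_neq(1)] .

lemma restricted_logical_notin:
  assumes "P \<in> hermitian_paulis L" "P \<notin> G" "- P \<notin> G" "h \<in> G" "embed_operator L A N = h * P"
    "N \<in> hermitian_paulis (card A)"
  shows "N \<notin> restricted_group" "- N \<notin> restricted_group"
proof -
  have hp: "h \<in> hermitian_paulis L" by (rule isotropicD(1)[OF G_iso assms(4)])
  have hhP: "h * (h * P) = P" using hp assms(1) by (simp add: hermitian_pauli_cancel[of _ L])
  show "N \<notin> restricted_group"
  proof
    assume "N \<in> restricted_group"
    then have "h * (h * P) \<in> G" using isotropicD(4)[OF G_iso assms(4)] assms(5) by (simp add: restricted_group_def)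
    then show False using hhP assms(2) by simp
  qed
  show "- N \<notin> restricted_group"
  proof
    assume "- N \<in> restricted_group"
    then have "- (h * P) \<in> G" using assms(5,6) by (simp add: restricted_group_def embed_operator_uminus[OF A])
    then have "h * (- (h * P)) \<in> G" using isotropicD(4)[OF G_iso assms(4)] by blast
    then show False using hhP hp assms(1,3) by simp
  qed
qed

theorem robustness_reduced_iff:
  "robustness (card A) (reduced_state L A (magic_operator L G Z Y)) > 1 \<longleftrightarrow>
     reducible_to L G Z A \<and> reducible_to L G Y A"
proof -
  let ?T = "stabilizer_projector L G" and ?n = "card A" and ?H = restricted_group
  let ?TA = "stabilizer_projector ?n ?H" and ?c = "complex_of_real half_root"
  have cZ: "Z \<in> carrier_mat (2 ^ L) (2 ^ L)" and cY: "Y \<in> carrier_mat (2 ^ L) (2 ^ L)" using Z Y by auto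
  have cZT: "Z * ?T \<in> carrier_mat (2 ^ L) (2 ^ L)" and cYT: "Y * ?T \<in> carrier_mat (2 ^ L) (2 ^ L)" using cZ cY by auto
  have red: "reduced_state L A (magic_operator L G Z Y) =
      ?TA + ?c \<cdot>\<^sub>m (reduced_state L A (Z * ?T) - reduced_state L A (Y * ?T))"
    unfolding magic_operator_alt[OF cZ cY] using cZT cYT
    by (simp add: reduced_state_add[OF A] reduced_state_smult[OF A] reduced_state_minus[OF A] reduced_projector minus_carrier_mat)
  note iso = restricted_group_isotropic
  show ?thesis
  proof (cases "reducible_to L G Z A")
    case rZ: True
    obtain N h where N: "N \<in> hermitian_paulis ?n" "h \<in> G" "embed_operator L A N = h * Z"
      "\<forall>k\<in>?H. N * k = k * N" "reduced_state L A (Z * ?T) = N * ?TA"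
      using reduced_logical(2)[OF Z Z_comm rZ] by blast
    note Nnot = restricted_logical_notin[OF Z logical_notin(1,2) N(2,3,1)]
    show ?thesis
    proof (cases "reducible_to L G Y A")
      case rY: True
      obtain M k where M: "M \<in> hermitian_paulis ?n" "k \<in> G" "embed_operator L A M = k * Y"
        "\<forall>k\<in>?H. M * k = k * M" "reduced_state L A (Y * ?T) = M * ?TA"
        using reduced_logical(2)[OF Y Y_comm rY] by blast
      have "N * M \<noteq> M * N"
      proof
        assume "N * M = M * N"
        then have "(h * Z) * (k * Y) = (k * Y) * (h * Z)"
          using embed_operator_mult[OF A, of N M] embed_operator_mult[OF A, of M N] N(1,3) M(1,3) by simp
        then have "(h * k) * (Z * Y) = (k * h) * (Y * Z)" by (simp only: coset_mult[OF N(2) M(2) Z Y Z_comm] coset_mult[OF M(2) N(2) Y Z Y_comm])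
        then have eq: "(h * k) * ((h * k) * (Z * Y)) = (h * k) * ((h * k) * (Y * Z))"
          using isotropicD(5)[OF G_iso N(2) M(2)] by simp
        have "h * k \<in> hermitian_paulis L" using isotropicD(1,4)[OF G_iso] N(2) M(2) by blast
        then have "(h * k) * ((h * k) * (Z * Y)) = Z * Y" "(h * k) * ((h * k) * (Y * Z)) = Y * Z"
          using Z Y by (intro hermitian_pauli_cancel; simp)+
        then show False using eq YZ_neq by simp
      qed
      then have "robustness ?n (magic_operator ?n ?H N M) > 1"
        using N M by (intro robustness_magic_operator[OF iso]) auto
      moreover have "reduced_state L A (magic_operator L G Z Y) = magic_operator ?n ?H N M"
        unfolding red N(5) M(5) using N(1) M(1) by (intro magic_operator_alt[symmetric]) auto
      ultimately show ?thesis using rZ rY by simp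
    next
      case False
      have "reduced_state L A (magic_operator L G Z Y) = ?TA + ?c \<cdot>\<^sub>m (N * ?TA)"
        unfolding red N(5) reduced_logical(1)[OF Y Y_comm False] using N(1)
        by (intro eq_matI) (auto simp del: index_mult_mat(1))
      then show ?thesis using robustness_partial[OF iso N(1,4) Nnot, of half_root] half_root(1,2) False by simp
    qed
  next
    case nZ: False
    show ?thesis
    proof (cases "reducible_to L G Y A")
      case rY: True
      obtain M k where M: "M \<in> hermitian_paulis ?n" "k \<in> G" "embed_operator L A M = k * Y"
        "\<forall>k\<in>?H. M * k = k * M" "reduced_state L A (Y * ?T) = M * ?TA"
        using reduced_logical(2)[OF Y Y_comm rY] by blast
      note Mnot = restricted_logical_notin[OF Y logical_notin(3,4) M(2,3,1)]
      have "\<forall>k\<in>?H. - M * k = k * - M"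
      proof
        fix k assume k: "k \<in> ?H"
        have "dim_row k = 2 ^ ?n" "dim_col k = 2 ^ ?n" using isotropicD(1)[OF iso k] by simp_all
        then show "- M * k = k * - M" using M(1,4) k by simp
      qed
      then have "robustness ?n (?TA + ?c \<cdot>\<^sub>m (- M * ?TA)) \<le> 1"
        using M(1) Mnot half_root(1,2) by (intro robustness_partial[OF iso]) auto
      moreover have "reduced_state L A (magic_operator L G Z Y) = ?TA + ?c \<cdot>\<^sub>m (- M * ?TA)"
        unfolding red M(5) reduced_logical(1)[OF Z Z_comm nZ] using M(1)
        by (intro eq_matI) (auto simp del: index_mult_mat(1))
      ultimately show ?thesis using nZ by simp
    next
      case False
      have "reduced_state L A (magic_operator L G Z Y) = ?TA"
        unfolding red reduced_logical(1)[OF Z Z_comm nZ] reduced_logical(1)[OF Y Y_comm False]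
        by (intro eq_matI) auto
      then show ?thesis using robustness_le[OF stabilizer_projector_decomposable[OF iso]] nZ by simp
    qed
  qed
qed

lemma reducible_X:
  assumes "reducible_to L G Z A" "reducible_to L G Y A"
  shows "reducible_to L G X A"
proof -
  obtain h N where h: "h \<in> G" and N: "N \<in> hermitian_paulis (card A)" "h * Z = embed_operator L A N"
    using assms(1) unfolding reducible_to_def supported_on_iff[OF A] by blast
  obtain k M where k: "k \<in> G" and M: "M \<in> hermitian_paulis (card A)" "k * Y = embed_operator L A M"
    using assms(2) unfolding reducible_to_def supported_on_iff[OF A] by blast
  have cMN: "M * N \<in> carrier_mat (2 ^ card A) (2 ^ card A)"
    by (rule mult_carrier_mat[OF hermitian_pauli_carrier[OF M(1)] hermitian_pauli_carrier[OF N(1)]])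
  have kh: "k * h \<in> G" "k * h \<in> hermitian_paulis L" using isotropicD(1,4)[OF G_iso] h k by blast+
  have "Y * Z = \<i> \<cdot>\<^sub>m (X * Z * Z)" unfolding Y_eq using X Z by (simp add: smult_mult_mat)
  also have "X * Z * Z = X" using X Z by (simp add: mat_assoc hermitian_pauli_square[of _ L] del: assoc_mult_mat)
  finally have "X = (- \<i>) \<cdot>\<^sub>m (Y * Z)" by simp
  then have "(k * h) * X = (- \<i>) \<cdot>\<^sub>m ((k * h) * (Y * Z))" using isotropicD(1)[OF G_iso h] isotropicD(1)[OF G_iso k] Y Z
    by (simp add: mult_smult_mat del: assoc_mult_mat)
  also have "(k * h) * (Y * Z) = embed_operator L A M * embed_operator L A N"
    using coset_mult[OF k h Y Z Y_comm] M(2) N(2) by simp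
  also have "(- \<i>) \<cdot>\<^sub>m \<dots> = embed_operator L A ((- \<i>) \<cdot>\<^sub>m (M * N))"
    using M(1) N(1) embed_operator_smult[OF A cMN] embed_operator_mult[OF A, of M N] by auto
  finally have e: "(k * h) * X = embed_operator L A ((- \<i>) \<cdot>\<^sub>m (M * N))" .
  have "(k * h) * X \<in> hermitian_paulis L"
    using X_comm kh by (intro hermitian_pauli_mult_closed kh X) auto
  then have "supported_on L A ((k * h) * X)"
    unfolding e using cMN by (intro hermitian_pauli_embedD[OF A]) auto
  then show ?thesis unfolding reducible_to_def using kh(1) by blast
qed

end

section \<open>Controlled Pauli gates\<close>

lemma smult_add_mat:
  "dim_row A = dim_row B \<Longrightarrow> dim_col A = dim_col B \<Longrightarrow> (k :: complex) \<cdot>\<^sub>m (A + B) = k \<cdot>\<^sub>m A + k \<cdot>\<^sub>m B"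
  by (intro eq_matI) (auto simp: distrib_left)

definition klein_sum :: "complex mat \<Rightarrow> complex mat \<Rightarrow> complex \<Rightarrow> complex \<Rightarrow> complex \<Rightarrow> complex \<Rightarrow> complex mat" where
  "klein_sum P Q a b c d = (a \<cdot>\<^sub>m 1\<^sub>m (dim_row P) + b \<cdot>\<^sub>m P) + (c \<cdot>\<^sub>m Q + d \<cdot>\<^sub>m (P * Q))"

lemma klein_sum_cong:
  "a = a' \<Longrightarrow> b = b' \<Longrightarrow> c = c' \<Longrightarrow> d = d' \<Longrightarrow> klein_sum P Q a b c d = klein_sum P Q a' b' c' d'"
  by simp

text \<open>The controlled gate for commuting \<open>P\<close>, \<open>Q\<close>: it acts as \<open>Q\<close> on the \<open>-1\<close>-eigenspace of \<open>P\<close>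
  and as the identity on the \<open>+1\<close>-eigenspace.\<close>

definition controlled_pauli :: "complex mat \<Rightarrow> complex mat \<Rightarrow> complex mat" where
  "controlled_pauli P Q = klein_sum P Q (1 / 2) (1 / 2) (1 / 2) (- 1 / 2)"

context
  fixes n P Q
  assumes P: "P \<in> hermitian_paulis n" and Q: "Q \<in> hermitian_paulis n" and PQ: "P * Q = Q * P"
begin

lemma klein_sum_dim[simp]:
  "dim_row (klein_sum P Q a b c d) = 2 ^ n" "dim_col (klein_sum P Q a b c d) = 2 ^ n"
  using P Q by (simp_all add: klein_sum_def)

lemma klein_sum_index:
  "i < 2 ^ n \<Longrightarrow> j < 2 ^ n \<Longrightarrow> klein_sum P Q a b c d $$ (i, j) =
    a * 1\<^sub>m (2 ^ n) $$ (i, j) + b * P $$ (i, j) + c * Q $$ (i, j) + d * (P * Q) $$ (i, j)"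
  using P Q by (simp add: klein_sum_def del: index_mult_mat(1) index_one_mat(1))

lemma klein_products:
  "P * P = 1\<^sub>m (2 ^ n)" "Q * Q = 1\<^sub>m (2 ^ n)" "Q * P = P * Q" "P * (P * Q) = Q" "Q * (P * Q) = P"
  "(P * Q) * P = Q" "(P * Q) * Q = P" "(P * Q) * (P * Q) = 1\<^sub>m (2 ^ n)"
proof -
  show 1: "P * P = 1\<^sub>m (2 ^ n)" "Q * Q = 1\<^sub>m (2 ^ n)" "Q * P = P * Q" "P * (P * Q) = Q"
    using P Q by (simp_all add: hermitian_pauli_square hermitian_pauli_cancel PQ[symmetric])
  show 2: "Q * (P * Q) = P" unfolding PQ using P Q by (simp add: hermitian_pauli_cancel)
  show "(P * Q) * P = Q" using 1 P Q unfolding PQ by (simp add: mat_assoc del: assoc_mult_mat)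
  show "(P * Q) * Q = P" using 1 P Q by (simp add: mat_assoc del: assoc_mult_mat)
  have "(P * Q) * (P * Q) = P * (Q * (P * Q))" using P Q by (simp add: mat_assoc del: assoc_mult_mat)
  then show "(P * Q) * (P * Q) = 1\<^sub>m (2 ^ n)" using 1 2 by simp
qed

lemma klein_sum_mult:
  "klein_sum P Q a b c d * klein_sum P Q a' b' c' d' =
    klein_sum P Q (a * a' + b * b' + c * c' + d * d') (a * b' + b * a' + c * d' + d * c')
      (a * c' + c * a' + b * d' + d * b') (a * d' + d * a' + b * c' + c * b')"
proof -
  have d: "dim_row P = 2 ^ n" "dim_col P = 2 ^ n" "dim_row Q = 2 ^ n" "dim_col Q = 2 ^ n" using P Q by simp_all
  have e: "klein_sum P Q a b c d * klein_sum P Q a' b' c' d' =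
     ((a * a') \<cdot>\<^sub>m 1\<^sub>m (2 ^ n) + (b * a') \<cdot>\<^sub>m P + ((c * a') \<cdot>\<^sub>m Q + (d * a') \<cdot>\<^sub>m (P * Q)) +
       ((a * b') \<cdot>\<^sub>m P + (b * b') \<cdot>\<^sub>m 1\<^sub>m (2 ^ n) + ((c * b') \<cdot>\<^sub>m (P * Q) + (d * b') \<cdot>\<^sub>m Q))) +
     ((a * c') \<cdot>\<^sub>m Q + (b * c') \<cdot>\<^sub>m (P * Q) + ((c * c') \<cdot>\<^sub>m 1\<^sub>m (2 ^ n) + (d * c') \<cdot>\<^sub>m P) +
       ((a * d') \<cdot>\<^sub>m (P * Q) + (b * d') \<cdot>\<^sub>m Q + ((c * d') \<cdot>\<^sub>m P + (d * d') \<cdot>\<^sub>m 1\<^sub>m (2 ^ n))))"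
    unfolding klein_sum_def using d
    by (simp add: mat_distrib smult_mult_mat mult_smult_mat smult_add_mat klein_products mult.commute del: assoc_mult_mat)
  show ?thesis
    unfolding e
  proof (intro eq_matI)
    fix i j assume "i < dim_row (klein_sum P Q (a * a' + b * b' + c * c' + d * d') (a * b' + b * a' + c * d' + d * c')
      (a * c' + c * a' + b * d' + d * b') (a * d' + d * a' + b * c' + c * b'))"
      "j < dim_col (klein_sum P Q (a * a' + b * b' + c * c' + d * d') (a * b' + b * a' + c * d' + d * c')
      (a * c' + c * a' + b * d' + d * b') (a * d' + d * a' + b * c' + c * b'))"
    then have ij: "i < 2 ^ n" "j < 2 ^ n" by simp_all
    show "(((a * a') \<cdot>\<^sub>m 1\<^sub>m (2 ^ n) + (b * a') \<cdot>\<^sub>m P + ((c * a') \<cdot>\<^sub>m Q + (d * a') \<cdot>\<^sub>m (P * Q)) +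
       ((a * b') \<cdot>\<^sub>m P + (b * b') \<cdot>\<^sub>m 1\<^sub>m (2 ^ n) + ((c * b') \<cdot>\<^sub>m (P * Q) + (d * b') \<cdot>\<^sub>m Q))) +
     ((a * c') \<cdot>\<^sub>m Q + (b * c') \<cdot>\<^sub>m (P * Q) + ((c * c') \<cdot>\<^sub>m 1\<^sub>m (2 ^ n) + (d * c') \<cdot>\<^sub>m P) +
       ((a * d') \<cdot>\<^sub>m (P * Q) + (b * d') \<cdot>\<^sub>m Q + ((c * d') \<cdot>\<^sub>m P + (d * d') \<cdot>\<^sub>m 1\<^sub>m (2 ^ n))))) $$ (i, j) =
      klein_sum P Q (a * a' + b * b' + c * c' + d * d') (a * b' + b * a' + c * d' + d * c')
      (a * c' + c * a' + b * d' + d * b') (a * d' + d * a' + b * c' + c * b') $$ (i, j)"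
      using ij d by (simp add: klein_sum_index algebra_simps del: index_mult_mat(1) index_one_mat(1))
  qed (use d in simp_all)
qed

lemma klein_sum_eq:
  "klein_sum P Q 1 0 0 0 = 1\<^sub>m (2 ^ n)" "klein_sum P Q 0 1 0 0 = P" "klein_sum P Q 0 0 1 0 = Q"
  "klein_sum P Q 0 0 0 (- 1) = - (P * Q)"
  using P Q by (intro eq_matI; simp add: klein_sum_index del: index_mult_mat(1) index_one_mat(1))+

lemma klein_sum_conj:
  assumes R: "dim_row R = 2 ^ n" "dim_col R = 2 ^ n" and "R * P = s \<cdot>\<^sub>m (P * R)" "R * Q = t \<cdot>\<^sub>m (Q * R)"
  shows "R * klein_sum P Q a b c d = klein_sum P Q a (s * b) (t * c) (s * t * d) * R"
proof -
  have d: "dim_row P = 2 ^ n" "dim_col P = 2 ^ n" "dim_row Q = 2 ^ n" "dim_col Q = 2 ^ n" using P Q by simp_all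
  have "R * (P * Q) = R * P * Q" using d R by (simp add: mat_assoc del: assoc_mult_mat)
  also have "\<dots> = s \<cdot>\<^sub>m (P * (R * Q))" unfolding assms(3) using d R by (simp add: mat_assoc smult_mult_mat del: assoc_mult_mat)
  also have "\<dots> = (s * t) \<cdot>\<^sub>m (P * (Q * R))" unfolding assms(4) using d R by (simp add: mult_smult_mat del: assoc_mult_mat)
  finally have 3: "R * (P * Q) = (s * t) \<cdot>\<^sub>m (P * (Q * R))" .
  show ?thesis
    unfolding klein_sum_def using d R
    by (simp add: mat_distrib smult_mult_mat mult_smult_mat mat_assoc assms(3,4) 3 mult_ac del: assoc_mult_mat)
qed

lemma controlled_pauli_conj:
  assumes R: "dim_row R = 2 ^ n" "dim_col R = 2 ^ n"
  shows "R * P = P * R \<Longrightarrow> R * Q = Q * R \<Longrightarrow> controlled_pauli P Q * R * controlled_pauli P Q = R"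
    "R * P = - (P * R) \<Longrightarrow> R * Q = Q * R \<Longrightarrow> controlled_pauli P Q * R * controlled_pauli P Q = Q * R"
    "R * P = P * R \<Longrightarrow> R * Q = - (Q * R) \<Longrightarrow> controlled_pauli P Q * R * controlled_pauli P Q = P * R"
    "R * P = - (P * R) \<Longrightarrow> R * Q = - (Q * R) \<Longrightarrow> controlled_pauli P Q * R * controlled_pauli P Q = - (P * Q) * R"
proof -
  have *: "controlled_pauli P Q * R * controlled_pauli P Q =
      klein_sum P Q ((1 + s + t + s * t) / 4) ((1 + s - t - s * t) / 4) ((1 - s + t - s * t) / 4) ((s + t - 1 - s * t) / 4) * R"
    if st: "R * P = s \<cdot>\<^sub>m (P * R)" "R * Q = t \<cdot>\<^sub>m (Q * R)" for s t
  proof -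
    have "controlled_pauli P Q * R * controlled_pauli P Q = controlled_pauli P Q * (R * controlled_pauli P Q)"
      using R by (simp add: controlled_pauli_def mat_assoc del: assoc_mult_mat)
    also have "\<dots> = controlled_pauli P Q * klein_sum P Q (1 / 2) (s * (1 / 2)) (t * (1 / 2)) (s * t * (- 1 / 2)) * R"
      unfolding controlled_pauli_def klein_sum_conj[OF R st] using R by (simp add: mat_assoc del: assoc_mult_mat)
    also have "controlled_pauli P Q * klein_sum P Q (1 / 2) (s * (1 / 2)) (t * (1 / 2)) (s * t * (- 1 / 2)) =
      klein_sum P Q ((1 + s + t + s * t) / 4) ((1 + s - t - s * t) / 4) ((1 - s + t - s * t) / 4) ((s + t - 1 - s * t) / 4)"
      unfolding controlled_pauli_def klein_sum_mult by (rule klein_sum_cong) (simp_all add: field_simps)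
    finally show ?thesis .
  qed
  show "R * P = P * R \<Longrightarrow> R * Q = Q * R \<Longrightarrow> controlled_pauli P Q * R * controlled_pauli P Q = R"
    using *[of 1 1] R klein_sum_eq by simp
  show "R * P = - (P * R) \<Longrightarrow> R * Q = Q * R \<Longrightarrow> controlled_pauli P Q * R * controlled_pauli P Q = Q * R"
    using *[of "- 1" 1] R klein_sum_eq by (simp add: uminus_eq_smult_mat[symmetric])
  show "R * P = P * R \<Longrightarrow> R * Q = - (Q * R) \<Longrightarrow> controlled_pauli P Q * R * controlled_pauli P Q = P * R"
    using *[of 1 "- 1"] R klein_sum_eq by (simp add: uminus_eq_smult_mat[symmetric])
  show "R * P = - (P * R) \<Longrightarrow> R * Q = - (Q * R) \<Longrightarrow> controlled_pauli P Q * R * controlled_pauli P Q = - (P * Q) * R"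
    using *[of "- 1" "- 1"] R klein_sum_eq by (simp add: uminus_eq_smult_mat[symmetric])
qed

lemma controlled_pauli_dim[simp]:
  "dim_row (controlled_pauli P Q) = 2 ^ n" "dim_col (controlled_pauli P Q) = 2 ^ n"
  by (simp_all add: controlled_pauli_def)

lemma controlled_pauli_involution: "controlled_pauli P Q * controlled_pauli P Q = 1\<^sub>m (2 ^ n)"
  unfolding controlled_pauli_def klein_sum_mult by (simp add: klein_sum_eq)

lemma controlled_pauli_adjoint: "mat_adjoint (controlled_pauli P Q) = controlled_pauli P Q"
proof (intro eq_matI)
  fix i j assume "i < dim_row (controlled_pauli P Q)" "j < dim_col (controlled_pauli P Q)"
  then have ij: "i < 2 ^ n" "j < 2 ^ n" by simp_all
  have "P * Q \<in> hermitian_paulis n" by (rule hermitian_pauli_mult_closed[OF P Q PQ])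
  then show "mat_adjoint (controlled_pauli P Q) $$ (i, j) = controlled_pauli P Q $$ (i, j)"
    using ij hermitian_pauli_cnj_index[OF P] hermitian_pauli_cnj_index[OF Q] hermitian_pauli_cnj_index[of "P * Q" n]
    by (simp add: mat_adjoint_index controlled_pauli_def klein_sum_index del: index_mult_mat(1))
qed simp_all

lemma controlled_pauli_clifford: "clifford n (controlled_pauli P Q)"
  unfolding clifford_def controlled_pauli_adjoint
proof (intro conjI ballI)
  show "controlled_pauli P Q \<in> carrier_mat (2 ^ n) (2 ^ n)" by (intro carrier_matI) simp_all
  fix R assume R: "R \<in> hermitian_paulis n"
  then have d: "dim_row R = 2 ^ n" "dim_col R = 2 ^ n" by simp_all
  have "R * P = P * R \<or> R * P = - (P * R)" "R * Q = Q * R \<or> R * Q = - (Q * R)"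
    using hermitian_pauli_mult_cases[OF R P] hermitian_pauli_mult_cases[OF R Q] by blast+
  then consider "R * P = P * R" "R * Q = Q * R" | "R * P = - (P * R)" "R * Q = Q * R"
    | "R * P = P * R" "R * Q = - (Q * R)" | "R * P = - (P * R)" "R * Q = - (Q * R)" by blast
  then show "controlled_pauli P Q * R * controlled_pauli P Q \<in> hermitian_paulis n"
  proof cases
    case 1
    show ?thesis unfolding controlled_pauli_conj(1)[OF d 1] by (rule R)
  next
    case 2
    show ?thesis unfolding controlled_pauli_conj(2)[OF d 2] by (rule hermitian_pauli_mult_closed[OF Q R 2(2)[symmetric]])
  next
    case 3
    show ?thesis unfolding controlled_pauli_conj(3)[OF d 3] by (rule hermitian_pauli_mult_closed[OF P R 3(1)[symmetric]])
  next
    case 4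
    have PQh: "P * Q \<in> hermitian_paulis n" by (rule hermitian_pauli_mult_closed[OF P Q PQ])
    have "R * (P * Q) = (R * P) * Q" using P Q R by (simp add: mat_assoc del: assoc_mult_mat)
    also have "\<dots> = - (P * (R * Q))" unfolding 4(1) using P Q R by (simp add: mat_assoc del: assoc_mult_mat)
    also have "\<dots> = (P * Q) * R" unfolding 4(2) using P Q R by (simp add: mat_assoc del: assoc_mult_mat)
    finally have "(P * Q) * R \<in> hermitian_paulis n" by (intro hermitian_pauli_mult_closed[OF PQh R]) simp
    then show ?thesis using controlled_pauli_conj(4)[OF d 4] Q R by simp
  qed
qed (simp_all add: controlled_pauli_involution)

end

section \<open>The ancilla\<close>

lemma supported_on_mono:
  assumes "supported_on n S M" "S \<subseteq> S'" shows "supported_on n S' M"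
proof -
  obtain s P where "s \<in> {1, - 1}" "M = s \<cdot>\<^sub>m pauli_string n P" "\<forall>k<n. k \<notin> S \<longrightarrow> P k = PI"
    using assms(1) unfolding supported_on_def by blast
  then show ?thesis unfolding supported_on_def using assms(2) by (intro exI[of _ s] exI[of _ P]) auto
qed

lemma density_mult_vec:
  assumes U: "U \<in> carrier_mat N N" and v: "dim_vec v = N"
  shows "density (U *\<^sub>v v) = U * density v * mat_adjoint U"
proof (intro eq_matI)
  fix i j assume "i < dim_row (U * density v * mat_adjoint U)" "j < dim_col (U * density v * mat_adjoint U)"
  then have ij: "i < N" "j < N" using U by simp_all
  have Uv: "(U *\<^sub>v v) $ i = (\<Sum>l<N. U $$ (i, l) * v $ l)" if "i < N" for i
    using U v that by (simp add: mult_mat_vec_index del: index_mult_mat_vec)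
  have "(U * density v * mat_adjoint U) $$ (i, j) = (\<Sum>m<N. (U * density v) $$ (i, m) * cnj (U $$ (j, m)))"
    using U v ij by (auto simp: times_mat_index mat_adjoint_index simp del: index_mult_mat(1) assoc_mult_mat intro!: sum.cong)
  also have "\<dots> = (\<Sum>m<N. (\<Sum>l<N. U $$ (i, l) * v $ l) * (cnj (v $ m) * cnj (U $$ (j, m))))"
  proof (intro sum.cong refl)
    fix m assume "m \<in> {..<N}"
    then have "(U * density v) $$ (i, m) = (\<Sum>l<N. U $$ (i, l) * v $ l * cnj (v $ m))"
      using U v ij by (auto simp: times_mat_index mult.assoc simp del: index_mult_mat(1) intro!: sum.cong)
    then show "(U * density v) $$ (i, m) * cnj (U $$ (j, m)) =
      (\<Sum>l<N. U $$ (i, l) * v $ l) * (cnj (v $ m) * cnj (U $$ (j, m)))"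
      by (simp add: sum_distrib_right mult.assoc)
  qed
  also have "\<dots> = (U *\<^sub>v v) $ i * cnj ((U *\<^sub>v v) $ j)"
    unfolding Uv[OF ij(1)] Uv[OF ij(2)] by (simp add: sum_distrib_left mult.commute)
  finally show "density (U *\<^sub>v v) $$ (i, j) = (U * density v * mat_adjoint U) $$ (i, j)"
    using U ij by simp
qed (use U in simp_all)

definition one_qubit :: "pauli \<Rightarrow> complex mat" where
  "one_qubit p = pauli_string 1 (\<lambda>_. p)"

lemma one_qubit_dim[simp]: "dim_row (one_qubit p) = 2" "dim_col (one_qubit p) = 2"
  by (simp_all add: one_qubit_def)

lemma one_qubit_carrier[simp]: "one_qubit p \<in> carrier_mat 2 2"
  by (intro carrier_matI) simp_all

lemma one_qubit_hermitian_pauli: "one_qubit p \<in> hermitian_paulis 1"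
  unfolding one_qubit_def by (rule pauli_string_hermitian_pauli)

lemma one_qubit_mult: "one_qubit p * one_qubit q = pauli_phase p q \<cdot>\<^sub>m one_qubit (pauli_mult p q)"
  using pauli_string_mult[of 1 "\<lambda>_. p" "\<lambda>_. q"] by (simp add: one_qubit_def)

lemma one_qubit_index:
  "i < 2 \<Longrightarrow> j < 2 \<Longrightarrow> one_qubit p $$ (i, j) = pauli_entry p (i = 1) (j = 1)"
  using pauli_string_index[of i 1 j "\<lambda>_. p"] by (auto simp: one_qubit_def less_2_cases_iff bit_0)

lemma one_qubit_PI: "one_qubit PI = 1\<^sub>m 2"
  using pauli_string_PI[of 1] by (simp add: one_qubit_def)

lemma trivial_isotropic: "isotropic n {1\<^sub>m (2 ^ n)}"
  unfolding isotropic_def using one_neq_uminus_one_mat[of n] by auto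

text \<open>The \<open>+1\<close> eigenvector of \<open>(Z - Y) / \<surd>2\<close>.\<close>

definition magic_vec :: "complex vec" where
  "magic_vec = vec 2 (\<lambda>i. complex_of_real (1 / sqrt (4 - 2 * sqrt 2)) * (if i = 0 then 1 else - \<i> * complex_of_real (sqrt 2 - 1)))"

lemma magic_vec_norm_sq: "complex_of_real (1 / sqrt (4 - 2 * sqrt 2)) * complex_of_real (1 / sqrt (4 - 2 * sqrt 2)) =
  complex_of_real ((2 + sqrt 2) / 4)"
proof -
  have "sqrt 2 < 2" by (rule real_less_lsqrt) simp_all
  then have "4 - 2 * sqrt 2 > (0::real)" by simp
  then have "1 / sqrt (4 - 2 * sqrt 2) * (1 / sqrt (4 - 2 * sqrt 2)) = 1 / (4 - 2 * sqrt 2)" by simp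
  also have "\<dots> = (2 + sqrt 2) / 4"
    using \<open>4 - 2 * sqrt 2 > 0\<close> by (simp add: field_simps)
  finally show ?thesis by (metis of_real_mult)
qed

lemma density_magic_vec: "density magic_vec = magic_operator 1 {1\<^sub>m (2 ^ 1)} (one_qubit PZ) (one_qubit PY)"
proof (intro eq_matI)
  let ?b = "complex_of_real (1 / sqrt (4 - 2 * sqrt 2))"
  fix i j assume "i < dim_row (magic_operator 1 {1\<^sub>m (2 ^ 1)} (one_qubit PZ) (one_qubit PY))"
    "j < dim_col (magic_operator 1 {1\<^sub>m (2 ^ 1)} (one_qubit PZ) (one_qubit PY))"
  then have ij: "i < 2" "j < 2" by (simp_all add: magic_operator_def)
  have T: "stabilizer_projector 1 {1\<^sub>m (2 ^ 1)} = complex_of_real (1 / 2) \<cdot>\<^sub>m 1\<^sub>m 2"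
    by (intro eq_matI) (simp_all add: stabilizer_projector_def)
  have "magic_operator 1 {1\<^sub>m (2 ^ 1)} (one_qubit PZ) (one_qubit PY) =
     complex_of_real (1 / 2) \<cdot>\<^sub>m (1\<^sub>m 2 + complex_of_real half_root \<cdot>\<^sub>m (one_qubit PZ - one_qubit PY))"
    unfolding magic_operator_def T by (subst mult_smult_mat) simp_all
  then have R: "magic_operator 1 {1\<^sub>m (2 ^ 1)} (one_qubit PZ) (one_qubit PY) $$ (i, j) =
    (1\<^sub>m 2 $$ (i, j) + complex_of_real half_root * (pauli_entry PZ (i = 1) (j = 1) - pauli_entry PY (i = 1) (j = 1))) / 2"
    using ij by (simp add: one_qubit_index)
  have "density magic_vec $$ (i, j) = ?b * ?b *
      ((if i = 0 then 1 else - \<i> * complex_of_real (sqrt 2 - 1)) * (if j = 0 then 1 else \<i> * complex_of_real (sqrt 2 - 1)))"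
    using ij by (simp add: magic_vec_def)
  also have "\<dots> = complex_of_real ((2 + sqrt 2) / 4) *
      ((if i = 0 then 1 else - \<i> * complex_of_real (sqrt 2 - 1)) * (if j = 0 then 1 else \<i> * complex_of_real (sqrt 2 - 1)))"
    unfolding magic_vec_norm_sq ..
  also have "\<dots> = (1\<^sub>m 2 $$ (i, j) + complex_of_real half_root * (pauli_entry PZ (i = 1) (j = 1) - pauli_entry PY (i = 1) (j = 1))) / 2"
    using ij by (auto simp: less_2_cases_iff pauli_entry_def half_root_def complex_eq_iff field_simps)
  also note R[symmetric]
  finally show "density magic_vec $$ (i, j) = magic_operator 1 {1\<^sub>m (2 ^ 1)} (one_qubit PZ) (one_qubit PY) $$ (i, j)" .
qed (simp_all add: magic_operator_def magic_vec_def)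

lemma one_qubit_anticommute: "one_qubit PZ * one_qubit PY \<noteq> one_qubit PY * one_qubit PZ"
  by (rule hermitian_pauli_anticommute_neq[OF one_qubit_hermitian_pauli one_qubit_hermitian_pauli])
    (simp add: one_qubit_mult uminus_eq_smult_mat)

lemma robustness_magic_vec: "robustness 1 (density magic_vec) > 1"
  unfolding density_magic_vec
  by (rule robustness_magic_operator[OF trivial_isotropic one_qubit_hermitian_pauli one_qubit_hermitian_pauli _ _
    one_qubit_anticommute]) simp_all

lemma magic_vec_pure: "pure_state 1 magic_vec"
proof -
  have "magic_vec \<bullet>c magic_vec = mtrace (density magic_vec)" by (simp add: mtrace_density)
  also have "\<dots> = 1"
  proof -
    have [simp]: "{..<2::nat} = {0, 1}" by auto
    have "mtrace (density magic_vec) = complex_of_real (1 / sqrt (4 - 2 * sqrt 2)) * complex_of_real (1 / sqrt (4 - 2 * sqrt 2)) *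
      (1 + complex_of_real (sqrt 2 - 1) * complex_of_real (sqrt 2 - 1))"
      by (simp add: mtrace_def magic_vec_def) (simp add: algebra_simps add_divide_distrib diff_divide_distrib)
    then have "mtrace (density magic_vec) = complex_of_real ((2 + sqrt 2) / 4) *
      (1 + complex_of_real (sqrt 2 - 1) * complex_of_real (sqrt 2 - 1))" unfolding magic_vec_norm_sq .
    then show ?thesis by (simp add: complex_eq_iff field_simps)
  qed
  finally show ?thesis by (simp add: pure_state_def magic_vec_def)
qed

locale ancilla =
  fixes L n :: nat
  assumes n: "n = L + 1"
begin

lemma register_subset: "{..<L} \<subseteq> {..<n}" and ancilla_subset: "{L} \<subseteq> {..<n}"
  and complement_register: "{..<n} - {..<L} = {L}"
  using n by auto

lemma register_card: "card {..<L} = L" and ancilla_card: "card {L} = 1"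
  by simp_all

definition on_register :: "complex mat \<Rightarrow> complex mat" where
  "on_register M = embed_operator n {..<L} M"

definition on_ancilla :: "complex mat \<Rightarrow> complex mat" where
  "on_ancilla M = embed_operator n {L} M"

lemma on_register_dim[simp]: "dim_row (on_register M) = 2 ^ n" "dim_col (on_register M) = 2 ^ n"
  and on_ancilla_dim[simp]: "dim_row (on_ancilla M) = 2 ^ n" "dim_col (on_ancilla M) = 2 ^ n"
  by (simp_all add: on_register_def on_ancilla_def)

lemma on_register_mult:
  "M \<in> carrier_mat (2 ^ L) (2 ^ L) \<Longrightarrow> N \<in> carrier_mat (2 ^ L) (2 ^ L) \<Longrightarrow>
    on_register M * on_register N = on_register (M * N)"
  unfolding on_register_def by (rule embed_operator_mult[OF register_subset, unfolded register_card])

lemma on_register_smult: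
  "M \<in> carrier_mat (2 ^ L) (2 ^ L) \<Longrightarrow> on_register (c \<cdot>\<^sub>m M) = c \<cdot>\<^sub>m on_register M"
  unfolding on_register_def by (rule embed_operator_smult[OF register_subset, unfolded register_card])

lemma on_register_uminus:
  "M \<in> carrier_mat (2 ^ L) (2 ^ L) \<Longrightarrow> on_register (- M) = - on_register M"
  unfolding on_register_def by (rule embed_operator_uminus[OF register_subset, unfolded register_card])

lemma on_register_minus:
  "M \<in> carrier_mat (2 ^ L) (2 ^ L) \<Longrightarrow> N \<in> carrier_mat (2 ^ L) (2 ^ L) \<Longrightarrow>
    on_register (M - N) = on_register M - on_register N"
  unfolding on_register_def by (rule embed_operator_minus[OF register_subset, unfolded register_card])

lemma on_register_one: "on_register (1\<^sub>m (2 ^ L)) = 1\<^sub>m (2 ^ n)"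
  unfolding on_register_def by (rule embed_operator_one[OF register_subset, unfolded register_card])

lemma on_register_hermitian_pauli: "M \<in> hermitian_paulis L \<Longrightarrow> on_register M \<in> hermitian_paulis n"
  unfolding on_register_def by (rule embed_hermitian_pauli[OF register_subset, unfolded register_card])

lemma on_ancilla_mult:
  "M \<in> carrier_mat 2 2 \<Longrightarrow> N \<in> carrier_mat 2 2 \<Longrightarrow> on_ancilla M * on_ancilla N = on_ancilla (M * N)"
  unfolding on_ancilla_def by (rule embed_operator_mult[OF ancilla_subset, unfolded ancilla_card power_one_right])

lemma on_ancilla_smult: "M \<in> carrier_mat 2 2 \<Longrightarrow> on_ancilla (c \<cdot>\<^sub>m M) = c \<cdot>\<^sub>m on_ancilla M"
  unfolding on_ancilla_def by (rule embed_operator_smult[OF ancilla_subset, unfolded ancilla_card power_one_right])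

lemma on_ancilla_minus:
  "M \<in> carrier_mat 2 2 \<Longrightarrow> N \<in> carrier_mat 2 2 \<Longrightarrow> on_ancilla (M - N) = on_ancilla M - on_ancilla N"
  unfolding on_ancilla_def by (rule embed_operator_minus[OF ancilla_subset, unfolded ancilla_card power_one_right])

lemma on_ancilla_one: "on_ancilla (1\<^sub>m 2) = 1\<^sub>m (2 ^ n)"
  unfolding on_ancilla_def by (rule embed_operator_one[OF ancilla_subset, unfolded ancilla_card power_one_right])

lemma on_ancilla_hermitian_pauli: "M \<in> hermitian_paulis 1 \<Longrightarrow> on_ancilla M \<in> hermitian_paulis n"
  unfolding on_ancilla_def by (rule embed_hermitian_pauli[OF ancilla_subset, unfolded ancilla_card])

lemma on_ancilla_supported: "M \<in> hermitian_paulis 1 \<Longrightarrow> supported_on n {L} (on_ancilla M)"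
  unfolding on_ancilla_def supported_on_iff[OF ancilla_subset] ancilla_card by blast

lemma on_register_on_ancilla_commute: "on_register M * on_ancilla N = on_ancilla N * on_register M"
  unfolding on_register_def on_ancilla_def
  by (rule embed_operator_complement_commute[OF register_subset, unfolded complement_register])

lemma product_mult:
  assumes "M \<in> carrier_mat (2 ^ L) (2 ^ L)" "M' \<in> carrier_mat (2 ^ L) (2 ^ L)" "N \<in> carrier_mat 2 2" "N' \<in> carrier_mat 2 2"
  shows "(on_register M * on_ancilla N) * (on_register M' * on_ancilla N') = on_register (M * M') * on_ancilla (N * N')"
proof -
  have "(on_register M * on_ancilla N) * (on_register M' * on_ancilla N') =
      on_register M * ((on_ancilla N * on_register M') * on_ancilla N')"
    by (simp add: mat_assoc del: assoc_mult_mat)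
  also have "on_ancilla N * on_register M' = on_register M' * on_ancilla N"
    by (rule on_register_on_ancilla_commute[symmetric])
  also have "on_register M * ((on_register M' * on_ancilla N) * on_ancilla N') =
      (on_register M * on_register M') * (on_ancilla N * on_ancilla N')"
    by (simp add: mat_assoc del: assoc_mult_mat)
  finally show ?thesis using on_register_mult[OF assms(1,2)] on_ancilla_mult[OF assms(3,4)] by simp
qed

lemma pauli_string_register:
  assumes "P L = PI" shows "pauli_string n P = on_register (pauli_string L P)"
proof -
  have "\<forall>k<n. k \<notin> {..<L} \<longrightarrow> P k = PI" using assms n by (auto simp: less_Suc_eq)
  then have "pauli_string n P = embed_operator n {..<L} (pauli_string (card {..<L}) (\<lambda>k. P (sorted_list_of_set {..<L} ! k)))"
    by (rule pauli_string_embed[OF register_subset])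
  moreover have "pauli_string L (\<lambda>k. P (sorted_list_of_set {..<L} ! k)) = pauli_string L P"
    by (rule pauli_string_cong) (simp add: lessThan_atLeast0)
  ultimately show ?thesis by (simp add: on_register_def)
qed

lemma pauli_string_product: "pauli_string n P = on_register (pauli_string L P) * on_ancilla (one_qubit (P L))"
proof -
  have "pauli_string L (\<lambda>k. P (sorted_list_of_set {..<L} ! k)) = pauli_string L P"
    by (rule pauli_string_cong) (simp add: lessThan_atLeast0)
  moreover have "pauli_string 1 (\<lambda>k. P (sorted_list_of_set {L} ! k)) = one_qubit (P L)"
    unfolding one_qubit_def by (rule pauli_string_cong) simp
  ultimately show ?thesis
    using pauli_string_split[OF register_subset, of P]
    unfolding complement_register register_card ancilla_card on_register_def on_ancilla_def by simp
qed

lemma on_register_supported: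
  assumes "supported_on L S M" shows "supported_on n (insert L S) (on_register M)"
proof -
  obtain s P where M: "s \<in> {1, - 1}" "M = s \<cdot>\<^sub>m pauli_string L P" "\<forall>k<L. k \<notin> S \<longrightarrow> P k = PI"
    using assms unfolding supported_on_def by blast
  let ?P = "P(L := PI)"
  have "pauli_string L ?P = pauli_string L P" by (rule pauli_string_cong) simp
  then have "on_register M = s \<cdot>\<^sub>m pauli_string n ?P"
    using M(2) pauli_string_register[of ?P] by (simp add: on_register_smult)
  moreover have "\<forall>k<n. k \<notin> insert L S \<longrightarrow> ?P k = PI" using M(3) n by (auto simp: less_Suc_eq)
  ultimately show ?thesis unfolding supported_on_def using M(1) by blast
qed

lemma on_register_tensor_vec:
  assumes "M \<in> carrier_mat (2 ^ L) (2 ^ L)" "dim_vec u = 2 ^ L"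
  shows "on_register M *\<^sub>v tensor_vec n {..<L} u v = tensor_vec n {..<L} (M *\<^sub>v u) v"
  unfolding on_register_def by (rule embed_operator_tensor_vec[OF register_subset, unfolded register_card, OF assms])

lemma mtrace_product_density:
  assumes "M \<in> carrier_mat (2 ^ L) (2 ^ L)" "N \<in> carrier_mat 2 2" "dim_vec u = 2 ^ L" "dim_vec v = 2"
  shows "mtrace (on_register M * on_ancilla N * density (tensor_vec n {..<L} u v)) = mtrace (M * density u) * mtrace (N * density v)"
  unfolding on_register_def on_ancilla_def
  by (rule mtrace_tensor_density[OF register_subset, unfolded complement_register register_card ancilla_card power_one_right, OF assms])

lemma tensor_vec_norm:
  assumes "dim_vec u = 2 ^ L" "dim_vec v = 2"
  shows "tensor_vec n {..<L} u v \<bullet>c tensor_vec n {..<L} u v = (u \<bullet>c u) * (v \<bullet>c v)"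
proof -
  have "mtrace (density (tensor_vec n {..<L} u v)) = mtrace (density u) * mtrace (density v)"
    using mtrace_product_density[of "1\<^sub>m (2 ^ L)" "1\<^sub>m 2", OF _ _ assms] assms
    by (simp add: on_register_one on_ancilla_one)
  then show ?thesis by (simp add: mtrace_density)
qed

section \<open>Extracting the logical qubit\<close>

text \<open>For anticommuting \<open>X\<close>, \<open>Y\<close> with \<open>Z = - i X Y\<close>, this gate is \<open>(1 + X X\<^sub>C + Y Y\<^sub>C + Z Z\<^sub>C) / 2\<close>,
  which swaps the logical qubit with the ancilla \<open>C\<close>.\<close>

definition logical_swap :: "complex mat \<Rightarrow> complex mat \<Rightarrow> complex mat" where
  "logical_swap X Y = controlled_pauli (on_register X * on_ancilla (one_qubit PX)) (on_register Y * on_ancilla (one_qubit PY))"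

context
  fixes X Y :: "complex mat"
  assumes X: "X \<in> hermitian_paulis L" and Y: "Y \<in> hermitian_paulis L" and XY: "X * Y = - (Y * X)"
begin

lemma logical_carrier: "X \<in> carrier_mat (2 ^ L) (2 ^ L)" "Y \<in> carrier_mat (2 ^ L) (2 ^ L)"
  "X * Y \<in> carrier_mat (2 ^ L) (2 ^ L)" "Y * X \<in> carrier_mat (2 ^ L) (2 ^ L)"
  using X Y mult_carrier_mat[OF hermitian_pauli_carrier[OF X] hermitian_pauli_carrier[OF Y]]
    mult_carrier_mat[OF hermitian_pauli_carrier[OF Y] hermitian_pauli_carrier[OF X]] by auto

abbreviation (input) "SX \<equiv> on_register X * on_ancilla (one_qubit PX)"
abbreviation (input) "SY \<equiv> on_register Y * on_ancilla (one_qubit PY)"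

lemma swap_generators:
  "SX \<in> hermitian_paulis n" "SY \<in> hermitian_paulis n" "SX * SY = SY * SX"
  "SX * SY = (\<i> \<cdot>\<^sub>m on_register (X * Y)) * on_ancilla (one_qubit PZ)"
proof -
  show "SX \<in> hermitian_paulis n" "SY \<in> hermitian_paulis n"
    by (intro hermitian_pauli_mult_closed on_register_hermitian_pauli on_ancilla_hermitian_pauli X Y
      one_qubit_hermitian_pauli on_register_on_ancilla_commute)+
  have "SX * SY = on_register (X * Y) * on_ancilla (\<i> \<cdot>\<^sub>m one_qubit PZ)"
    unfolding product_mult[OF logical_carrier(1,2) one_qubit_carrier one_qubit_carrier] by (simp add: one_qubit_mult)
  then show 1: "SX * SY = (\<i> \<cdot>\<^sub>m on_register (X * Y)) * on_ancilla (one_qubit PZ)"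
    by (simp add: on_ancilla_smult mult_smult_mat smult_mult_mat)
  have "SY * SX = on_register (Y * X) * on_ancilla ((- \<i>) \<cdot>\<^sub>m one_qubit PZ)"
    unfolding product_mult[OF logical_carrier(2,1) one_qubit_carrier one_qubit_carrier] by (simp add: one_qubit_mult)
  also have "\<dots> = (- \<i>) \<cdot>\<^sub>m (on_register (Y * X) * on_ancilla (one_qubit PZ))"
    by (simp add: on_ancilla_smult mult_smult_mat)
  finally have 2: "SY * SX = (- \<i>) \<cdot>\<^sub>m (on_register (Y * X) * on_ancilla (one_qubit PZ))" .
  have "on_register (X * Y) = - on_register (Y * X)" unfolding XY by (rule on_register_uminus[OF logical_carrier(4)])
  then show "SX * SY = SY * SX" unfolding 1 2 
    by (simp add: smult_mult_mat uminus_eq_smult_mat)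
qed

lemma logical_swap_clifford: "clifford n (logical_swap X Y)"
  unfolding logical_swap_def by (rule controlled_pauli_clifford[OF swap_generators(1-3)])

lemma logical_swap_dim: "dim_row (logical_swap X Y) = 2 ^ n" "dim_col (logical_swap X Y) = 2 ^ n"
  unfolding logical_swap_def using controlled_pauli_dim[OF swap_generators(1-3)] by simp_all

lemma logical_swap_involution: "logical_swap X Y * logical_swap X Y = 1\<^sub>m (2 ^ n)"
  unfolding logical_swap_def by (rule controlled_pauli_involution[OF swap_generators(1-3)])

lemma ancilla_swap_commute:
  "on_ancilla N * (on_register M * on_ancilla N') = on_register M * (on_ancilla N * on_ancilla N')"
proof -
  have "on_ancilla N * (on_register M * on_ancilla N') = (on_ancilla N * on_register M) * on_ancilla N'"
    by (simp add: mat_assoc del: assoc_mult_mat)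
  then show ?thesis by (simp add: mat_assoc on_register_on_ancilla_commute[symmetric] del: assoc_mult_mat)
qed

lemma ancilla_pauli_sign:
  assumes "one_qubit p * one_qubit q = s \<cdot>\<^sub>m (one_qubit q * one_qubit p)"
  shows "on_ancilla (one_qubit p) * (on_register M * on_ancilla (one_qubit q)) =
    s \<cdot>\<^sub>m ((on_register M * on_ancilla (one_qubit q)) * on_ancilla (one_qubit p))"
proof -
  have "on_ancilla (one_qubit p) * on_ancilla (one_qubit q) = on_ancilla (s \<cdot>\<^sub>m (one_qubit q * one_qubit p))"
    by (simp add: on_ancilla_mult assms)
  also have "\<dots> = s \<cdot>\<^sub>m on_ancilla (one_qubit q * one_qubit p)"
    by (rule on_ancilla_smult) (rule mult_carrier_mat[OF one_qubit_carrier one_qubit_carrier])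
  also have "on_ancilla (one_qubit q * one_qubit p) = on_ancilla (one_qubit q) * on_ancilla (one_qubit p)"
    by (simp add: on_ancilla_mult)
  finally show ?thesis
    unfolding ancilla_swap_commute by (simp add: mult_smult_mat mat_assoc del: assoc_mult_mat)
qed

lemma logical_swap_Y:
  "logical_swap X Y * on_ancilla (one_qubit PY) * logical_swap X Y = on_register Y"
proof -
  have "logical_swap X Y * on_ancilla (one_qubit PY) * logical_swap X Y = SY * on_ancilla (one_qubit PY)"
    unfolding logical_swap_def
  proof (rule controlled_pauli_conj(2)[OF swap_generators(1-3)])
    show "on_ancilla (one_qubit PY) * SX = - (SX * on_ancilla (one_qubit PY))"
      unfolding uminus_eq_smult_mat by (rule ancilla_pauli_sign) (simp add: one_qubit_mult)
    show "on_ancilla (one_qubit PY) * SY = SY * on_ancilla (one_qubit PY)"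
      using ancilla_pauli_sign[of PY PY 1 Y] by simp
  qed simp_all
  also have "\<dots> = on_register Y * on_ancilla (1\<^sub>m 2)"
    by (simp add: mat_assoc on_ancilla_mult one_qubit_mult one_qubit_PI del: assoc_mult_mat)
  finally show ?thesis by (simp add: on_ancilla_one)
qed

lemma logical_swap_Z:
  "logical_swap X Y * on_ancilla (one_qubit PZ) * logical_swap X Y = on_register ((- \<i>) \<cdot>\<^sub>m (X * Y))"
proof -
  have "logical_swap X Y * on_ancilla (one_qubit PZ) * logical_swap X Y = - (SX * SY) * on_ancilla (one_qubit PZ)"
    unfolding logical_swap_def
  proof (rule controlled_pauli_conj(4)[OF swap_generators(1-3)])
    show "on_ancilla (one_qubit PZ) * SX = - (SX * on_ancilla (one_qubit PZ))"
      unfolding uminus_eq_smult_mat by (rule ancilla_pauli_sign) (simp add: one_qubit_mult)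
    show "on_ancilla (one_qubit PZ) * SY = - (SY * on_ancilla (one_qubit PZ))"
      unfolding uminus_eq_smult_mat by (rule ancilla_pauli_sign) (simp add: one_qubit_mult)
  qed simp_all
  also have "\<dots> = (- \<i>) \<cdot>\<^sub>m (on_register (X * Y) * on_ancilla (1\<^sub>m 2))"
    unfolding swap_generators(4) uminus_eq_smult_mat
    by (simp add: smult_mult_mat mat_assoc on_ancilla_mult one_qubit_mult one_qubit_PI del: assoc_mult_mat)
  finally show ?thesis using logical_carrier by (simp add: on_ancilla_one on_register_smult)
qed

lemma logical_swap_embed:
  assumes A: "A \<subseteq> {..<L}" and "supported_on L A X" "supported_on L A Y"
  shows "\<exists>V\<in>carrier_mat (2 ^ (card A + 1)) (2 ^ (card A + 1)). logical_swap X Y = embed_operator n (insert L A) V"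
proof -
  let ?S = "insert L A"
  have S: "?S \<subseteq> {..<n}" using A n by auto
  have card: "card ?S = card A + 1"
  proof -
    have "finite A" "L \<notin> A" using A finite_subset by auto
    then show ?thesis by simp
  qed
  note mult = embed_operator_mult[OF S, unfolded card] and smult = embed_operator_smult[OF S, unfolded card]
    and add = embed_operator_add[OF S, unfolded card] and one = embed_operator_one[OF S, unfolded card]
  have prod: "\<exists>W\<in>carrier_mat (2 ^ (card A + 1)) (2 ^ (card A + 1)). on_register M * on_ancilla (one_qubit p) = embed_operator n ?S W"
    if M: "supported_on L A M" for M p
  proof -
    have "supported_on n ?S (on_ancilla (one_qubit p))"
      by (rule supported_on_mono[OF on_ancilla_supported[OF one_qubit_hermitian_pauli]]) simp
    then obtain N' where N': "N' \<in> hermitian_paulis (card A + 1)" "on_ancilla (one_qubit p) = embed_operator n ?S N'"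
      unfolding supported_on_iff[OF S] card by blast
    obtain N where N: "N \<in> hermitian_paulis (card A + 1)" "on_register M = embed_operator n ?S N"
      using on_register_supported[OF M] unfolding supported_on_iff[OF S] card by blast
    show ?thesis
      unfolding N(2) N'(2)
      using mult[OF hermitian_pauli_carrier[OF N(1)] hermitian_pauli_carrier[OF N'(1)]]
        mult_carrier_mat[OF hermitian_pauli_carrier[OF N(1)] hermitian_pauli_carrier[OF N'(1)]] by blast
  qed
  obtain W where W: "W \<in> carrier_mat (2 ^ (card A + 1)) (2 ^ (card A + 1))" "SX = embed_operator n ?S W" using prod[OF assms(2)] by blast
  obtain W' where W': "W' \<in> carrier_mat (2 ^ (card A + 1)) (2 ^ (card A + 1))" "SY = embed_operator n ?S W'" using prod[OF assms(3)] by blast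
  have WW: "W * W' \<in> carrier_mat (2 ^ (card A + 1)) (2 ^ (card A + 1))" by (rule mult_carrier_mat[OF W(1) W'(1)])
  let ?V = "((1 / 2) \<cdot>\<^sub>m 1\<^sub>m (2 ^ (card A + 1)) + (1 / 2) \<cdot>\<^sub>m W) + ((1 / 2) \<cdot>\<^sub>m W' + (- 1 / 2) \<cdot>\<^sub>m (W * W'))"
  have "logical_swap X Y = embed_operator n ?S ?V"
    unfolding logical_swap_def controlled_pauli_def klein_sum_def
    unfolding W(2) W'(2) embed_operator_dim mult[OF W(1) W'(1)] one[symmetric]
    by (simp only: add smult add_carrier_mat smult_carrier_mat one_carrier_mat W(1) W'(1) WW)
  moreover have "?V \<in> carrier_mat (2 ^ (card A + 1)) (2 ^ (card A + 1))"
    by (intro add_carrier_mat smult_carrier_mat one_carrier_mat W(1) W'(1) WW)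
  ultimately show ?thesis by blast
qed

end

end

context ancilla
begin

lemma complement_ancilla: "{..<n} - {L} = {..<L}"
  using n by auto

lemma on_ancilla_mult_vec_index:
  assumes "K \<in> carrier_mat 2 2" "dim_vec v = 2 ^ n" "a < 2 ^ L" "c < 2"
  shows "(on_ancilla K *\<^sub>v v) $ glue_bits n {..<L} a c =
    K $$ (c, 0) * v $ glue_bits n {..<L} a 0 + K $$ (c, 1) * v $ glue_bits n {..<L} a 1"
proof -
  note glue = glue_bits[OF register_subset, unfolded complement_register register_card ancilla_card power_one_right]
  have two: "{..<2::nat} = {0, 1}" by auto
  have "(on_ancilla K *\<^sub>v v) $ glue_bits n {..<L} a c =
      (\<Sum>l<2 ^ n. on_ancilla K $$ (glue_bits n {..<L} a c, l) * v $ l)"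
    using assms glue(1)[of a c] by (simp add: mult_mat_vec_index del: index_mult_mat_vec)
  also have "\<dots> = (\<Sum>b<2 ^ L. \<Sum>d<2. if b = a then K $$ (c, d) * v $ glue_bits n {..<L} a d else 0)"
    unfolding sum_glue_bits[OF register_subset] complement_register register_card ancilla_card power_one_right
    using assms glue
    by (intro sum.cong refl) (auto simp: on_ancilla_def embed_operator_index complement_ancilla)
  also have "\<dots> = (\<Sum>b<2 ^ L. if b = a then (\<Sum>d<2. K $$ (c, d) * v $ glue_bits n {..<L} a d) else 0)"
    by (intro sum.cong refl) simp
  also have "\<dots> = (\<Sum>d<2. K $$ (c, d) * v $ glue_bits n {..<L} a d)"
    using assms(3) by simp
  finally show ?thesis by (simp add: two)
qed

lemma ancilla_eigenvector:
  assumes v: "dim_vec v = 2 ^ n" "v \<bullet>c v = 1"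
    and eig: "on_ancilla (one_qubit PZ - one_qubit PY) *\<^sub>v v = complex_of_real (sqrt 2) \<cdot>\<^sub>v v"
  shows "\<exists>\<phi>. pure_state L \<phi> \<and> v = tensor_vec n {..<L} \<phi> magic_vec"
proof -
  note glue = glue_bits[OF register_subset, unfolded complement_register register_card ancilla_card power_one_right]
  define b where "b = complex_of_real (1 / sqrt (4 - 2 * sqrt 2))"
  have "b * b = complex_of_real ((2 + sqrt 2) / 4)" unfolding b_def by (rule magic_vec_norm_sq)
  moreover have "(2 + sqrt 2) / 4 > (0 :: real)"
    by (intro divide_pos_pos add_pos_pos) simp_all
  ultimately have b: "b \<noteq> 0" by (metis mult_zero_left of_real_eq_0_iff order_less_irrefl)
  define \<phi> where "\<phi> = vec (2 ^ L) (\<lambda>a. v $ glue_bits n {..<L} a 0 / b)"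
  have K: "one_qubit PZ - one_qubit PY \<in> carrier_mat 2 2" by (rule minus_carrier_mat) simp
  have second: "v $ glue_bits n {..<L} a 1 = - \<i> * complex_of_real (sqrt 2 - 1) * v $ glue_bits n {..<L} a 0"
    if a: "a < 2 ^ L" for a
  proof -
    have "complex_of_real (sqrt 2) * v $ glue_bits n {..<L} a 0 =
        v $ glue_bits n {..<L} a 0 + \<i> * v $ glue_bits n {..<L} a 1"
      using on_ancilla_mult_vec_index[OF K v(1) a, of 0] glue(1)[OF a, of 0] v(1)
      unfolding eig by (simp add: one_qubit_index pauli_entry_def)
    then have "\<i> * (complex_of_real (sqrt 2) * v $ glue_bits n {..<L} a 0) =
        \<i> * v $ glue_bits n {..<L} a 0 - v $ glue_bits n {..<L} a 1" by (simp add: distrib_left)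
    then show ?thesis by (simp add: algebra_simps)
  qed
  have eq: "v = tensor_vec n {..<L} \<phi> magic_vec"
  proof (intro eq_vecI)
    fix i assume "i < dim_vec (tensor_vec n {..<L} \<phi> magic_vec)"
    then have i: "i < 2 ^ n" by simp
    let ?a = "restrict_bits {..<L} i" and ?c = "restrict_bits {L} i"
    have ac: "?a < 2 ^ L" "?c < 2" using restrict_bits_less[of "{..<L}" i] by (simp_all add: restrict_bits_singleton)
    have gi: "glue_bits n {..<L} ?a ?c = i"
      using glue_bits_restrict_bits[OF register_subset i] unfolding complement_register .
    have "tensor_vec n {..<L} \<phi> magic_vec $ i = \<phi> $ ?a * magic_vec $ ?c"
      using tensor_vec_index[OF i, of "{..<L}"] unfolding complement_register .
    also have "\<dots> = v $ glue_bits n {..<L} ?a 0 * (if ?c = 0 then 1 else - \<i> * complex_of_real (sqrt 2 - 1))"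
    proof -
      have "magic_vec $ ?c = b * (if ?c = 0 then 1 else - \<i> * complex_of_real (sqrt 2 - 1))"
        using ac by (simp only: magic_vec_def index_vec b_def)
      then show ?thesis using ac(1) b by (simp add: \<phi>_def)
    qed
    also have "\<dots> = v $ glue_bits n {..<L} ?a ?c"
    proof (cases "?c = 0")
      case False
      then have "?c = 1" using ac(2) by simp
      then show ?thesis using second[OF ac(1)] by simp
    qed simp
    finally show "v $ i = tensor_vec n {..<L} \<phi> magic_vec $ i" unfolding gi by simp
  qed (use v in simp)
  have dims: "dim_vec \<phi> = 2 ^ L" "dim_vec magic_vec = 2" by (simp_all add: \<phi>_def magic_vec_def)
  have "(\<phi> \<bullet>c \<phi>) * (magic_vec \<bullet>c magic_vec) = 1"
    using tensor_vec_norm[OF dims] v(2) unfolding eq[symmetric] by simp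
  then have "\<phi> \<bullet>c \<phi> = 1" using magic_vec_pure by (simp add: pure_state_def)
  then have "pure_state L \<phi>" unfolding pure_state_def by (intro conjI carrier_vecI dims)
  then show ?thesis using eq by blast
qed

lemma mtrace_conj_unitary:
  assumes U: "U \<in> carrier_mat N N" "mat_adjoint U * U = 1\<^sub>m N" and C: "C \<in> carrier_mat N N" and v: "dim_vec v = N"
  shows "mtrace (C * density (U *\<^sub>v v)) = mtrace (mat_adjoint U * C * U * density v)"
proof -
  have d: "dim_row U = N" "dim_col U = N" "dim_row C = N" "dim_col C = N" using U C by auto
  have "C * density (U *\<^sub>v v) = (C * U * density v) * mat_adjoint U"
    unfolding density_mult_vec[OF U(1) v] using d v by (simp add: mat_assoc del: assoc_mult_mat)
  also have "mtrace \<dots> = mtrace (mat_adjoint U * (C * U * density v))"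
    by (rule mtrace_comm[of _ N]; rule carrier_matI) (use d v in simp_all)
  finally show ?thesis using d v by (simp add: mat_assoc del: assoc_mult_mat)
qed

lemma unitary_norm:
  fixes U :: "complex mat"
  assumes U: "U \<in> carrier_mat N N" "mat_adjoint U * U = 1\<^sub>m N" and v: "dim_vec v = N"
  shows "(U *\<^sub>v v) \<bullet>c (U *\<^sub>v v) = v \<bullet>c v"
proof -
  have "mtrace (1\<^sub>m N * density (U *\<^sub>v v)) = mtrace (mat_adjoint U * 1\<^sub>m N * U * density v)"
    by (rule mtrace_conj_unitary[OF U _ v]) simp
  then show ?thesis using U v by (simp add: mtrace_density)
qed

end

context code
begin

lemma magic_state_fixed:
  assumes \<psi>: "pure_state L \<psi>" and \<rho>: "density \<psi> = magic_operator L G Z Y"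
  shows "h \<in> G \<Longrightarrow> h *\<^sub>v \<psi> = \<psi>" "(Z - Y) *\<^sub>v \<psi> = complex_of_real (sqrt 2) \<cdot>\<^sub>v \<psi>"
proof -
  let ?T = "stabilizer_projector L G" and ?c = "complex_of_real half_root"
  have d: "dim_vec \<psi> = 2 ^ L" "\<psi> \<in> carrier_vec (2 ^ L)" using \<psi> by (auto simp: pure_state_def)
  have cZ: "Z \<in> carrier_mat (2 ^ L) (2 ^ L)" and cY: "Y \<in> carrier_mat (2 ^ L) (2 ^ L)" using Z Y by auto
  have \<rho>\<psi>: "density \<psi> *\<^sub>v \<psi> = \<psi>" using \<psi> by (intro density_mult_self) (simp add: pure_state_def)
  have cD: "density \<psi> \<in> carrier_mat (2 ^ L) (2 ^ L)" using d by simp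
  have alt: "density \<psi> = ?T + ?c \<cdot>\<^sub>m (Z * ?T - Y * ?T)" unfolding \<rho> by (rule magic_operator_alt[OF cZ cY])
  show "h *\<^sub>v \<psi> = \<psi>" if h: "h \<in> G"
  proof -
    have hp: "h \<in> hermitian_paulis L" by (rule isotropicD(1)[OF G_iso h])
    have "h * (P * ?T) = P * ?T" if "P \<in> hermitian_paulis L" "\<forall>h\<in>G. P * h = h * P" for P
    proof -
      have "h * (P * ?T) = (h * P) * ?T" using hp that by (simp add: mat_assoc del: assoc_mult_mat)
      also have "h * P = P * h" using that h by simp
      also have "(P * h) * ?T = P * (h * ?T)" using hp that by (simp add: mat_assoc del: assoc_mult_mat)
      finally show ?thesis using stabilizer_projector_absorb(1)[OF G_iso h] by simp
    qed
    then have "h * density \<psi> = density \<psi>" unfolding alt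
      using hp Z Y Z_comm Y_comm stabilizer_projector_absorb(1)[OF G_iso h]
      by (simp add: mat_distrib mult_smult_mat del: assoc_mult_mat)
    then have "h *\<^sub>v (density \<psi> *\<^sub>v \<psi>) = density \<psi> *\<^sub>v \<psi>"
      using assoc_mult_mat_vec[OF hermitian_pauli_carrier[OF hp] cD d(2)] by simp
    then show ?thesis unfolding \<rho>\<psi> .
  qed
  note wl = witness_left[OF G_iso Z Y Z_comm Y_comm YZ_neq(1)]
  have "(Z - Y) * density \<psi> = complex_of_real (sqrt 2) \<cdot>\<^sub>m density \<psi>"
  proof -
    have e: "(Z - Y) * density \<psi> = (Z * ?T - Y * ?T) + ?c \<cdot>\<^sub>m ((?T - - (Z * (Y * ?T))) - (Z * (Y * ?T) - ?T))"
      unfolding alt using Z Y by (simp add: mat_distrib mult_smult_mat wl del: assoc_mult_mat)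
    show ?thesis
      unfolding e unfolding alt
    proof (intro eq_matI)
      fix i j assume "i < dim_row (complex_of_real (sqrt 2) \<cdot>\<^sub>m (?T + ?c \<cdot>\<^sub>m (Z * ?T - Y * ?T)))"
        "j < dim_col (complex_of_real (sqrt 2) \<cdot>\<^sub>m (?T + ?c \<cdot>\<^sub>m (Z * ?T - Y * ?T)))"
      then have ij: "i < 2 ^ L" "j < 2 ^ L" using Z Y by simp_all
      have s: "complex_of_real (sqrt 2) * (?c * x) = x" for x
        using half_root(5) by (simp add: mult.assoc[symmetric] flip: of_real_mult)
      have hh: "?c * ?c = complex_of_real (1 / 2)" unfolding of_real_mult[symmetric] half_root(4) ..
      have cc: "2 * (?c * ?c) = 1" unfolding hh by simp
      have s3: "2 * (?c * (?c * x)) = x" for x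
      proof -
        have "2 * (?c * (?c * x)) = (2 * (?c * ?c)) * x" by (simp only: mult.assoc)
        then show ?thesis unfolding cc by simp
      qed
      have s2: "?c * x + ?c * x = complex_of_real (sqrt 2) * x" for x
        using half_root(3) by (metis distrib_right mult_2 of_real_add)
      show "((Z * ?T - Y * ?T) + ?c \<cdot>\<^sub>m ((?T - - (Z * (Y * ?T))) - (Z * (Y * ?T) - ?T))) $$ (i, j) =
        (complex_of_real (sqrt 2) \<cdot>\<^sub>m (?T + ?c \<cdot>\<^sub>m (Z * ?T - Y * ?T))) $$ (i, j)"
        using ij Z Y by (simp add: distrib_left s s2[symmetric] s3 right_diff_distrib del: index_mult_mat(1) assoc_mult_mat)
    qed (use Z Y in simp_all)
  qed
  then have "(Z - Y) *\<^sub>v (density \<psi> *\<^sub>v \<psi>) = (complex_of_real (sqrt 2) \<cdot>\<^sub>m density \<psi>) *\<^sub>v \<psi>"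
    using assoc_mult_mat_vec[OF minus_carrier_mat[OF cY, of Z] cD d(2)] by simp
  also have "\<dots> = complex_of_real (sqrt 2) \<cdot>\<^sub>v (density \<psi> *\<^sub>v \<psi>)"
    using d by (intro eq_vecI) (simp_all add: mult_mat_vec_index sum_distrib_left mult.assoc del: index_mult_mat_vec)
  finally show "(Z - Y) *\<^sub>v \<psi> = complex_of_real (sqrt 2) \<cdot>\<^sub>v \<psi>" unfolding \<rho>\<psi> .
qed

theorem reducible_imp_extractable:
  assumes \<psi>: "pure_state L \<psi>" and \<rho>: "density \<psi> = magic_operator L G Z Y"
    and "reducible_to L G X A" "reducible_to L G Y A"
  shows "unitarily_extractable L A \<psi>"
proof -
  obtain n where n: "n = L + 1" by simp
  interpret ancilla L n by unfold_locales (rule n)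
  obtain h k where h: "h \<in> G" "supported_on L A (h * X)" and k: "k \<in> G" "supported_on L A (k * Y)"
    using assms(3,4) unfolding reducible_to_def by blast
  have hp: "h \<in> hermitian_paulis L" "k \<in> hermitian_paulis L" using isotropicD(1)[OF G_iso] h k by auto
  have hk: "h * k \<in> G" "k * h = h * k" using isotropicD(4,5)[OF G_iso] h k by auto
  have hkp: "h * k \<in> hermitian_paulis L" by (rule isotropicD(1)[OF G_iso hk(1)])
  let ?X = "h * X" and ?Y = "k * Y"
  have X': "?X \<in> hermitian_paulis L" and Y': "?Y \<in> hermitian_paulis L"
    using X_comm Y_comm h k by (auto intro!: hermitian_pauli_mult_closed hp X Y)
  have prod: "?X * ?Y = (h * k) * (X * Y)" "?Y * ?X = (h * k) * (Y * X)"
    using coset_mult[OF h(1) k(1) X Y X_comm] coset_mult[OF k(1) h(1) Y X Y_comm] hk(2) by simp_all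
  have XY': "?X * ?Y = - (?Y * ?X)"
    unfolding prod XY using hp Y X by (simp del: assoc_mult_mat)
  have "X * Y = \<i> \<cdot>\<^sub>m (X * (X * Z))" unfolding Y_eq using X Z by (simp add: mult_smult_mat del: assoc_mult_mat)
  then have "X * Y = \<i> \<cdot>\<^sub>m Z" using hermitian_pauli_cancel[OF X, of Z] Z by simp
  then have Zeq: "(- \<i>) \<cdot>\<^sub>m (?X * ?Y) = (h * k) * Z"
    unfolding prod using hp Z by (simp add: mult_smult_mat del: assoc_mult_mat)
  let ?U = "logical_swap ?X ?Y"
  have cU: "clifford n ?U" by (rule logical_swap_clifford[OF X' Y' XY'])
  have carU: "?U \<in> carrier_mat (2 ^ n) (2 ^ n)" and unitU: "mat_adjoint ?U * ?U = 1\<^sub>m (2 ^ n)"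
    using cU unfolding clifford_def by blast+
  obtain V where V: "V \<in> carrier_mat (2 ^ (card A + 1)) (2 ^ (card A + 1))" "?U = embed_operator n (insert L A) V"
    using logical_swap_embed[OF X' Y' XY' A h(2) k(2)] by blast
  let ?w = "tensor_vec n {..<L} \<psi> (unit_vec 2 0)"
  let ?v = "?U *\<^sub>v ?w"
  have d: "dim_vec \<psi> = 2 ^ L" "\<psi> \<in> carrier_vec (2 ^ L)" "\<psi> \<bullet>c \<psi> = 1" using \<psi> by (auto simp: pure_state_def)
  have "unit_vec 2 0 \<bullet>c (unit_vec 2 0 :: complex vec) = 1"
    by (simp add: cscalar_prod_sum numeral_2_eq_2)
  then have "?w \<bullet>c ?w = 1" using tensor_vec_norm[OF d(1), of "unit_vec 2 0"] d by simp
  then have norm: "?v \<bullet>c ?v = 1" using unitary_norm[OF carU unitU] by simp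
  have cw: "?w \<in> carrier_vec (2 ^ n)" by (rule tensor_vec_carrier(1))
  let ?Z = "(h * k) * Z"
  have cZ': "?Z \<in> carrier_mat (2 ^ L) (2 ^ L)" and cY': "?Y \<in> carrier_mat (2 ^ L) (2 ^ L)"
    using mult_carrier_mat[OF hermitian_pauli_carrier[OF hkp] hermitian_pauli_carrier[OF Z]] Y' by auto
  let ?K = "one_qubit PZ - one_qubit PY"
  have swapK: "on_ancilla ?K * ?U = ?U * on_register (?Z - ?Y)"
  proof -
    note dU = logical_swap_dim[OF X' Y' XY']
    have conj: "on_ancilla N * ?U = ?U * (?U * on_ancilla N * ?U)" for N
    proof -
      have "?U * (?U * on_ancilla N * ?U) = (?U * ?U) * (on_ancilla N * ?U)"
        using dU by (simp add: mat_assoc del: assoc_mult_mat)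
      then show ?thesis unfolding logical_swap_involution[OF X' Y' XY'] using dU by simp
    qed
    have "on_ancilla ?K * ?U = (on_ancilla (one_qubit PZ) - on_ancilla (one_qubit PY)) * ?U"
      by (subst on_ancilla_minus) simp_all
    also have "\<dots> = on_ancilla (one_qubit PZ) * ?U - on_ancilla (one_qubit PY) * ?U"
      by (rule mat_distrib) (simp_all add: dU)
    also have "\<dots> = ?U * on_register ?Z - ?U * on_register ?Y"
      unfolding conj[of "one_qubit PZ"] conj[of "one_qubit PY"] logical_swap_Y[OF X' Y' XY']
        logical_swap_Z[OF X' Y' XY'] Zeq ..
    also have "\<dots> = ?U * (on_register ?Z - on_register ?Y)"
      by (rule mat_distrib(2)[symmetric]) (simp_all add: dU)
    finally show ?thesis unfolding on_register_minus[OF cZ' cY'] .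
  qed
  have local: "(?Z - ?Y) *\<^sub>v \<psi> = complex_of_real (sqrt 2) \<cdot>\<^sub>v \<psi>"
  proof -
    have P: "(g * P) *\<^sub>v \<psi> = P *\<^sub>v \<psi>" if "g \<in> G" "P \<in> hermitian_paulis L" "\<forall>h\<in>G. P * h = h * P" for g P
    proof -
      have gp: "g \<in> carrier_mat (2 ^ L) (2 ^ L)" using isotropicD(1)[OF G_iso that(1)] by blast
      have cP: "P \<in> carrier_mat (2 ^ L) (2 ^ L)" using that(2) by blast
      have "(g * P) *\<^sub>v \<psi> = (P * g) *\<^sub>v \<psi>" using that by simp
      also have "\<dots> = P *\<^sub>v (g *\<^sub>v \<psi>)" by (rule assoc_mult_mat_vec[OF cP gp d(2)])
      finally show ?thesis using magic_state_fixed(1)[OF \<psi> \<rho> that(1)] by simp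
    qed
    have "(?Z - ?Y) *\<^sub>v \<psi> = ?Z *\<^sub>v \<psi> - ?Y *\<^sub>v \<psi>" by (rule minus_mult_distrib_mat_vec[OF cZ' cY' d(2)])
    also have "\<dots> = Z *\<^sub>v \<psi> - Y *\<^sub>v \<psi>" using P[OF hk(1) Z Z_comm] P[OF k(1) Y Y_comm] by simp
    also have "\<dots> = (Z - Y) *\<^sub>v \<psi>"
      by (rule minus_mult_distrib_mat_vec[OF hermitian_pauli_carrier[OF Z] hermitian_pauli_carrier[OF Y] d(2), symmetric])
    finally show ?thesis using magic_state_fixed(2)[OF \<psi> \<rho>] by simp
  qed
  have cF: "on_ancilla ?K \<in> carrier_mat (2 ^ n) (2 ^ n)"
    and cE: "on_register (?Z - ?Y) \<in> carrier_mat (2 ^ n) (2 ^ n)"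
    by (intro carrier_matI on_ancilla_dim on_register_dim)+
  have "on_ancilla ?K *\<^sub>v ?v = (on_ancilla ?K * ?U) *\<^sub>v ?w"
    by (rule assoc_mult_mat_vec[OF cF carU cw, symmetric])
  also have "\<dots> = ?U *\<^sub>v (on_register (?Z - ?Y) *\<^sub>v ?w)"
    unfolding swapK by (rule assoc_mult_mat_vec[OF carU cE cw])
  also have "on_register (?Z - ?Y) *\<^sub>v ?w = tensor_vec n {..<L} ((?Z - ?Y) *\<^sub>v \<psi>) (unit_vec 2 0)"
    by (rule on_register_tensor_vec[OF minus_carrier_mat[OF cY'] d(1)])
  also have "\<dots> = complex_of_real (sqrt 2) \<cdot>\<^sub>v ?w"
  proof (intro eq_vecI)
    fix i assume "i < dim_vec (complex_of_real (sqrt 2) \<cdot>\<^sub>v ?w)"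
    then have i: "i < 2 ^ n" by simp
    have "restrict_bits {..<L} i < 2 ^ L" using restrict_bits_less[of "{..<L}" i] by simp
    then show "tensor_vec n {..<L} ((?Z - ?Y) *\<^sub>v \<psi>) (unit_vec 2 0) $ i = (complex_of_real (sqrt 2) \<cdot>\<^sub>v ?w) $ i"
      unfolding local using i d(1) by (simp add: tensor_vec_index del: power_Suc)
  qed simp
  also have "?U *\<^sub>v (complex_of_real (sqrt 2) \<cdot>\<^sub>v ?w) = complex_of_real (sqrt 2) \<cdot>\<^sub>v ?v"
    by (rule mult_mat_vec[OF carU cw])
  finally have "on_ancilla ?K *\<^sub>v ?v = complex_of_real (sqrt 2) \<cdot>\<^sub>v ?v" .
  then obtain \<phi> where \<phi>: "pure_state L \<phi>" "?v = tensor_vec n {..<L} \<phi> magic_vec"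
    using ancilla_eigenvector[OF _ norm] carU by (metis carrier_matD(1) dim_mult_mat_vec)
  show ?thesis
    unfolding unitarily_extractable_def n[symmetric]
    using cU V \<phi> magic_vec_pure robustness_magic_vec
    by (intro exI[of _ ?U] exI[of _ V] exI[of _ \<phi>] exI[of _ magic_vec]) simp
qed

end

section \<open>One-qubit states\<close>

definition bloch :: "complex vec \<Rightarrow> pauli \<Rightarrow> complex" where
  "bloch \<chi> p = mtrace (one_qubit p * density \<chi>)"

lemma bloch_sum:
  assumes "dim_vec \<chi> = 2"
  shows "bloch \<chi> p = (\<Sum>i<2. \<Sum>l<2. pauli_entry p (i = 1) (l = 1) * (\<chi> $ l * cnj (\<chi> $ i)))"
proof -
  have "bloch \<chi> p = (\<Sum>i<2. \<Sum>l<2. one_qubit p $$ (i, l) * (\<chi> $ l * cnj (\<chi> $ i)))"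
    unfolding bloch_def by (rule mtrace_mult_density[OF one_qubit_carrier assms])
  also have "\<dots> = (\<Sum>i<2. \<Sum>l<2. pauli_entry p (i = 1) (l = 1) * (\<chi> $ l * cnj (\<chi> $ i)))"
    by (intro sum.cong refl) (simp add: one_qubit_index)
  finally show ?thesis .
qed

lemma lessThan_2_nat: "{..<2::nat} = {0, 1}"
  by auto

lemma bloch_values:
  assumes "dim_vec \<chi> = 2"
  shows "bloch \<chi> PI = \<chi> $ 0 * cnj (\<chi> $ 0) + \<chi> $ 1 * cnj (\<chi> $ 1)"
    "bloch \<chi> PX = \<chi> $ 1 * cnj (\<chi> $ 0) + \<chi> $ 0 * cnj (\<chi> $ 1)"
    "bloch \<chi> PY = \<i> * (\<chi> $ 0 * cnj (\<chi> $ 1) - \<chi> $ 1 * cnj (\<chi> $ 0))"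
    "bloch \<chi> PZ = \<chi> $ 0 * cnj (\<chi> $ 0) - \<chi> $ 1 * cnj (\<chi> $ 1)"
  unfolding bloch_sum[OF assms] lessThan_2_nat by (simp_all add: pauli_entry_def algebra_simps)

lemma bloch_norm:
  assumes "pure_state 1 \<chi>"
  shows "bloch \<chi> PI = 1" "(bloch \<chi> PX)\<^sup>2 + (bloch \<chi> PY)\<^sup>2 + (bloch \<chi> PZ)\<^sup>2 = 1"
proof -
  have d: "dim_vec \<chi> = 2" using assms by (auto simp: pure_state_def)
  have "\<chi> \<bullet>c \<chi> = bloch \<chi> PI"
    unfolding bloch_values(1)[OF d] using d by (simp add: cscalar_prod_sum lessThan_2_nat)
  then show 1: "bloch \<chi> PI = 1" using assms by (simp add: pure_state_def)
  have "(bloch \<chi> PX)\<^sup>2 + (bloch \<chi> PY)\<^sup>2 + (bloch \<chi> PZ)\<^sup>2 = (bloch \<chi> PI)\<^sup>2"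
    unfolding bloch_values[OF d] by (simp add: power_mult_distrib power2_eq_square algebra_simps)
  then show "(bloch \<chi> PX)\<^sup>2 + (bloch \<chi> PY)\<^sup>2 + (bloch \<chi> PZ)\<^sup>2 = 1" using 1 by simp
qed

lemma density_bloch:
  assumes "pure_state 1 \<chi>"
  shows "density \<chi> = (1 / 2) \<cdot>\<^sub>m ((1\<^sub>m 2 + bloch \<chi> PX \<cdot>\<^sub>m one_qubit PX) + (bloch \<chi> PY \<cdot>\<^sub>m one_qubit PY + bloch \<chi> PZ \<cdot>\<^sub>m one_qubit PZ))"
    (is "_ = ?R")
proof (intro eq_matI)
  have d: "dim_vec \<chi> = 2" using assms by (auto simp: pure_state_def)
  fix i j assume "i < dim_row ?R" "j < dim_col ?R"
  then have ij: "i < 2" "j < 2" by simp_all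
  have one: "1\<^sub>m 2 $$ (i, j) = (\<chi> $ 0 * cnj (\<chi> $ 0) + \<chi> $ 1 * cnj (\<chi> $ 1)) * of_bool (i = j)"
    using bloch_norm(1)[OF assms] bloch_values(1)[OF d] ij by simp
  have "?R $$ (i, j) = (1\<^sub>m 2 $$ (i, j) + bloch \<chi> PX * pauli_entry PX (i = 1) (j = 1) +
      (bloch \<chi> PY * pauli_entry PY (i = 1) (j = 1) + bloch \<chi> PZ * pauli_entry PZ (i = 1) (j = 1))) / 2"
    using ij by (simp add: one_qubit_index del: One_nat_def)
  also have "\<dots> = \<chi> $ i * cnj (\<chi> $ j)"
    unfolding one bloch_values(2-4)[OF d] using ij
    by (auto simp: less_2_cases_iff pauli_entry_def algebra_simps)
  finally show "density \<chi> $$ (i, j) = ?R $$ (i, j)" using ij d by simp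
qed (use assms in \<open>auto simp: pure_state_def\<close>)

lemma robustness_bloch_axis:
  assumes \<chi>: "pure_state 1 \<chi>" and p: "p \<in> {PX, PY, PZ}" "\<And>q. q \<in> {PX, PY, PZ} - {p} \<Longrightarrow> bloch \<chi> q = 0"
  shows "robustness 1 (density \<chi>) \<le> 1"
proof -
  have "(bloch \<chi> p)\<^sup>2 = 1" using bloch_norm(2)[OF \<chi>] p by auto
  then have sq: "bloch \<chi> p = 1 \<or> bloch \<chi> p = - 1" by (simp add: power2_eq_1_iff)
  define P where "P = bloch \<chi> p \<cdot>\<^sub>m one_qubit p"
  have "P = one_qubit p \<or> P = - one_qubit p" using sq by (auto simp: P_def uminus_eq_smult_mat)
  then have P: "P \<in> hermitian_paulis 1" using one_qubit_hermitian_pauli by auto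
  have ne: "one_qubit p \<noteq> 1\<^sub>m (2 ^ 1)" "one_qubit p \<noteq> - 1\<^sub>m (2 ^ 1)"
  proof -
    have "mtrace (one_qubit p) = 0" using p(1) mtrace_pauli_string[of 1 "\<lambda>_. p"] by (auto simp: one_qubit_def)
    moreover have "mtrace (1\<^sub>m (2 ^ 1)) = 2" "mtrace (- 1\<^sub>m (2 ^ 1)) = - 2"
      by (simp_all add: mtrace_uminus[of _ 2] mtrace_one)
    ultimately show "one_qubit p \<noteq> 1\<^sub>m (2 ^ 1)" "one_qubit p \<noteq> - 1\<^sub>m (2 ^ 1)" by auto
  qed
  have notin: "P \<notin> {1\<^sub>m (2 ^ 1)}" "- P \<notin> {1\<^sub>m (2 ^ 1)}"
    using \<open>P = one_qubit p \<or> P = - one_qubit p\<close> ne by (auto simp: uminus_mat_eq_iff)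
  have dP: "dim_row P = 2" "dim_col P = 2" by (simp_all add: P_def)
  have T: "stabilizer_projector 1 {1\<^sub>m (2 ^ 1)} = (1 / 2) \<cdot>\<^sub>m 1\<^sub>m 2"
    by (intro eq_matI) (simp_all add: stabilizer_projector_def)
  have rob: "robustness 1 (stabilizer_projector 1 {1\<^sub>m (2 ^ 1)} + complex_of_real 1 \<cdot>\<^sub>m (P * stabilizer_projector 1 {1\<^sub>m (2 ^ 1)})) \<le> 1"
    by (rule robustness_partial[OF trivial_isotropic P _ notin]) (use dP in simp_all)
  have "stabilizer_projector 1 {1\<^sub>m (2 ^ 1)} + complex_of_real 1 \<cdot>\<^sub>m (P * stabilizer_projector 1 {1\<^sub>m (2 ^ 1)}) = density \<chi>"
  proof -
    have "complex_of_real 1 \<cdot>\<^sub>m (P * ((1 / 2) \<cdot>\<^sub>m 1\<^sub>m 2)) = (1 / 2) \<cdot>\<^sub>m P"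
      using dP by (simp add: mult_smult_mat)
    then have "stabilizer_projector 1 {1\<^sub>m (2 ^ 1)} + complex_of_real 1 \<cdot>\<^sub>m (P * stabilizer_projector 1 {1\<^sub>m (2 ^ 1)}) =
        (1 / 2) \<cdot>\<^sub>m 1\<^sub>m 2 + (1 / 2) \<cdot>\<^sub>m P" unfolding T by simp
    also have "\<dots> = density \<chi>"
      unfolding density_bloch[OF \<chi>] P_def using p
      by (intro eq_matI) (auto simp: distrib_left simp del: index_one_mat(1))
    finally show ?thesis .
  qed
  then show ?thesis using rob by simp
qed

section \<open>Expectations of Pauli operators in the magic state\<close>

lemma isotropic_expectation_nonzero:
  assumes iso: "isotropic n G" and M: "M \<in> hermitian_paulis n" and P: "P \<in> hermitian_paulis n" "\<forall>h\<in>G. P * h = h * P"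
    and "mtrace (M * (P * stabilizer_projector n G)) \<noteq> 0"
  shows "\<exists>h\<in>G. M = h * P \<or> M = - (h * P)"
proof (rule ccontr)
  assume not: "\<not> (\<exists>h\<in>G. M = h * P \<or> M = - (h * P))"
  have cM: "M \<in> carrier_mat (2 ^ n) (2 ^ n)" and cP: "P \<in> carrier_mat (2 ^ n) (2 ^ n)" using M P by auto
  have ch: "h \<in> carrier_mat (2 ^ n) (2 ^ n)" if "h \<in> G" for h using isotropicD(1)[OF iso that] by blast
  have cPh: "P * h \<in> carrier_mat (2 ^ n) (2 ^ n)" if "h \<in> G" for h by (rule mult_carrier_mat[OF cP ch[OF that]])
  have "mtrace (M * (P * h)) = 0" if h: "h \<in> G" for h
  proof (rule mtrace_hermitian_pauli_mult[OF M])
    show "P * h \<in> hermitian_paulis n"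
      by (rule hermitian_pauli_mult_closed[OF P(1) isotropicD(1)[OF iso h]]) (use P h in blast)
    show "M \<noteq> P * h" "M \<noteq> - (P * h)" using not P(2) h by auto
  qed
  then have "mtrace (mat_sum (2 ^ n) (\<lambda>h. M * (P * h)) G) = 0"
    by (subst mtrace_mat_sum) (auto intro: mult_carrier_mat[OF cM cPh])
  also have "mat_sum (2 ^ n) (\<lambda>h. M * (P * h)) G = M * mat_sum (2 ^ n) (\<lambda>h. P * h) G"
    by (rule mat_sum_mult_left[OF cM cPh, symmetric])
  also have "mat_sum (2 ^ n) (\<lambda>h. P * h) G = P * mat_sum (2 ^ n) (\<lambda>h. h) G"
    by (rule mat_sum_mult_left[OF cP ch, symmetric])
  finally have z: "mtrace (M * (P * mat_sum (2 ^ n) (\<lambda>h. h) G)) = 0" .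
  have c: "M * (P * mat_sum (2 ^ n) (\<lambda>h. h) G) \<in> carrier_mat (2 ^ n) (2 ^ n)"
    by (intro mult_carrier_mat[OF cM] mult_carrier_mat[OF cP] mat_sum_carrier)
  have "M * (P * stabilizer_projector n G) = (1 / 2 ^ n) \<cdot>\<^sub>m (M * (P * mat_sum (2 ^ n) (\<lambda>h. h) G))"
    using M P(1) by (simp add: stabilizer_projector_def mult_smult_mat)
  then show False using assms(5) mtrace_smult[OF c, of "1 / 2 ^ n"] z by simp
qed

context code
begin

lemma one_comm: "\<forall>h\<in>G. 1\<^sub>m (2 ^ L) * h = h * 1\<^sub>m (2 ^ L)"
proof
  fix h assume "h \<in> G"
  then have "dim_row h = 2 ^ L" "dim_col h = 2 ^ L" using isotropicD(1)[OF G_iso] by auto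
  then show "1\<^sub>m (2 ^ L) * h = h * 1\<^sub>m (2 ^ L)" by simp
qed

lemma magic_expectation_nonzero:
  assumes M: "M \<in> hermitian_paulis L" and "mtrace (M * magic_operator L G Z Y) \<noteq> 0"
  shows "\<exists>P\<in>{1\<^sub>m (2 ^ L), Z, Y}. \<exists>h\<in>G. M = h * P \<or> M = - (h * P)"
proof (rule ccontr)
  assume not: "\<not> ?thesis"
  let ?T = "stabilizer_projector L G"
  have z: "mtrace (M * (P * ?T)) = 0" if "P \<in> {1\<^sub>m (2 ^ L), Z, Y}" for P
  proof (rule ccontr)
    assume nz: "mtrace (M * (P * ?T)) \<noteq> 0"
    have "P \<in> hermitian_paulis L" "\<forall>h\<in>G. P * h = h * P" using that Y Z Y_comm Z_comm one_comm by auto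
    from isotropic_expectation_nonzero[OF G_iso M this nz] show False using not that by blast
  qed
  have cM: "M \<in> carrier_mat (2 ^ L) (2 ^ L)" and cZ: "Z \<in> carrier_mat (2 ^ L) (2 ^ L)" and cY: "Y \<in> carrier_mat (2 ^ L) (2 ^ L)"
    using M Z Y by auto
  have c: "M * (P * ?T) \<in> carrier_mat (2 ^ L) (2 ^ L)" if "P \<in> carrier_mat (2 ^ L) (2 ^ L)" for P
    by (intro mult_carrier_mat[OF cM] mult_carrier_mat[OF that] stabilizer_projector_carrier)
  have cT: "M * ?T \<in> carrier_mat (2 ^ L) (2 ^ L)" by (intro mult_carrier_mat[OF cM] stabilizer_projector_carrier)
  have "M * magic_operator L G Z Y = M * ?T + complex_of_real half_root \<cdot>\<^sub>m (M * (Z * ?T) - M * (Y * ?T))"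
    unfolding magic_operator_alt[OF cZ cY] using M Z Y by (simp add: mat_distrib mult_smult_mat del: assoc_mult_mat)
  then have "mtrace (M * magic_operator L G Z Y) =
      mtrace (M * ?T) + complex_of_real half_root * (mtrace (M * (Z * ?T)) - mtrace (M * (Y * ?T)))"
    using mtrace_add[OF cT smult_carrier_mat[OF minus_carrier_mat[OF c[OF cY]]], of "complex_of_real half_root" "M * (Z * ?T)"]
      mtrace_smult[OF minus_carrier_mat[OF c[OF cY]], of "complex_of_real half_root" "M * (Z * ?T)"]
      mtrace_minus[OF c[OF cZ] c[OF cY]] by simp
  also have "\<dots> = 0" using z[of Z] z[of Y] z[of "1\<^sub>m (2 ^ L)"] by simp
  finally show False using assms(2) by simp
qed

lemma anticommuting_expectations:
  assumes M: "M \<in> hermitian_paulis L" "supported_on L A M" "mtrace (M * magic_operator L G Z Y) \<noteq> 0"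
    and N: "N \<in> hermitian_paulis L" "supported_on L A N" "mtrace (N * magic_operator L G Z Y) \<noteq> 0"
    and MN: "M * N \<noteq> N * M"
  shows "reducible_to L G Z A \<and> reducible_to L G Y A"
proof -
  obtain P h where P: "P \<in> {1\<^sub>m (2 ^ L), Z, Y}" "h \<in> G" "M = h * P \<or> M = - (h * P)"
    using magic_expectation_nonzero[OF M(1,3)] by blast
  obtain Q k where Q: "Q \<in> {1\<^sub>m (2 ^ L), Z, Y}" "k \<in> G" "N = k * Q \<or> N = - (k * Q)"
    using magic_expectation_nonzero[OF N(1,3)] by blast
  have PQ: "P \<in> hermitian_paulis L" "\<forall>h\<in>G. P * h = h * P" "Q \<in> hermitian_paulis L" "\<forall>h\<in>G. Q * h = h * Q"
    using P(1) Q(1) one_comm Y Z Y_comm Z_comm by auto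
  have hk: "h * k = k * h" using isotropicD(5)[OF G_iso P(2) Q(2)] .
  have dims: "dim_row h = 2 ^ L" "dim_col h = 2 ^ L" "dim_row k = 2 ^ L" "dim_col k = 2 ^ L"
    "dim_row P = 2 ^ L" "dim_col P = 2 ^ L" "dim_row Q = 2 ^ L" "dim_col Q = 2 ^ L"
    using isotropicD(1)[OF G_iso P(2)] isotropicD(1)[OF G_iso Q(2)] PQ by simp_all
  have "P * Q \<noteq> Q * P"
  proof
    assume e: "P * Q = Q * P"
    have "(h * P) * (k * Q) = (k * Q) * (h * P)"
      unfolding coset_mult[OF P(2) Q(2) PQ(1,3,2)] coset_mult[OF Q(2) P(2) PQ(3,1,4)] e hk ..
    then have "M * N = N * M" using P(3) Q(3) dims by (auto simp del: assoc_mult_mat)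
    then show False using MN by simp
  qed
  then have "P \<noteq> 1\<^sub>m (2 ^ L)" "Q \<noteq> 1\<^sub>m (2 ^ L)" "P \<noteq> Q" using dims by auto
  then have cases: "(P = Z \<and> Q = Y) \<or> (P = Y \<and> Q = Z)" using P(1) Q(1) by auto
  have red: "reducible_to L G R A" if S: "supported_on L A S" and g: "g \<in> G" "S = g * R \<or> S = - (g * R)" for S g R
  proof -
    have "supported_on L A (g * R)"
    proof (cases "S = g * R")
      case False
      then have "g * R = - S" using g(2) by simp
      moreover obtain N where N: "N \<in> hermitian_paulis (card A)" "S = embed_operator L A N"
        using S unfolding supported_on_iff[OF A] by blast
      ultimately have "g * R = embed_operator L A (- N)" by (simp add: embed_operator_uminus[OF A])
      then show ?thesis unfolding supported_on_iff[OF A] using N(1) by (intro bexI[of _ "- N"]) simp_all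
    qed (use S in simp)
    then show ?thesis unfolding reducible_to_def using g(1) by blast
  qed
  show ?thesis using cases red[OF M(2) P(2,3)] red[OF N(2) Q(2,3)] by blast
qed

text \<open>Heisenberg picture: a Clifford unitary on \<open>A\<close> and the ancilla pulls a Pauli operator on the ancilla back
  to \<open>\<plusminus> M \<otimes> q\<close> with \<open>M\<close> on \<open>A\<close>, and only \<open>q \<in> {1, Z}\<close> has nonzero expectation in \<open>|0\<rangle>\<close>.\<close>

lemma pull_back:
  fixes n :: nat
  assumes n: "n = L + 1" and U: "clifford n U" and V: "V \<in> carrier_mat (2 ^ (card A + 1)) (2 ^ (card A + 1))"
    "U = embed_operator n (insert L A) V"
    and \<psi>: "dim_vec \<psi> = 2 ^ L" and \<phi>: "pure_state L \<phi>" and \<chi>: "pure_state 1 \<chi>"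
    and ext: "U *\<^sub>v tensor_vec n {..<L} \<psi> (unit_vec 2 0) = tensor_vec n {..<L} \<phi> \<chi>"
    and nz: "bloch \<chi> p \<noteq> 0"
  shows "\<exists>s M q. s \<in> {1, - 1} \<and> q \<in> {PI, PZ} \<and> M \<in> hermitian_paulis L \<and> supported_on L A M \<and>
    mtrace (M * density \<psi>) \<noteq> 0 \<and>
    mat_adjoint U * ancilla.on_ancilla L n (one_qubit p) * U =
      s \<cdot>\<^sub>m (ancilla.on_register L n M * ancilla.on_ancilla L n (one_qubit q))"
proof -
  interpret ancilla L n by unfold_locales (rule n)
  let ?S = "insert L A" and ?C = "on_ancilla (one_qubit p)" and ?w = "tensor_vec n {..<L} \<psi> (unit_vec 2 0)"
  have S: "?S \<subseteq> {..<n}" using A n by auto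
  have card: "card ?S = card A + 1"
  proof -
    have "finite A" "L \<notin> A" using A finite_subset by auto
    then show ?thesis by simp
  qed
  have cU: "U \<in> carrier_mat (2 ^ n) (2 ^ n)" and UU: "U * mat_adjoint U = 1\<^sub>m (2 ^ n)" "mat_adjoint U * U = 1\<^sub>m (2 ^ n)"
    and pauli: "\<And>P. P \<in> hermitian_paulis n \<Longrightarrow> U * P * mat_adjoint U \<in> hermitian_paulis n"
    using U unfolding clifford_def by blast+
  have dU: "dim_row U = 2 ^ n" "dim_col U = 2 ^ n" using cU by auto
  let ?f = "\<lambda>P. U * P * mat_adjoint U"
  have conj_back: "mat_adjoint U * (?f P) * U = P" if "dim_row P = 2 ^ n" "dim_col P = 2 ^ n" for P
  proof -
    have "mat_adjoint U * (?f P) * U = (mat_adjoint U * U) * P * (mat_adjoint U * U)"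
      using that dU by (simp add: mat_assoc del: assoc_mult_mat)
    then show ?thesis unfolding UU using that by simp
  qed
  have "inj_on ?f (hermitian_paulis n)"
  proof (rule inj_onI)
    fix P Q assume "P \<in> hermitian_paulis n" "Q \<in> hermitian_paulis n" "?f P = ?f Q"
    then show "P = Q" using conj_back[of P] conj_back[of Q] by (metis hermitian_pauli_dim)
  qed
  moreover have "?f ` hermitian_paulis n \<subseteq> hermitian_paulis n" using pauli by blast
  ultimately have surj: "?f ` hermitian_paulis n = hermitian_paulis n"
    using finite_hermitian_paulis by (intro endo_inj_surj)
  have C: "?C \<in> hermitian_paulis n" by (rule on_ancilla_hermitian_pauli[OF one_qubit_hermitian_pauli])
  then have "?C \<in> ?f ` hermitian_paulis n" unfolding surj .
  then obtain P where P: "?C = ?f P" "P \<in> hermitian_paulis n" by (rule imageE)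
  have P_eq: "mat_adjoint U * ?C * U = P" unfolding P(1) using conj_back[of P] P(2) by simp
  obtain N where N: "N \<in> hermitian_paulis (card A + 1)" "?C = embed_operator n ?S N"
    using supported_on_mono[OF on_ancilla_supported[OF one_qubit_hermitian_pauli], where S' = ?S]
    unfolding supported_on_iff[OF S] card by blast
  have cN: "N \<in> carrier_mat (2 ^ (card A + 1)) (2 ^ (card A + 1))" using N(1) by blast
  have cV': "mat_adjoint V \<in> carrier_mat (2 ^ (card A + 1)) (2 ^ (card A + 1))" using V(1) by (intro carrier_matI) auto
  note emult = embed_operator_mult[OF S, unfolded card]
  have "P = embed_operator n ?S (mat_adjoint V * N * V)"
    unfolding P_eq[symmetric] N(2) V(2) embed_operator_adjoint[OF S, unfolded card, OF V(1)]
      emult[OF cV' cN] emult[OF mult_carrier_mat[OF cV' cN] V(1)] ..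
  then have "supported_on n ?S P"
    using hermitian_pauli_embedD[OF S, unfolded card, OF _ mult_carrier_mat[OF mult_carrier_mat[OF cV' cN] V(1)]] P(2) by simp
  then obtain s Q where Q: "s \<in> {1, - 1}" "P = s \<cdot>\<^sub>m pauli_string n Q" "\<forall>k<n. k \<notin> ?S \<longrightarrow> Q k = PI"
    unfolding supported_on_def by blast
  let ?M = "pauli_string L Q" and ?q = "Q L"
  have Pprod: "P = s \<cdot>\<^sub>m (on_register ?M * on_ancilla (one_qubit ?q))" using Q(2) pauli_string_product[of Q] by simp
  have M: "?M \<in> hermitian_paulis L" by simp
  have "\<forall>k<L. k \<notin> A \<longrightarrow> Q k = PI" using Q(3) n by auto
  then have supp: "supported_on L A ?M" unfolding supported_on_def by (intro exI[of _ 1] exI[of _ Q]) simp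
  have d\<phi>: "dim_vec \<phi> = 2 ^ L" "\<phi> \<bullet>c \<phi> = 1" and d\<chi>: "dim_vec \<chi> = 2"
    using \<phi> \<chi> by (auto simp: pure_state_def)
  have dC: "dim_row ?C = 2 ^ n" "dim_col ?C = 2 ^ n" by simp_all
  have "bloch \<chi> p = mtrace (1\<^sub>m (2 ^ L) * density \<phi>) * mtrace (one_qubit p * density \<chi>)"
    using d\<phi> by (simp add: bloch_def mtrace_density)
  also have "\<dots> = mtrace (on_register (1\<^sub>m (2 ^ L)) * ?C * density (tensor_vec n {..<L} \<phi> \<chi>))"
    by (rule mtrace_product_density[symmetric]) (simp_all add: d\<phi> d\<chi>)
  also have "\<dots> = mtrace (?C * density (U *\<^sub>v ?w))" unfolding ext on_register_one by simp
  also have "\<dots> = mtrace (P * density ?w)"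
    unfolding P_eq[symmetric] by (rule mtrace_conj_unitary[OF cU UU(2)]) (use C in auto)
  also have "\<dots> = s * (mtrace (?M * density \<psi>) * mtrace (one_qubit ?q * density (unit_vec 2 0)))"
  proof -
    have "P * density ?w = s \<cdot>\<^sub>m (on_register ?M * on_ancilla (one_qubit ?q) * density ?w)"
      unfolding Pprod by (rule smult_mult_mat) simp
    also have "mtrace \<dots> = s * mtrace (on_register ?M * on_ancilla (one_qubit ?q) * density ?w)"
      by (rule mtrace_smult[of _ "2 ^ n"]) (intro carrier_matI; simp)
    also have "mtrace (on_register ?M * on_ancilla (one_qubit ?q) * density ?w) =
        mtrace (?M * density \<psi>) * mtrace (one_qubit ?q * density (unit_vec 2 0))"
      by (rule mtrace_product_density) (simp_all add: \<psi>)
    finally show ?thesis .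
  qed
  finally have e: "bloch \<chi> p = s * (mtrace (?M * density \<psi>) * bloch (unit_vec 2 0) ?q)" by (simp add: bloch_def)
  then have nz': "mtrace (?M * density \<psi>) \<noteq> 0" "bloch (unit_vec 2 0) ?q \<noteq> 0" using nz by auto
  have "bloch (unit_vec 2 0) PX = 0" "bloch (unit_vec 2 0) PY = 0" by (simp_all add: bloch_values)
  then have "?q \<in> {PI, PZ}" using nz'(2) by (cases ?q) auto
  then show ?thesis using Q(1) M supp nz'(1) P_eq Pprod by blast
qed

theorem extractable_imp_reducible:
  assumes \<psi>: "pure_state L \<psi>" and \<rho>: "density \<psi> = magic_operator L G Z Y" and "unitarily_extractable L A \<psi>"
  shows "reducible_to L G Z A \<and> reducible_to L G Y A"
proof (rule ccontr)
  assume not: "\<not> ?thesis"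
  obtain n where n: "n = L + 1" by simp
  interpret ancilla L n by unfold_locales (rule n)
  obtain U V \<phi> \<chi> where U: "clifford n U"
    and V: "V \<in> carrier_mat (2 ^ (card A + 1)) (2 ^ (card A + 1))" "U = embed_operator n (insert L A) V"
    and \<phi>: "pure_state L \<phi>" and \<chi>: "pure_state 1 \<chi>"
    and ext: "U *\<^sub>v tensor_vec n {..<L} \<psi> (unit_vec 2 0) = tensor_vec n {..<L} \<phi> \<chi>"
    and magic: "robustness 1 (density \<chi>) > 1"
    using assms(3) unfolding unitarily_extractable_def n[symmetric] by blast
  have d: "dim_vec \<psi> = 2 ^ L" using \<psi> by (auto simp: pure_state_def)
  note pb = pull_back[OF n U V d \<phi> \<chi> ext]
  have cU: "U \<in> carrier_mat (2 ^ n) (2 ^ n)" and UU: "U * mat_adjoint U = 1\<^sub>m (2 ^ n)"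
    using U unfolding clifford_def by blast+
  have dU: "dim_row U = 2 ^ n" "dim_col U = 2 ^ n" using cU by auto
  have one: "p = q" if p: "p \<in> {PX, PY, PZ}" "bloch \<chi> p \<noteq> 0" and q: "q \<in> {PX, PY, PZ}" "bloch \<chi> q \<noteq> 0" for p q
  proof (rule ccontr)
    assume "p \<noteq> q"
    let ?P = "on_ancilla (one_qubit p)" and ?Q = "on_ancilla (one_qubit q)"
    have anti: "one_qubit p * one_qubit q = - (one_qubit q * one_qubit p)"
      using p(1) q(1) \<open>p \<noteq> q\<close> by (auto simp: one_qubit_mult uminus_eq_smult_mat)
    obtain s M p' where M: "s \<in> {1, - 1}" "p' \<in> {PI, PZ}" "M \<in> hermitian_paulis L" "supported_on L A M"
      "mtrace (M * density \<psi>) \<noteq> 0" "mat_adjoint U * ?P * U = s \<cdot>\<^sub>m (on_register M * on_ancilla (one_qubit p'))"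
      using pb[OF p(2)] by blast
    obtain t N q' where N: "t \<in> {1, - 1}" "q' \<in> {PI, PZ}" "N \<in> hermitian_paulis L" "supported_on L A N"
      "mtrace (N * density \<psi>) \<noteq> 0" "mat_adjoint U * ?Q * U = t \<cdot>\<^sub>m (on_register N * on_ancilla (one_qubit q'))"
      using pb[OF q(2)] by blast
    have "M * N = N * M"
      using anticommuting_expectations[OF M(3,4) _ N(3,4)] M(5) N(5) not unfolding \<rho> by blast
    moreover have "one_qubit p' * one_qubit q' = one_qubit q' * one_qubit p'"
      using M(2) N(2) by (auto simp: one_qubit_mult)
    ultimately have comm: "(on_register M * on_ancilla (one_qubit p')) * (on_register N * on_ancilla (one_qubit q')) =
        (on_register N * on_ancilla (one_qubit q')) * (on_register M * on_ancilla (one_qubit p'))"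
      using product_mult[OF hermitian_pauli_carrier[OF M(3)] hermitian_pauli_carrier[OF N(3)] one_qubit_carrier one_qubit_carrier, of p' q']
        product_mult[OF hermitian_pauli_carrier[OF N(3)] hermitian_pauli_carrier[OF M(3)] one_qubit_carrier one_qubit_carrier, of q' p']
      by simp
    have "(mat_adjoint U * ?P * U) * (mat_adjoint U * ?Q * U) = (mat_adjoint U * ?Q * U) * (mat_adjoint U * ?P * U)"
      unfolding M(6) N(6) by (subst (1 2) smult_mult_smult_mat) (simp_all add: comm mult.commute del: assoc_mult_mat)
    moreover have conj: "(mat_adjoint U * B * U) * (mat_adjoint U * B' * U) = mat_adjoint U * (B * B') * U"
      if "dim_row B = 2 ^ n" "dim_col B = 2 ^ n" "dim_row B' = 2 ^ n" "dim_col B' = 2 ^ n" for B B'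
    proof -
      have "(mat_adjoint U * B * U) * (mat_adjoint U * B' * U) = mat_adjoint U * (B * ((U * mat_adjoint U) * (B' * U)))"
        using dU that by (simp add: mat_assoc del: assoc_mult_mat)
      then show ?thesis unfolding UU using dU that by (simp add: mat_assoc del: assoc_mult_mat)
    qed
    ultimately have "mat_adjoint U * (?P * ?Q) * U = mat_adjoint U * (?Q * ?P) * U"
      using conj[of ?P ?Q] conj[of ?Q ?P] by simp
    then have "U * (mat_adjoint U * (?P * ?Q) * U) * mat_adjoint U = U * (mat_adjoint U * (?Q * ?P) * U) * mat_adjoint U" by simp
    moreover have "U * (mat_adjoint U * B * U) * mat_adjoint U = B" if "dim_row B = 2 ^ n" "dim_col B = 2 ^ n" for B
    proof -
      have "U * (mat_adjoint U * B * U) * mat_adjoint U = (U * mat_adjoint U) * B * (U * mat_adjoint U)"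
        using dU that by (simp add: mat_assoc del: assoc_mult_mat)
      then show ?thesis unfolding UU using that by simp
    qed
    ultimately have "?P * ?Q = ?Q * ?P" by simp
    then have "on_ancilla (one_qubit p * one_qubit q) = on_ancilla (one_qubit q * one_qubit p)"
      by (simp add: on_ancilla_mult)
    then have "one_qubit p * one_qubit q = one_qubit q * one_qubit p"
      unfolding on_ancilla_def
      using embed_operator_inject[OF ancilla_subset, unfolded ancilla_card power_one_right,
        OF mult_carrier_mat[OF one_qubit_carrier one_qubit_carrier] mult_carrier_mat[OF one_qubit_carrier one_qubit_carrier]] by blast
    then show False using hermitian_pauli_anticommute_neq[OF one_qubit_hermitian_pauli one_qubit_hermitian_pauli anti] by simp
  qed
  have "\<exists>p\<in>{PX, PY, PZ}. bloch \<chi> p \<noteq> 0"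
  proof (rule ccontr)
    assume "\<not> (\<exists>p\<in>{PX, PY, PZ}. bloch \<chi> p \<noteq> 0)"
    then show False using bloch_norm(2)[OF \<chi>] by simp
  qed
  then obtain p where p: "p \<in> {PX, PY, PZ}" "bloch \<chi> p \<noteq> 0" by blast
  have "robustness 1 (density \<chi>) \<le> 1"
    by (rule robustness_bloch_axis[OF \<chi> p(1)]) (use one[OF p] in blast)
  then show False using magic by simp
qed

end

theorem mainTheorem3:
  fixes L :: nat
    and A :: "nat set"
    and \<psi> :: "complex vec"
    and g :: "nat \<Rightarrow> complex mat"
    and G :: "complex mat set"
    and Xbar Ybar Zbar :: "complex mat"
  assumes "L \<ge> 1"
    and "A \<subseteq> {..<L}"
    and "stabilizer_group L {2..L} g G"
    and "{Xbar, Ybar, Zbar} \<subseteq> logical_operators L G"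
    and "Xbar * Ybar = - (Ybar * Xbar)"
    and "Ybar * Zbar = - (Zbar * Ybar)"
    and "Xbar * Zbar = - (Zbar * Xbar)"
    and "Ybar = \<i> \<cdot>\<^sub>m (Xbar * Zbar)"
    and "pure_state L \<psi>"
    and "density \<psi> =
      complex_of_real (1 / 2 ^ L) \<cdot>\<^sub>m
        ((1\<^sub>m (2 ^ L) + complex_of_real (1 / sqrt 2) \<cdot>\<^sub>m (Zbar - Ybar)) *
          foldr (\<lambda>j M. (1\<^sub>m (2 ^ L) + g j) * M) [2..<L + 1] (1\<^sub>m (2 ^ L)))"
  shows "(unitarily_extractable L A \<psi> \<longleftrightarrow> robustness (card A) (reduced_state L A (density \<psi>)) > 1) \<and>
         (robustness (card A) (reduced_state L A (density \<psi>)) > 1 \<longleftrightarrow>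
            reducible_to L G Xbar A \<and> reducible_to L G Ybar A \<and> reducible_to L G Zbar A)"
proof -
  have log: "P \<in> hermitian_paulis L \<and> (\<forall>h\<in>G. P * h = h * P)" if "P \<in> {Xbar, Ybar, Zbar}" for P
    using assms(4) that unfolding logical_operators_def by blast
  interpret code L A G Xbar Ybar Zbar
    by unfold_locales (use assms(2,5-8) log stabilizer_group_isotropic[OF assms(3)] in blast)+
  have "set [2..<L + 1] = {2..L}" by auto
  then have "foldr (\<lambda>j M. (1\<^sub>m (2 ^ L) + g j) * M) [2..<L + 1] (1\<^sub>m (2 ^ L)) = mat_sum (2 ^ L) (\<lambda>h. h) G"
    using foldr_stabilizer_generators[OF assms(3), of "[2..<L + 1]"] stabilizer_groupD(1)[OF assms(3)] by simp
  then have \<rho>: "density \<psi> = magic_operator L G Zbar Ybar"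
    using assms(10) Z Y unfolding magic_operator_def stabilizer_projector_def half_root_def by (simp add: mult_smult_mat)
  have c_iff: "reducible_to L G Xbar A \<and> reducible_to L G Ybar A \<and> reducible_to L G Zbar A \<longleftrightarrow>
      reducible_to L G Zbar A \<and> reducible_to L G Ybar A"
    using reducible_X by blast
  have b_iff: "robustness (card A) (reduced_state L A (density \<psi>)) > 1 \<longleftrightarrow>
      reducible_to L G Zbar A \<and> reducible_to L G Ybar A"
    unfolding \<rho> by (rule robustness_reduced_iff)
  have a_iff: "unitarily_extractable L A \<psi> \<longleftrightarrow> reducible_to L G Zbar A \<and> reducible_to L G Ybar A"
    using extractable_imp_reducible[OF assms(9) \<rho>] reducible_imp_extractable[OF assms(9) \<rho>] reducible_X by blast
  show ?thesis unfolding c_iff b_iff a_iff by simp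
qed

end
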